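(* Let $n$ and $k$ be integers with $n\ge k\ge 11$. Let $r$ be the remainder of $n-4$ when divided by $k-6+\lfloor (k-1)/2\rfloor$. Then (i) $ex_{\mathcal{P}}(n,C_k)=3n-6$ for all $n\le k-5+\lfloor (k-1)/2\rfloor$, and (ii) for all $n\ge k-4+\lfloor (k-1)/2\rfloor$, $$ex_{\mathcal{P}}(n,C_k)\ge\left(3-\frac{3-\frac{2}{k-1}}{k-6+\left\lfloor\frac{k-1}2\right\rfloor}\right)n+\frac{12+3r-\frac{8+2r}{k-1}}{k-6+\left\lfloor\frac{k-1}2\right\rfloor}+\frac{4}{k-1}-\min\{r+10,11\}.$$
   Context: All graphs are finite and simple. $C_k$ denotes the cycle on $k$ vertices. For a graph $H$, the planar Turán number $ex_{\mathcal{P}}(n,H)$ is the maximum number of edges in a planar graph on $n$ vertices that does not contain $H$ as a subgraph. *)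

theory Defs
  imports "HOL-Analysis.Analysis"
begin

text \<open>A finite simple graph is a pair of a finite vertex set and a set of edges, each edge being
  a two-element set of vertices.\<close>

type_synonym 'a sgraph = "'a set \<times> 'a set set"

abbreviation verts :: "'a sgraph \<Rightarrow> 'a set" where
  "verts G \<equiv> fst G"

abbreviation edges :: "'a sgraph \<Rightarrow> 'a set set" where
  "edges G \<equiv> snd G"

definition simple_graph :: "'a sgraph \<Rightarrow> bool" where
  "simple_graph G \<longleftrightarrow> finite (verts G) \<and> (\<forall>e\<in>edges G. e \<subseteq> verts G \<and> card e = 2)"

text \<open>\<open>G\<close> has a (not necessarily induced) subgraph isomorphic to \<open>H\<close>.\<close>

definition contains_subgraph :: "'a sgraph \<Rightarrow> 'b sgraph \<Rightarrow> bool" where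
  "contains_subgraph G H \<longleftrightarrow>
     (\<exists>f. inj_on f (verts H) \<and> f ` verts H \<subseteq> verts G \<and> (\<forall>e\<in>edges H. f ` e \<in> edges G))"

text \<open>The cycle on \<open>k\<close> vertices; meaningful for \<open>k \<ge> 3\<close> only.\<close>

definition cycle_graph :: "nat \<Rightarrow> nat sgraph" where
  "cycle_graph k = ({..<k}, {{i, (i + 1) mod k} | i. i < k})"

text \<open>A plane drawing places the vertices at distinct points \<open>p v\<close> of the plane (represented by
  the type of complex numbers) and draws every edge \<open>e\<close> as a simple arc \<open>\<gamma> e\<close> joining its two
  ends. An arc meets no vertices except its ends, and two arcs meet only in common ends.\<close>

definition plane_drawing ::
    "'a sgraph \<Rightarrow> ('a \<Rightarrow> complex) \<Rightarrow> ('a set \<Rightarrow> real \<Rightarrow> complex) \<Rightarrow> bool" where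
  "plane_drawing G p \<gamma> \<longleftrightarrow>
     inj_on p (verts G) \<and>
     (\<forall>e\<in>edges G. arc (\<gamma> e) \<and> {pathstart (\<gamma> e), pathfinish (\<gamma> e)} = p ` e \<and>
        path_image (\<gamma> e) \<inter> p ` verts G = p ` e) \<and>
     (\<forall>e\<in>edges G. \<forall>e'\<in>edges G. e \<noteq> e' \<longrightarrow>
        path_image (\<gamma> e) \<inter> path_image (\<gamma> e') \<subseteq> p ` (e \<inter> e'))"

definition planar :: "'a sgraph \<Rightarrow> bool" where
  "planar G \<longleftrightarrow> (\<exists>p \<gamma>. plane_drawing G p \<gamma>)"

text \<open>Every finite graph is isomorphic to one whose vertices are natural numbers, so it suffices
  to range over those. The set of edge numbers is finite, being bounded by \<open>n choose 2\<close>, and it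
  contains \<open>0\<close> whenever \<open>H\<close> has an edge; hence the maximum is attained.\<close>

definition ex_planar :: "nat \<Rightarrow> 'b sgraph \<Rightarrow> nat" where
  "ex_planar n H = Max {card (edges G) | G :: nat sgraph.
     simple_graph G \<and> card (verts G) = n \<and> planar G \<and> \<not> contains_subgraph G H}"

end

theory Submission
  imports Defs "HOL-Number_Theory.Cong"
begin

text \<open>
  Upper bound \<open>3 n - 6\<close>, by induction on the number of edges. A plane forest has fewer edges than
  vertices. Otherwise pick a cycle of length \<open>m\<close>; it suffices that the closed inside of the cycle, with
  \<open>n'\<close> vertices, carries at most \<open>3 n' - m - 3\<close> edges, since an inversion gives the same for the outside
  and the two bounds add up. If some path through the inside joins two vertices of the cycle, the Jordan
  curve theorem splits the inside along it. If there is none, deleting the cycle leaves its vertices in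
  \<open>m\<close> different components, each with at most three times as many edges as it has further vertices.

  Lower bound. Let \<open>s = (k - 1) div 2\<close>. In the triangulation \<open>K\<^sub>2 + P\<close> on \<open>s\<close> vertices insert a
  vertex into each of the \<open>2 s - 4\<close> faces (two adjacent ones in one face if \<open>k\<close> is even). The inserted
  vertices are independent, up to one edge, so a cycle has at most \<open>2 s\<close> (or \<open>2 s + 1\<close>) vertices, hence fewer
  than \<open>k\<close>. This block has \<open>D + 1\<close> vertices, where \<open>D = k - 6 + s\<close>. Blocks are strung together at
  cut vertices; identifying the two free ends of a chain of \<open>k + 1\<close> blocks saves a vertex without creating a
  \<open>k\<close>-cycle, because a cycle around the ring visits each of its blocks. All drawings are straight-line
  drawings, and the horizontal coordinate measures how many blocks a path must cross.
\<close>

section \<open>Paths, cycles and forests\<close>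

text \<open>Why rings pay off: with \<open>n - 4 = q * D + r\<close> the claimed bound equals
  \<open>3 n - 3 q + 2 (q + 2) / (k - 1) - min (r + 10) 11\<close>. A block glued on at a cut vertex
  brings \<open>D\<close> new vertices and \<open>3 D - 3\<close> new edges, so \<open>q\<close>
  blocks account for \<open>- 3 q\<close>. The vertex saved by a ring can be spent elsewhere and is
  worth three edges. Per ring that exceeds the \<open>2 (k + 1) / (k - 1)\<close> asked for by its
  \<open>k + 1\<close> blocks, even though the saved vertices eventually fill further blocks that
  lose three edges each. A cycle around the ring uses at least \<open>k\<close> edges to cross
  \<open>k\<close> blocks and at least one more to return, so it is too long. The term
  \<open>- m - 3\<close> for the inside of an \<open>m\<close>-cycle makes the upper bound additive:
  cutting along a path with \<open>l\<close> edges doubles \<open>l\<close> edges and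
  \<open>l + 1\<close> vertices and lengthens the two boundaries by \<open>2 l\<close> altogether,
  and everything cancels.\<close>

inductive gpath :: "'a set set \<Rightarrow> 'a \<Rightarrow> 'a \<Rightarrow> bool" where
  edge: "a \<noteq> b \<Longrightarrow> gpath {{a, b}} a b"
| step: "gpath F a b \<Longrightarrow> c \<notin> \<Union>F \<Longrightarrow> gpath (insert {b, c} F) a c"

lemma gpath_ends:
  "gpath F a b \<Longrightarrow> a \<noteq> b \<and> a \<in> \<Union>F \<and> b \<in> \<Union>F \<and> finite F \<and> F \<noteq> {}"
proof (induction rule: gpath.induct)
  case (step F a b c)
  then have "a \<noteq> c" by metis
  then show ?case using step by simp
qed simp

lemma gpath_card2: "gpath F a b \<Longrightarrow> e \<in> F \<Longrightarrow> card e = 2"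
proof (induction rule: gpath.induct)
  case (step F a b c)
  have "b \<noteq> c" using gpath_ends[OF step(1)] step(2) by metis
  then show ?case using step by auto
qed simp

lemma gpath_finite_verts: "gpath F a b \<Longrightarrow> finite (\<Union>F)"
  by (induction rule: gpath.induct) auto

lemma card_gpath: "gpath F a b \<Longrightarrow> card (\<Union>F) = card F + 1"
proof (induction rule: gpath.induct)
  case (step F a b c)
  have "b \<in> \<Union>F" "finite (\<Union>F)" "finite F"
    using gpath_ends[OF step(1)] gpath_finite_verts[OF step(1)] by auto
  moreover have "\<Union>(insert {b, c} F) = insert c (\<Union>F)" using \<open>b \<in> \<Union>F\<close> by auto
  moreover have "{b, c} \<notin> F" using step(2) by auto
  ultimately show ?case using step by simp
qed auto

lemma gpath_join:
  "gpath G b c \<Longrightarrow> gpath F a b \<Longrightarrow> \<Union>F \<inter> \<Union>G = {b} \<Longrightarrow> gpath (F \<union> G) a c"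
proof (induction rule: gpath.induct)
  case (edge b c)
  then have "c \<notin> \<Union>F" by auto
  then show ?case using gpath.step[OF edge(2)] by simp
next
  case (step G b c d)
  have b: "b \<in> \<Union>G" using gpath_ends[OF step(1)] by auto
  then have "d \<noteq> b" using step(2) by auto
  then have d: "d \<notin> \<Union>F" using step.prems(2) by auto
  have "\<Union>F \<inter> \<Union>G = {b}" using step.prems(2) b by auto
  then have "gpath (F \<union> G) a c" by (rule step.IH[OF step.prems(1)])
  moreover have "d \<notin> \<Union>(F \<union> G)" using d step(2) by simp
  ultimately show ?case using gpath.step by fastforce
qed

lemma gpath_sym: "gpath F a b \<Longrightarrow> gpath F b a"
proof (induction rule: gpath.induct)
  case (edge a b)
  then show ?case using gpath.edge[of b a] by (simp add: insert_commute)
next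
  case (step F a b c)
  have "b \<in> \<Union>F" using gpath_ends[OF step(1)] by auto
  then have "b \<noteq> c" using step(2) by auto
  then have "gpath {{c, b}} c b" by (intro gpath.edge) auto
  from gpath_join[OF step(3) this] step(2) \<open>b \<in> \<Union>F\<close> show ?case
    by (auto simp: insert_commute)
qed

lemma gpath_split:
  "gpath F a b \<Longrightarrow> x \<in> \<Union>F \<Longrightarrow> x \<noteq> a \<Longrightarrow> x \<noteq> b \<Longrightarrow>
    \<exists>F1 F2. F = F1 \<union> F2 \<and> gpath F1 a x \<and> gpath F2 x b \<and> \<Union>F1 \<inter> \<Union>F2 = {x}"
proof (induction rule: gpath.induct)
  case (step F a b c)
  have b: "b \<in> \<Union>F" using gpath_ends[OF step(1)] by auto
  then have bc: "b \<noteq> c" using step(2) by auto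
  show ?case
  proof (cases "x = b")
    case True
    have "\<Union>F \<inter> \<Union>{{b, c}} = {x}" using True b step(2) by auto
    then show ?thesis using True step(1) gpath.edge[OF bc]
      by (intro exI[of _ F] exI[of _ "{{b, c}}"]) simp
  next
    case False
    then have "x \<in> \<Union>F" using step.prems by auto
    then obtain F1 F2 where F: "F = F1 \<union> F2" "gpath F1 a x" "gpath F2 x b" "\<Union>F1 \<inter> \<Union>F2 = {x}"
      using step False by blast
    have "b \<in> \<Union>F2" using gpath_ends[OF F(3)] by auto
    have *: "gpath (insert {b, c} F2) x c" using F(1,3) step(2) by (intro gpath.step) simp_all
    have "c \<notin> \<Union>F1" using F(1) step(2) by simp
    moreover have "\<Union>(insert {b, c} F2) = insert c (\<Union>F2)"
      using \<open>b \<in> \<Union>F2\<close> by auto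
    ultimately have **: "\<Union>F1 \<inter> \<Union>(insert {b, c} F2) = {x}" using F(4) by simp
    have "insert {b, c} F = F1 \<union> insert {b, c} F2" using F(1) by simp
    with * ** F(2) show ?thesis
      by (intro exI[of _ F1] exI[of _ "insert {b, c} F2"] conjI) simp_all
  qed
qed auto

text \<open>An edge has two vertices and so cannot lie within the single shared vertex.\<close>

lemma gpath_Un_disjoint:
  assumes "gpath F a b" "\<Union>F \<inter> \<Union>G = {x}"
  shows "F \<inter> G = {}"
proof (rule ccontr)
  assume "F \<inter> G \<noteq> {}"
  then obtain e where "e \<in> F" "e \<in> G" by auto
  then have "card e = 2" "e \<subseteq> {x}" using gpath_card2[OF assms(1)] assms(2) by blast+
  then show False using card_mono[of "{x}" e] by auto
qed

section \<open>Connectivity, cycles and forests in terms of edge sets\<close>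

definition adj_rel :: "'a set set \<Rightarrow> ('a \<times> 'a) set" where
  "adj_rel E = {(u, v). {u, v} \<in> E}"

lemma sym_adj_rel: "sym (adj_rel E)"
  by (auto simp: sym_def adj_rel_def insert_commute)

lemma gpath_of_rtrancl:
  assumes "(x, y) \<in> (adj_rel E)\<^sup>*" "x \<noteq> y"
  shows "\<exists>F\<subseteq>E. gpath F x y"
  using assms
proof (induction rule: rtrancl_induct)
  case (step y z)
  have yz: "{y, z} \<in> E" using step(2) by (auto simp: adj_rel_def)
  show ?case
  proof (cases "x = y")
    case True
    then show ?thesis using yz gpath.edge[of x z] step.prems by (intro exI[of _ "{{y, z}}"]) auto
  next
    case False
    then obtain F where F: "F \<subseteq> E" "gpath F x y" using step by auto
    show ?thesis
    \<comment> \<open>If the new vertex was visited before, cutting the path there keeps it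
      simple.\<close>
    proof (cases "z \<in> \<Union>F")
      case True
      show ?thesis
      proof (cases "z = y")
        case False
        then show ?thesis using gpath_split[OF F(2) True] step.prems F by auto
      qed (use F in auto)
    next
      case False
      then show ?thesis using gpath.step[OF F(2)] F yz by (intro exI[of _ "insert {y, z} F"]) auto
    qed
  qed
qed auto

text \<open>A cycle with two marked vertices that cut it into two paths. The condition
  \<open>F1 \<inter> F2 = {}\<close> rules out the degenerate case in which both paths are the
  single edge \<open>{a, b}\<close>.\<close>

definition gcycle_at :: "'a set set \<Rightarrow> 'a \<Rightarrow> 'a \<Rightarrow> bool" where
  "gcycle_at F a b \<longleftrightarrow> (\<exists>F1 F2. gpath F1 a b \<and> gpath F2 a b \<and> F = F1 \<union> F2 \<and> F1 \<inter> F2 = {}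
     \<and> \<Union>F1 \<inter> \<Union>F2 = {a, b})"

definition gcycle :: "'a set set \<Rightarrow> bool" where
  "gcycle F \<longleftrightarrow> (\<exists>a b. gcycle_at F a b)"

lemma gcycle_at_sym:
  assumes "gcycle_at F a b"
  shows "gcycle_at F b a"
proof -
  have "{b, a} = {a, b}" by auto
  with assms show ?thesis
    unfolding gcycle_at_def by (simp only:) (blast intro: gpath_sym)
qed

text \<open>The part of the path through \<open>x\<close> that lies beyond \<open>x\<close> is
  handed over to the other path, which it continues at \<open>b\<close>. Moving one marked vertex at
  a time reaches every pair of vertices, in particular the two ends of a path through the
  inside.\<close>

lemma gcycle_at_shift:
  assumes "gcycle_at F a b" "x \<in> \<Union>F" "x \<noteq> a"
  shows "gcycle_at F a x"
proof (cases "x = b")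
  case False
  have *: "gcycle_at F a x"
    if F: "gpath F1 a b" "gpath F2 a b" "F = F1 \<union> F2" "F1 \<inter> F2 = {}" "\<Union>F1 \<inter> \<Union>F2 = {a, b}"
      and x: "x \<in> \<Union>F1" for F1 F2
  proof -
    obtain A B where AB: "F1 = A \<union> B" "gpath A a x" "gpath B x b" "\<Union>A \<inter> \<Union>B = {x}"
      using gpath_split[OF F(1) x assms(3) False] by blast
    have ends: "a \<in> \<Union>A" "b \<in> \<Union>B" "a \<in> \<Union>F2" "b \<in> \<Union>F2" "x \<in> \<Union>A" "x \<in> \<Union>B"
      using gpath_ends[OF AB(2)] gpath_ends[OF AB(3)] gpath_ends[OF F(2)] by auto
    then have n: "a \<notin> \<Union>B" "b \<notin> \<Union>A" using AB(4) assms(3) False by (metis IntI singletonD)+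
    have F1: "\<Union>F1 = \<Union>A \<union> \<Union>B" using AB(1) by auto
    have *: "P \<inter> R = {b} \<and> Q \<inter> P = {a} \<and> Q \<inter> (P \<union> R) = {a, x}"
      if "(Q \<union> R) \<inter> P = {a, b}" "a \<notin> R" "b \<notin> Q" "a \<in> Q" "b \<in> R" "Q \<inter> R = {x}" for P Q R :: "'a set"
      using that unfolding set_eq_iff Int_iff Un_iff insert_iff empty_iff by metis
    note ** = *[OF F(5)[unfolded F1] n ends(1,2) AB(4)]
    have "\<Union>F2 \<inter> \<Union>B = {b}" using ** by (elim conjE)
    from gpath_join[OF gpath_sym[OF AB(3)] F(2) this] have "gpath (F2 \<union> B) a x" .
    moreover have "A \<inter> B = {}" using gpath_Un_disjoint[OF AB(2) AB(4)] .
    then have "A \<inter> (F2 \<union> B) = {}" using F(4) AB(1) by auto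
    moreover have "\<Union>A \<inter> \<Union>(F2 \<union> B) = {a, x}" using ** by (simp only: Union_Un_distrib)
    moreover have "F = A \<union> (F2 \<union> B)" using F(3) AB(1) by blast
    ultimately show ?thesis unfolding gcycle_at_def using AB(2)
      by (intro exI[of _ A] exI[of _ "F2 \<union> B"] conjI)
  qed
  obtain F1 F2 where F: "gpath F1 a b" "gpath F2 a b" "F = F1 \<union> F2" "F1 \<inter> F2 = {}" "\<Union>F1 \<inter> \<Union>F2 = {a, b}"
    using assms(1) unfolding gcycle_at_def by blast
  consider "x \<in> \<Union>F1" | "x \<in> \<Union>F2" using assms(2) F(3) by auto
  then show ?thesis
  proof cases
    case 1 then show ?thesis by (rule *[OF F])
  next
    case 2 
    have "F = F2 \<union> F1" "F2 \<inter> F1 = {}" "\<Union>F2 \<inter> \<Union>F1 = {a, b}"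
      using F by (simp_all add: Un_commute Int_commute)
    then show ?thesis using *[OF F(2) F(1) _ _ _ 2] by simp
  qed
qed (use assms in simp)

lemma gcycle_at_any:
  assumes "gcycle F" "x \<in> \<Union>F" "y \<in> \<Union>F" "x \<noteq> y"
  shows "gcycle_at F x y"
proof -
  obtain a b where ab: "gcycle_at F a b" using assms(1) by (auto simp: gcycle_def)
  show ?thesis
  proof (cases "x = a")
    case True
    then show ?thesis using gcycle_at_shift[OF ab] assms by blast
  next
    case False
    then show ?thesis using gcycle_at_shift[OF gcycle_at_sym[OF gcycle_at_shift[OF ab assms(2)]]] assms
      by blast
  qed
qed

lemma gcycle_card:
  assumes "gcycle F"
  shows "finite F" "finite (\<Union>F)" "card (\<Union>F) = card F" "card F \<ge> 3"
proof -
  obtain a b F1 F2 where F: "gpath F1 a b" "gpath F2 a b" "F = F1 \<union> F2" "F1 \<inter> F2 = {}" "\<Union>F1 \<inter> \<Union>F2 = {a, b}"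
    using assms unfolding gcycle_def gcycle_at_def by blast
  have fin: "finite F1" "finite F2" "finite (\<Union>F1)" "finite (\<Union>F2)" "a \<noteq> b"
    using gpath_ends[OF F(1)] gpath_ends[OF F(2)] gpath_finite_verts[OF F(1)] gpath_finite_verts[OF F(2)]
      by auto
  show "finite F" "finite (\<Union>F)" using fin F(3) by auto
  have "card (\<Union>F1) + card (\<Union>F2) = card (\<Union>F) + 2"
    using card_Un_Int[OF fin(3,4)] F(3,5) fin(5) by (simp add: Union_Un_distrib)
  then show c: "card (\<Union>F) = card F"
    using card_gpath[OF F(1)] card_gpath[OF F(2)] card_Un_disjoint[OF fin(1,2) F(4)] F(3) by auto
  \<comment> \<open>Two one-edge paths with the same ends would share their edge, against
    edge-disjointness.\<close>
  have "\<not> (card F1 = 1 \<and> card F2 = 1)"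
  proof
    assume "card F1 = 1 \<and> card F2 = 1"
    then have "card (\<Union>F1) = 2" "card (\<Union>F2) = 2"
      using card_gpath[OF F(1)] card_gpath[OF F(2)] by simp_all
    then have "\<Union>F1 = {a, b}" "\<Union>F2 = {a, b}"
      using F(5) fin card_subset_eq[of "\<Union>F1" "{a,b}"] card_subset_eq[of "\<Union>F2" "{a,b}"]
      by (metis Int_lower1 Int_lower2 card_2_iff)+
    moreover obtain e1 e2 where "F1 = {e1}" "F2 = {e2}"
      using \<open>card F1 = 1 \<and> card F2 = 1\<close> by (auto simp: card_1_singleton_iff)
    ultimately show False using F(4) by auto
  qed
  moreover have "card F1 \<noteq> 0" "card F2 \<noteq> 0"
    using fin gpath_ends[OF F(1)] gpath_ends[OF F(2)] by auto
  ultimately have "card F1 + card F2 \<ge> 3" by linarith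
  then show "card F \<ge> 3" using card_Un_disjoint[OF fin(1,2) F(4)] F(3) by auto
qed

lemma gcycle_edge_gpath:
  assumes "gpath Q u v" "{u, v} \<notin> Q"
  shows "gcycle (insert {u, v} Q)"
proof -
  have "u \<noteq> v" "u \<in> \<Union>Q" "v \<in> \<Union>Q" using gpath_ends[OF assms(1)] by auto
  then show ?thesis unfolding gcycle_def gcycle_at_def
    using assms gpath.edge[of u v]
    by (intro exI[of _ u] exI[of _ v] exI[of _ "{{u,v}}"] exI[of _ Q]) auto
qed

text \<open>Deleting an edge of a forest creates one more component, so a set of pairwise disconnected
  vertices can be enlarged by one of the two ends of the deleted edge.\<close>

lemma forest_edge_bound:
  assumes "finite V" "X \<subseteq> V" "\<And>e. e \<in> E \<Longrightarrow> e \<subseteq> V \<and> card e = 2" "\<And>F. F \<subseteq> E \<Longrightarrow> \<not> gcycle F"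
    "\<And>x y. x \<in> X \<Longrightarrow> y \<in> X \<Longrightarrow> x \<noteq> y \<Longrightarrow> (x, y) \<notin> (adj_rel E)\<^sup>*"
  shows "card E + card X \<le> card V"
proof -
  have "finite E" using assms(1,3) by (meson Pow_iff finite_Pow_iff finite_subset subsetI)
  then show ?thesis using assms(2-5)
  proof (induction E arbitrary: X rule: finite_induct)
    case empty
    then show ?case using assms(1) by (simp add: card_mono)
  next
    case (insert e E)
    obtain u v where uv: "e = {u, v}" "u \<noteq> v" using insert.prems(2)[of e] by (auto simp: card_2_iff)
    let ?R = "(adj_rel E)\<^sup>*" and ?S = "(adj_rel (insert e E))\<^sup>*"
    have sR: "sym ?R" and sS: "sym ?S" by (simp_all add: sym_adj_rel sym_rtrancl)
    have tR: "trans ?R" and tS: "trans ?S" by (simp_all add: trans_rtrancl)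
    have mono: "?R \<subseteq> ?S" by (intro rtrancl_mono) (auto simp: adj_rel_def)
    have uvS: "(u, v) \<in> ?S" using uv by (auto simp: adj_rel_def)
    have uvR: "(u, v) \<notin> ?R"
    proof
      assume "(u, v) \<in> ?R"
      then obtain Q where Q: "Q \<subseteq> E" "gpath Q u v" using gpath_of_rtrancl uv(2) by metis
      then have "gcycle (insert e Q)" using gcycle_edge_gpath[OF Q(2)] insert.hyps(2) uv(1) by auto
      then show False using insert.prems(3)[of "insert e Q"] Q(1) by blast
    qed
    have "\<exists>w\<in>{u, v}. \<forall>x\<in>X. (x, w) \<notin> ?R"
    proof (rule ccontr)
      assume "\<not> ?thesis"
      then obtain x y where xy: "x \<in> X" "y \<in> X" "(x, u) \<in> ?R" "(y, v) \<in> ?R" by auto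
      then have "(x, y) \<in> ?S" using mono uvS tS sS by (meson subsetD symD transD)
      then have "x = y" using insert.prems(4) xy by blast
      then show False using xy uvR tR sR by (meson symD transD)
    qed
    then obtain w where w: "w \<in> {u, v}" "\<And>x. x \<in> X \<Longrightarrow> (x, w) \<notin> ?R" by blast
    then have wX: "w \<notin> X" by auto
    have "card E + card (insert w X) \<le> card V"
    proof (rule insert.IH)
      show "insert w X \<subseteq> V" using insert.prems(1,2) uv w(1) by auto
      show "\<not> gcycle F" if "F \<subseteq> E" for F using insert.prems(3) that by blast
      show "(x, y) \<notin> ?R" if "x \<in> insert w X" "y \<in> insert w X" "x \<noteq> y" for x y
      proof -
        have "(x, y) \<notin> ?R" if "x \<in> X" "y \<in> X" "x \<noteq> y" for x y
          using that insert.prems(4) mono by blast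
        moreover have "(w, x) \<notin> ?R" if "x \<in> X" for x
          using w(2)[OF that] sR by (meson symD)
        ultimately show ?thesis using that w(2) by auto
      qed
    qed (use insert.prems(2) in auto)
    then show ?case using insert.hyps insert.prems(1) wX assms(1) finite_subset[of X V] by simp
  qed
qed

section \<open>Plane graphs and the Jordan curve theorem\<close>

locale plane_graph =
  fixes V :: "'a set" and E :: "'a set set" and p :: "'a \<Rightarrow> complex"
    and \<gamma> :: "'a set \<Rightarrow> real \<Rightarrow> complex"
  assumes simple: "simple_graph (V, E)" and drawing: "plane_drawing (V, E) p \<gamma>"
begin

lemma finite_verts: "finite V" and edge_subset: "e \<in> E \<Longrightarrow> e \<subseteq> V" and edge_card: "e \<in> E \<Longrightarrow> card e = 2"
  using simple by (auto simp: simple_graph_def)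

lemma finite_edges: "finite E"
proof (rule finite_subset)
  show "E \<subseteq> Pow V" using edge_subset by auto
qed (simp add: finite_verts)

lemma inj_p: "inj_on p V"
  using drawing by (simp add: plane_drawing_def)

lemma edge_arc:
  assumes "e \<in> E"
  shows "arc (\<gamma> e)" "{pathstart (\<gamma> e), pathfinish (\<gamma> e)} = p ` e"
    "path_image (\<gamma> e) \<inter> p ` V = p ` e"
  using drawing assms by (simp_all add: plane_drawing_def)

lemma edge_Int:
  "e \<in> E \<Longrightarrow> e' \<in> E \<Longrightarrow> e \<noteq> e' \<Longrightarrow> path_image (\<gamma> e) \<inter> path_image (\<gamma> e') \<subseteq> p ` (e \<inter> e')"
  using drawing by (simp add: plane_drawing_def)

lemma ends_in_path_image: "e \<in> E \<Longrightarrow> p ` e \<subseteq> path_image (\<gamma> e)"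
  using edge_arc(3) by blast

definition img :: "'a set set \<Rightarrow> complex set" where
  "img F = (\<Union>e\<in>F. path_image (\<gamma> e))"

lemma img_Un: "img (F \<union> G) = img F \<union> img G"
  by (auto simp: img_def)

lemma img_edge: "e \<in> F \<Longrightarrow> path_image (\<gamma> e) \<subseteq> img F"
  by (auto simp: img_def)

lemma vert_img:
  assumes "F \<subseteq> E" "v \<in> V"
  shows "p v \<in> img F \<longleftrightarrow> v \<in> \<Union>F"
proof
  assume "p v \<in> img F"
  then obtain e where e: "e \<in> F" "p v \<in> path_image (\<gamma> e)" by (auto simp: img_def)
  then have "e \<in> E" using assms(1) by auto
  then have "p v \<in> p ` e" using edge_arc(3) e assms(2) by blast
  then have "v \<in> e" using inj_p edge_subset[OF \<open>e \<in> E\<close>] assms(2) by (auto simp: inj_on_def)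
  then show "v \<in> \<Union>F" using e(1) by blast
next
  assume "v \<in> \<Union>F"
  then obtain e where "e \<in> F" "v \<in> e" by auto
  then show "p v \<in> img F" using ends_in_path_image[of e] assms(1) by (auto simp: img_def)
qed

lemma img_Int:
  assumes "F \<subseteq> E" "G \<subseteq> E" "F \<inter> G = {}"
  shows "img F \<inter> img G = p ` (\<Union>F \<inter> \<Union>G)"
proof
  show "img F \<inter> img G \<subseteq> p ` (\<Union>F \<inter> \<Union>G)"
  proof
    fix x assume "x \<in> img F \<inter> img G"
    then obtain e e' where e: "e \<in> F" "e' \<in> G" "x \<in> path_image (\<gamma> e) \<inter> path_image (\<gamma> e')"
      by (auto simp: img_def)
    then have "e \<in> E" "e' \<in> E" "e \<noteq> e'" using assms by auto
    then have "x \<in> p ` (e \<inter> e')" using edge_Int e(3) by blast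
    then show "x \<in> p ` (\<Union>F \<inter> \<Union>G)" using e by auto
  qed
next
  have "\<Union>F \<subseteq> V" using edge_subset assms(1) by auto
  then show "p ` (\<Union>F \<inter> \<Union>G) \<subseteq> img F \<inter> img G"
    using vert_img assms by auto
qed

lemma edge_path_oriented:
  assumes "{a, b} \<in> E"
  shows "\<exists>g. arc g \<and> pathstart g = p a \<and> pathfinish g = p b \<and> path_image g = path_image (\<gamma> {a, b})"
proof -
  have "{pathstart (\<gamma> {a, b}), pathfinish (\<gamma> {a, b})} = {p a, p b}" using edge_arc(2)[OF assms] by simp
  then consider "pathstart (\<gamma> {a, b}) = p a" "pathfinish (\<gamma> {a, b}) = p b"
    | "pathstart (\<gamma> {a, b}) = p b" "pathfinish (\<gamma> {a, b}) = p a"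
    by (auto simp: doubleton_eq_iff)
  then show ?thesis
  proof cases
    case 1 then show ?thesis using edge_arc(1)[OF assms] by blast
  next
    case 2 then show ?thesis using edge_arc(1)[OF assms]
      by (intro exI[of _ "reversepath (\<gamma> {a, b})"]) (simp add: arc_reversepath)
  qed
qed

lemma gpath_arc:
  "gpath F a b \<Longrightarrow> F \<subseteq> E \<Longrightarrow>
    \<exists>g. arc g \<and> pathstart g = p a \<and> pathfinish g = p b \<and> path_image g = img F"
proof (induction rule: gpath.induct)
  case (edge a b)
  then show ?case using edge_path_oriented[of a b] by (auto simp: img_def)
next
  case (step F a b c)
  then obtain g where g: "arc g" "pathstart g = p a" "pathfinish g = p b" "path_image g = img F"
    by auto
  have bcE: "{b, c} \<in> E" using step.prems by simp
  obtain h where h: "arc h" "pathstart h = p b" "pathfinish h = p c" "path_image h = img {{b, c}}"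
    using edge_path_oriented[OF bcE] by (auto simp: img_def)
  have "{b, c} \<notin> F" using step(2) by auto
  then have "img F \<inter> img {{b, c}} = p ` (\<Union>F \<inter> {b, c})"
    using img_Int[of F "{{b, c}}"] step.prems by simp
  then have "path_image g \<inter> path_image h \<subseteq> {pathstart h}" using step(2) g h by auto
  then have "arc (g +++ h)" using arc_join g h by metis
  moreover have "img (insert {b, c} F) = img F \<union> img {{b, c}}" by (auto simp: img_def)
  ultimately show ?case using g h by (intro exI[of _ "g +++ h"]) (simp add: path_image_join)
qed

lemma gcycle_loop:
  assumes "gcycle F" "F \<subseteq> E"
  shows "\<exists>c. simple_path c \<and> pathfinish c = pathstart c \<and> path_image c = img F"
proof -
  obtain a b F1 F2 where F: "gpath F1 a b" "gpath F2 a b" "F = F1 \<union> F2" "F1 \<inter> F2 = {}" "\<Union>F1 \<inter> \<Union>F2 = {a, b}"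
    using assms(1) unfolding gcycle_def gcycle_at_def by blast
  have sub: "F1 \<subseteq> E" "F2 \<subseteq> E" using F(3) assms(2) by auto
  obtain g where g: "arc g" "pathstart g = p a" "pathfinish g = p b" "path_image g = img F1"
    using gpath_arc[OF F(1) sub(1)] by blast
  obtain h where h: "arc h" "pathstart h = p b" "pathfinish h = p a" "path_image h = img F2"
    using gpath_arc[OF gpath_sym[OF F(2)] sub(2)] by blast
  have "path_image g \<inter> path_image h = {p a, p b}"
    using img_Int[OF sub F(4)] F(5) g h by simp
  then have "simple_path (g +++ h)" using g h by (intro simple_path_join_loop) auto
  then show ?thesis using g h F(3) by (intro exI[of _ "g +++ h"]) (simp add: path_image_join img_Un)
qed

lemma Jordan_gcycle:
  assumes "gcycle F" "F \<subseteq> E"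
  shows "inside (img F) \<noteq> {}" "open (inside (img F))" "connected (inside (img F))"
    "open (outside (img F))" "connected (outside (img F))" "\<not> bounded (outside (img F))"
    "bounded (inside (img F))" "outside (img F) \<noteq> {}"
    "closure (inside (img F)) = img F \<union> inside (img F)"
    "closure (outside (img F)) = img F \<union> outside (img F)"
proof -
  obtain c where c: "simple_path c" "pathfinish c = pathstart c" "path_image c = img F"
    using gcycle_loop[OF assms] by blast
  note J = Jordan_inside_outside[OF c(1,2), unfolded c(3)]
  show "inside (img F) \<noteq> {}" "open (inside (img F))" "connected (inside (img F))"
    "open (outside (img F))" "connected (outside (img F))" "\<not> bounded (outside (img F))"
    "bounded (inside (img F))" "outside (img F) \<noteq> {}"
    using J by auto
  show "closure (inside (img F)) = img F \<union> inside (img F)"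
    "closure (outside (img F)) = img F \<union> outside (img F)"
    using J closure_Un_frontier by auto
qed

text \<open>The arc of an edge without its ends is connected and avoids every set of other edges, so
  it lies on one side of any cycle not containing the edge. Taking closures then puts the whole arc
  on that side.\<close>

definition open_edge :: "'a set \<Rightarrow> complex set" where
  "open_edge e = path_image (\<gamma> e) - p ` e"

lemma open_edge:
  assumes "e \<in> E"
  shows "connected (open_edge e)" "open_edge e \<noteq> {}" "path_image (\<gamma> e) \<subseteq> closure (open_edge e)"
proof -
  let ?g = "\<gamma> e"
  have sp: "simple_path ?g" using edge_arc(1)[OF assms] by (rule arc_imp_simple_path)
  have eq: "open_edge e = path_image ?g - {pathstart ?g, pathfinish ?g}"
    using edge_arc(2)[OF assms] by (simp add: open_edge_def)
  show "connected (open_edge e)" unfolding eq by (rule connected_simple_path_endless[OF sp])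
  show "open_edge e \<noteq> {}" unfolding eq by (rule nonempty_simple_path_endless[OF sp])
  have "?g ` closure {0<..<1} \<subseteq> closure (?g ` {0<..<1})"
    using sp by (intro image_closure_subset) (auto simp: simple_path_def path_def closure_subset)
  moreover have "open_edge e = ?g ` {0<..<1}" unfolding eq by (rule simple_path_endless[OF sp])
  ultimately show "path_image ?g \<subseteq> closure (open_edge e)" by (simp add: path_image_def)
qed

lemma open_edge_disjoint:
  assumes "e \<in> E" "F \<subseteq> E" "e \<notin> F"
  shows "open_edge e \<inter> img F = {}"
proof -
  have "img {e} \<inter> img F = p ` (\<Union>{e} \<inter> \<Union>F)" by (rule img_Int) (use assms in auto)
  then show ?thesis by (auto simp: img_def open_edge_def)
qed

lemma open_edge_img: "e \<in> F \<Longrightarrow> open_edge e \<subseteq> img F"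
  using img_edge by (auto simp: open_edge_def)

lemma edge_in_closure:
  assumes "e \<in> E" "open_edge e \<subseteq> A"
  shows "path_image (\<gamma> e) \<subseteq> closure A"
  using open_edge(3)[OF assms(1)] closure_mono[OF assms(2)] by blast

lemma subgraph:
  assumes "V' \<subseteq> V" "E' \<subseteq> E" "\<And>e. e \<in> E' \<Longrightarrow> e \<subseteq> V'"
  shows "plane_graph V' E' p \<gamma>"
proof
  show "simple_graph (V', E')"
    using assms finite_subset[OF assms(1) finite_verts] edge_card by (auto simp: simple_graph_def)
  have "path_image (\<gamma> e) \<inter> p ` V' = p ` e" if "e \<in> E'" for e
    using edge_arc(3)[of e] that assms by blast
  then show "plane_drawing (V', E') p \<gamma>"
    using assms inj_on_subset[OF inj_p assms(1)] edge_arc(1,2) edge_Int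
    unfolding plane_drawing_def by (auto simp: subset_iff)
qed

end

section \<open>The edge bound for planar graphs\<close>

text \<open>The induction hypothesis of the edge bound. The graphs are quantified inside, so the
  type argument fixes their vertex type; \<open>+ 6\<close> on the left avoids truncated
  subtraction.\<close>

definition edge_bound_below :: "nat \<Rightarrow> 'a itself \<Rightarrow> bool" where
  "edge_bound_below N _ \<longleftrightarrow> (\<forall>(V :: 'a set) E p \<gamma>. plane_graph V E p \<gamma> \<longrightarrow> card E < N \<longrightarrow> 3 \<le> card V \<longrightarrow>
     card E + 6 \<le> 3 * card V)"

text \<open>Giving up three edges extends the bound to one vertex (no edge) and two vertices (at
  most one edge), so that it applies to every component.\<close>

lemma edge_bound_nonempty:
  fixes V :: "'a set"
  assumes "edge_bound_below N TYPE('a)" "plane_graph V E p \<gamma>" "card E < N" "V \<noteq> {}"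
  shows "card E + 3 \<le> 3 * card V"
proof (cases "3 \<le> card V")
  case True
  then show ?thesis using assms unfolding edge_bound_below_def by fastforce
next
  case False
  interpret plane_graph V E p \<gamma> by fact
  have pos: "card V \<ge> 1" using finite_verts assms(4) by (simp add: Suc_le_eq card_gt_0_iff)
  have "e = V \<and> card V = 2" if "e \<in> E" for e
  proof -
    have "e \<subseteq> V" "card e = 2" using that edge_subset edge_card by auto
    moreover from this have "card e \<le> card V" using finite_verts card_mono by blast
    ultimately show ?thesis using False finite_verts card_subset_eq[of V e] by auto
  qed
  then have "E = {} \<or> E = {V} \<and> card V = 2" by blast
  then show ?thesis using pos by auto
qed

text \<open>Split off the component \<open>K\<close> of one vertex of \<open>X\<close>: it has at
  most \<open>3 * card K - 3\<close> edges, and the other vertices of \<open>X\<close> stay pairwise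
  disconnected in the rest. Each element of \<open>X\<close> thus contributes its own deficit of
  three.\<close>

lemma components_edge_bound:
  fixes V :: "'a set"
  assumes "edge_bound_below N TYPE('a)" "finite X" "plane_graph V E p \<gamma>" "card E < N" "X \<subseteq> V"
    "\<And>x y. x \<in> X \<Longrightarrow> y \<in> X \<Longrightarrow> x \<noteq> y \<Longrightarrow> (x, y) \<notin> (adj_rel E)\<^sup>*"
  shows "card E + 3 * card X \<le> 3 * card V"
  using assms(2-)
proof (induction X arbitrary: V E rule: finite_induct)
  case empty
  interpret plane_graph V E p \<gamma> by fact
  show ?case
  proof (cases "V = {}")
    case True
    then have "E = {}" using edge_subset edge_card by fastforce
    then show ?thesis by simp
  next
    case False
    then show ?thesis using edge_bound_nonempty[OF assms(1) empty(1,2)] by simp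
  qed
next
  case (insert x X)
  interpret plane_graph V E p \<gamma> by fact
  define K where "K = {v \<in> V. (x, v) \<in> (adj_rel E)\<^sup>*}"
  define E1 where "E1 = {e \<in> E. e \<subseteq> K}"
  define E2 where "E2 = {e \<in> E. e \<subseteq> V - K}"
  have xK: "x \<in> K" "x \<in> V" using insert.prems by (auto simp: K_def)
  have KV: "K \<subseteq> V" by (auto simp: K_def)
  have E: "E = E1 \<union> E2"
  proof -
    have "e \<subseteq> K \<or> e \<subseteq> V - K" if e: "e \<in> E" for e
    proof -
      obtain u v where uv: "e = {u, v}" using edge_card[OF e] by (auto simp: card_2_iff)
      then have "(u, v) \<in> adj_rel E" "(v, u) \<in> adj_rel E" "u \<in> V" "v \<in> V"
        using e edge_subset[OF e] by (auto simp: adj_rel_def insert_commute)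
      then have "u \<in> K \<longleftrightarrow> v \<in> K" unfolding K_def by (auto intro: rtrancl_into_rtrancl)
      then show ?thesis using uv \<open>u \<in> V\<close> \<open>v \<in> V\<close> by auto
    qed
    then show ?thesis unfolding E1_def E2_def by auto
  qed
  have disj: "E1 \<inter> E2 = {}"
  proof -
    have "e = {}" if "e \<in> E1 \<inter> E2" for e using that by (auto simp: E1_def E2_def)
    then show ?thesis using edge_card E by fastforce
  qed
  have fin: "finite E1" "finite E2" using finite_edges E by auto
  have sub: "E1 \<subseteq> E" "E2 \<subseteq> E" using E by auto
  have p1: "plane_graph K E1 p \<gamma>" by (rule subgraph) (use KV sub in \<open>auto simp: E1_def\<close>)
  have p2: "plane_graph (V - K) E2 p \<gamma>" by (rule subgraph) (use sub in \<open>auto simp: E2_def\<close>)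
  have c: "card E1 < N" "card E2 < N"
    using insert.prems(2) card_mono[OF finite_edges sub(1)] card_mono[OF finite_edges sub(2)] by auto
  have "card E1 + 3 \<le> 3 * card K"
    using edge_bound_nonempty[OF assms(1) p1 c(1)] xK by auto
  moreover have "card E2 + 3 * card X \<le> 3 * card (V - K)"
  proof (rule insert.IH[OF p2 c(2)])
    show "X \<subseteq> V - K"
    proof
      fix y assume y: "y \<in> X"
      then have "(x, y) \<notin> (adj_rel E)\<^sup>*" using insert.prems(4)[of x y] insert.hyps(2) by auto
      then show "y \<in> V - K" using y insert.prems(3) by (auto simp: K_def)
    qed
    have mono: "(adj_rel E2)\<^sup>* \<subseteq> (adj_rel E)\<^sup>*"
      by (intro rtrancl_mono) (use sub(2) in \<open>auto simp: adj_rel_def\<close>)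
    fix u v assume "u \<in> X" "v \<in> X" "u \<noteq> v"
    then have "(u, v) \<notin> (adj_rel E)\<^sup>*" using insert.prems(4) by simp
    then show "(u, v) \<notin> (adj_rel E2)\<^sup>*" using mono by blast
  qed
  moreover have "card E = card E1 + card E2" using E disj fin by (simp add: card_Un_disjoint)
  moreover have "card V = card K + card (V - K)"
    using KV finite_verts finite_subset[OF KV] by (simp add: card_Diff_subset card_mono)
  moreover have "card (insert x X) = card X + 1" using insert.hyps by simp
  ultimately show ?case by linarith
qed

text \<open>The paths \<open>F1\<close>, \<open>F2\<close> and \<open>Q\<close> form a theta graph
  with \<open>Q\<close> running through the inside of \<open>F1 \<union> F2\<close>. By the theta
  form of the Jordan curve theorem \<open>Q\<close> cuts this inside into the insides of
  \<open>F1 \<union> Q\<close> and \<open>F2 \<union> Q\<close>, and every further edge, being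
  connected, falls on one side.\<close>

lemma inside_ear_split:
  assumes G: "plane_graph V E p \<gamma>"
    and F: "gpath F1 a b" "gpath F2 a b" "F1 \<union> F2 \<subseteq> E" "F1 \<inter> F2 = {}" "\<Union>F1 \<inter> \<Union>F2 = {a, b}"
    and Q: "gpath Q a b" "Q \<subseteq> E" "Q \<inter> (F1 \<union> F2) = {}" "\<Union>Q \<inter> \<Union>(F1 \<union> F2) = {a, b}"
    and in_V: "\<And>v. v \<in> V \<Longrightarrow> p v \<in> plane_graph.img \<gamma> (F1 \<union> F2) \<union> inside (plane_graph.img \<gamma> (F1 \<union> F2))"
    and in_E: "\<And>e. e \<in> E \<Longrightarrow> path_image (\<gamma> e) \<subseteq>
      plane_graph.img \<gamma> (F1 \<union> F2) \<union> inside (plane_graph.img \<gamma> (F1 \<union> F2))"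
  obtains V1 E1 V2 E2 where "plane_graph V1 E1 p \<gamma>" "plane_graph V2 E2 p \<gamma>"
    "V1 \<union> V2 = V" "V1 \<inter> V2 = \<Union>Q" "E1 \<union> E2 = E" "E1 \<inter> E2 = Q" "E1 \<inter> F2 = {}" "E2 \<inter> F1 = {}"
    "F1 \<union> Q \<subseteq> E1" "F2 \<union> Q \<subseteq> E2"
    "\<And>v. v \<in> V1 \<Longrightarrow> p v \<in> plane_graph.img \<gamma> (F1 \<union> Q) \<union> inside (plane_graph.img \<gamma> (F1 \<union> Q))"
    "\<And>v. v \<in> V2 \<Longrightarrow> p v \<in> plane_graph.img \<gamma> (F2 \<union> Q) \<union> inside (plane_graph.img \<gamma> (F2 \<union> Q))"
    "\<And>e. e \<in> E1 \<Longrightarrow> path_image (\<gamma> e) \<subseteq> plane_graph.img \<gamma> (F1 \<union> Q) \<union> inside (plane_graph.img \<gamma> (F1 \<union> Q))"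
    "\<And>e. e \<in> E2 \<Longrightarrow> path_image (\<gamma> e) \<subseteq> plane_graph.img \<gamma> (F2 \<union> Q) \<union> inside (plane_graph.img \<gamma> (F2 \<union> Q))"
proof -
  interpret plane_graph V E p \<gamma> by fact
  have sub: "F1 \<subseteq> E" "F2 \<subseteq> E" using F(3) by auto
  have ab: "a \<noteq> b" "a \<in> \<Union>F1" "b \<in> \<Union>F1" "a \<in> \<Union>F2" "b \<in> \<Union>F2" "a \<in> \<Union>Q" "b \<in> \<Union>Q"
    using gpath_ends[OF F(1)] gpath_ends[OF F(2)] gpath_ends[OF Q(1)] by auto
  have QF: "Q \<inter> F1 = {}" "Q \<inter> F2 = {}" using Q(3) by auto
  have uni: "\<Union>F1 \<inter> \<Union>Q = {a, b}" "\<Union>F2 \<inter> \<Union>Q = {a, b}"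
  proof -
    have *: "A \<inter> C = {a, b} \<and> B \<inter> C = {a, b}"
      if "C \<inter> (A \<union> B) = {a, b}" "a \<in> A" "b \<in> A" "a \<in> B" "b \<in> B" for A B C :: "'a set"
      using that by blast
    show "\<Union>F1 \<inter> \<Union>Q = {a, b}" "\<Union>F2 \<inter> \<Union>Q = {a, b}"
      using *[OF Q(4)[unfolded Union_Un_distrib] ab(2-5)] by simp_all
  qed
  have abV: "a \<in> V" "b \<in> V" using ab(2,3) edge_subset sub(1) by auto
  have pab: "p a \<noteq> p b" using inj_p ab(1) abV by (auto simp: inj_on_def)
  obtain c1 where c1: "arc c1" "pathstart c1 = p a" "pathfinish c1 = p b" "path_image c1 = img F1"
    using gpath_arc[OF F(1) sub(1)] by blast
  obtain c2 where c2: "arc c2" "pathstart c2 = p a" "pathfinish c2 = p b" "path_image c2 = img F2"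
    using gpath_arc[OF F(2) sub(2)] by blast
  obtain c where c: "arc c" "pathstart c = p a" "pathfinish c = p b" "path_image c = img Q"
    using gpath_arc[OF Q(1,2)] by blast
  have I12: "img F1 \<inter> img F2 = {p a, p b}" using img_Int[OF sub F(4)] F(5) by simp
  have I1Q: "img F1 \<inter> img Q = {p a, p b}" using img_Int[OF sub(1) Q(2)] QF uni by (simp add: Int_commute)
  have I2Q: "img F2 \<inter> img Q = {p a, p b}" using img_Int[OF sub(2) Q(2)] QF uni by (simp add: Int_commute)
  \<comment> \<open>The splitting theorem requires that \<open>Q\<close> really enters the inside;
    the open arc of any edge of \<open>Q\<close> is a witness, since it avoids the cycle.\<close>
  obtain e0 where e0: "e0 \<in> Q" using gpath_ends[OF Q(1)] by auto
  have e0d: "open_edge e0 \<inter> img (F1 \<union> F2) = {}" using open_edge_disjoint[of e0 "F1 \<union> F2"] e0 Q(2,3) sub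
    by blast
  have "open_edge e0 \<subseteq> path_image (\<gamma> e0)" by (auto simp: open_edge_def)
  then have "open_edge e0 \<subseteq> inside (img (F1 \<union> F2))"
    using in_E[of e0] e0 Q(2) e0d by blast
  then have ne: "path_image c \<inter> inside (path_image c1 \<union> path_image c2) \<noteq> {}"
    using open_edge(2)[of e0] open_edge_img[OF e0] e0 Q(2) unfolding c(4) c1(4) c2(4) img_Un by blast
  define I where "I = inside (img (F1 \<union> F2))"
  define I1 where "I1 = inside (img (F1 \<union> Q))"
  define I2 where "I2 = inside (img (F2 \<union> Q))"
  have split: "I1 \<inter> I2 = {}" "I1 \<union> I2 \<union> (img Q - {p a, p b}) = I"
    using split_inside_simple_closed_curve[OF arc_imp_simple_path[OF c1(1)] c1(2,3)
      arc_imp_simple_path[OF c2(1)] c2(2,3) arc_imp_simple_path[OF c(1)] c(2,3) pab] I12 I1Q I2Q ne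
    unfolding c1(4) c2(4) c(4) I_def I1_def I2_def img_Un by blast+
  have gc: "gcycle (F1 \<union> Q)" "gcycle (F2 \<union> Q)"
    unfolding gcycle_def gcycle_at_def using F(1,2) Q(1) QF uni by (metis Int_commute)+
  have subs: "F1 \<union> Q \<subseteq> E" "F2 \<union> Q \<subseteq> E" using sub Q(2) by auto
  have op: "open I1" "open I2" unfolding I1_def I2_def
    using Jordan_gcycle(2)[OF gc(1) subs(1)] Jordan_gcycle(2)[OF gc(2) subs(2)] .
  have cl: "closure I1 = img (F1 \<union> Q) \<union> I1" "closure I2 = img (F2 \<union> Q) \<union> I2"
    unfolding I1_def I2_def
    using Jordan_gcycle(9)[OF gc(1) subs(1)] Jordan_gcycle(9)[OF gc(2) subs(2)] .
  have noov: "I \<inter> img (F1 \<union> F2) = {}" "I1 \<inter> img (F1 \<union> Q) = {}" "I2 \<inter> img (F2 \<union> Q) = {}"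
    unfolding I_def I1_def I2_def by (simp_all add: inside_no_overlap)
  define D1 where "D1 = img (F1 \<union> Q) \<union> I1"
  define D2 where "D2 = img (F2 \<union> Q) \<union> I2"
  have D12: "D1 \<inter> D2 = img Q"
    using split noov I12 I1Q I2Q unfolding D1_def D2_def img_Un by blast
  have DU: "img (F1 \<union> F2) \<union> I \<subseteq> D1 \<union> D2"
    using split unfolding D1_def D2_def img_Un by blast
  define V1 where "V1 = {v \<in> V. p v \<in> D1}"
  define V2 where "V2 = {v \<in> V. p v \<in> D2}"
  define E1 where "E1 = {e \<in> E. path_image (\<gamma> e) \<subseteq> D1}"
  define E2 where "E2 = {e \<in> E. path_image (\<gamma> e) \<subseteq> D2}"
  show thesis
  proof
    have "e \<subseteq> V1" if "e \<in> E1" for e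
      using that ends_in_path_image[of e] edge_subset[of e] by (auto simp: E1_def V1_def)
    then show "plane_graph V1 E1 p \<gamma>" by (intro subgraph) (auto simp: E1_def V1_def)
    have "e \<subseteq> V2" if "e \<in> E2" for e
      using that ends_in_path_image[of e] edge_subset[of e] by (auto simp: E2_def V2_def)
    then show "plane_graph V2 E2 p \<gamma>" by (intro subgraph) (auto simp: E2_def V2_def)
    show "V1 \<union> V2 = V" using in_V DU unfolding V1_def V2_def I_def by blast
    have "V1 \<inter> V2 = {v \<in> V. p v \<in> img Q}" using D12 by (auto simp: V1_def V2_def)
    moreover have "\<Union>Q \<subseteq> V" using Q(2) edge_subset by auto
    ultimately show "V1 \<inter> V2 = \<Union>Q" using vert_img[OF Q(2)] by auto
    have oe: "open_edge e \<subseteq> path_image (\<gamma> e)" for e by (auto simp: open_edge_def)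
    have "E \<subseteq> E1 \<union> E2"
    proof
      fix e assume e: "e \<in> E"
      consider "e \<in> F1 \<union> Q" | "e \<in> F2 \<union> Q" | "e \<notin> F1 \<union> F2 \<union> Q" by blast
      then show "e \<in> E1 \<union> E2"
      proof cases
        case 1 then show ?thesis using e img_edge[of e "F1 \<union> Q"] by (auto simp: E1_def D1_def)
      next
        case 2 then show ?thesis using e img_edge[of e "F2 \<union> Q"] by (auto simp: E2_def D2_def)
      next
        case 3
        \<comment> \<open>The open arc avoids the whole theta graph, so it lies in
          \<open>I1 \<union> I2\<close> and, being connected, in one of the two open sets; its ends
          follow by closure.\<close>
        have "open_edge e \<inter> img (F1 \<union> F2 \<union> Q) = {}"
          by (rule open_edge_disjoint) (use 3 e sub Q(2) in auto)
        then have "open_edge e \<subseteq> I1 \<union> I2"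
          using in_E[OF e] oe[of e] split(2) unfolding I_def img_Un by blast
        moreover have "open_edge e \<inter> I1 = {} \<or> open_edge e \<inter> I2 = {}"
          using connectedD[OF open_edge(1)[OF e] op] split(1) calculation by blast
        ultimately have "open_edge e \<subseteq> I1 \<or> open_edge e \<subseteq> I2" by blast
        then have "path_image (\<gamma> e) \<subseteq> D1 \<or> path_image (\<gamma> e) \<subseteq> D2"
          using edge_in_closure[OF e] cl unfolding D1_def D2_def by blast
        then show ?thesis using e by (auto simp: E1_def E2_def)
      qed
    qed
    then show "E1 \<union> E2 = E" by (auto simp: E1_def E2_def)
    show sub1: "F1 \<union> Q \<subseteq> E1" using subs(1) img_edge[of _ "F1 \<union> Q"] by (auto simp: E1_def D1_def)
    show sub2: "F2 \<union> Q \<subseteq> E2" using subs(2) img_edge[of _ "F2 \<union> Q"] by (auto simp: E2_def D2_def)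
    have "e \<in> Q" if "e \<in> E1 \<inter> E2" for e
    proof (rule ccontr)
      assume "e \<notin> Q"
      have e: "e \<in> E" using that by (auto simp: E1_def)
      \<comment> \<open>The two closed regions meet only in \<open>img Q\<close>, whereas the
        nonempty open arc of an edge outside \<open>Q\<close> avoids \<open>img Q\<close>.\<close>
      have "path_image (\<gamma> e) \<subseteq> img Q" using that D12 by (auto simp: E1_def E2_def)
      then show False using open_edge_disjoint[OF e Q(2) \<open>e \<notin> Q\<close>] open_edge(2)[OF e] oe by blast
    qed
    then show "E1 \<inter> E2 = Q" using sub1 sub2 by blast
    then show "E1 \<inter> F2 = {}" "E2 \<inter> F1 = {}" using sub1 sub2 QF by blast+
  qed (auto simp: V1_def V2_def E1_def E2_def D1_def D2_def I1_def I2_def)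
qed

text \<open>A shortest path in \<open>H\<close> between two vertices of \<open>W\<close> has no
  inner vertex in \<open>W\<close>, since cutting it there would give a shorter one.\<close>

lemma shortest_ear:
  assumes "x \<in> W" "y \<in> W" "x \<noteq> y" "(x, y) \<in> (adj_rel H)\<^sup>*"
  obtains Q a b where "Q \<subseteq> H" "gpath Q a b" "\<Union>Q \<inter> W = {a, b}"
proof -
  define P where "P n \<longleftrightarrow> (\<exists>Q a b. Q \<subseteq> H \<and> gpath Q a b \<and> a \<in> W \<and> b \<in> W \<and> card Q = n)" for n
  have "\<exists>n. P n" unfolding P_def using gpath_of_rtrancl[OF assms(4,3)] assms(1,2) by blast
  then have "P (LEAST n. P n)" by (rule LeastI_ex)
  then obtain Q a b where Q: "Q \<subseteq> H" "gpath Q a b" "a \<in> W" "b \<in> W" "card Q = (LEAST n. P n)"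
    unfolding P_def by blast
  have "z \<in> {a, b}" if z: "z \<in> \<Union>Q" "z \<in> W" for z
  proof (rule ccontr)
    assume "z \<notin> {a, b}"
    then obtain A B where AB: "Q = A \<union> B" "gpath A a z" "gpath B z b" "\<Union>A \<inter> \<Union>B = {z}"
      using gpath_split[OF Q(2) z(1)] by blast
    have "finite B" "B \<noteq> {}" "finite A" using gpath_ends[OF AB(2)] gpath_ends[OF AB(3)] by auto
    moreover have "A \<inter> B = {}" using gpath_Un_disjoint[OF AB(2,4)] .
    ultimately have "card A < card Q" using AB(1) by (simp add: card_Un_disjoint card_gt_0_iff)
    moreover have "P (card A)" unfolding P_def using AB Q z(2) by blast
    ultimately show False using Q(5) not_less_Least by metis
  qed
  moreover have "a \<in> \<Union>Q" "b \<in> \<Union>Q" using gpath_ends[OF Q(2)] by auto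
  ultimately have "\<Union>Q \<inter> W = {a, b}" using Q(3,4)
    by (metis (no_types, lifting) IntE IntI empty_subsetI insert_subset subsetI subset_antisym)
  then show thesis using that Q by blast
qed

text \<open>A path \<open>Q\<close> through the inside yields two instances with fewer edges, each
  missing one of the two boundary paths. Without such a path the cycle can be deleted, and
  \<open>T\<close> applies to the components because at least three edges have disappeared.\<close>

lemma inside_edge_bound:
  fixes V :: "'a set"
  assumes T: "edge_bound_below N TYPE('a)"
    and "plane_graph V E p \<gamma>" "card E \<le> N" "gcycle F" "F \<subseteq> E"
    and "\<And>v. v \<in> V \<Longrightarrow> p v \<in> plane_graph.img \<gamma> F \<union> inside (plane_graph.img \<gamma> F)"
    and "\<And>e. e \<in> E \<Longrightarrow> path_image (\<gamma> e) \<subseteq> plane_graph.img \<gamma> F \<union> inside (plane_graph.img \<gamma> F)"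
  shows "card E + card F + 3 \<le> 3 * card V"
  using assms(2-)
proof (induction "card E" arbitrary: V E F rule: less_induct)
  case less
  interpret plane_graph V E p \<gamma> by (rule less.prems(1))
  note F = gcycle_card[OF less.prems(3)]
  have WV: "\<Union>F \<subseteq> V" using less.prems(4) edge_subset by auto
  define H where "H = E - F"
  have HE: "H \<subseteq> E" by (auto simp: H_def)
  have cE: "card E = card H + card F"
    unfolding H_def using F(1) less.prems(4) finite_edges card_mono[OF finite_edges less.prems(4)]
    by (simp add: card_Diff_subset)
  show ?case
  proof (cases "\<exists>x\<in>\<Union>F. \<exists>y\<in>\<Union>F. x \<noteq> y \<and> (x, y) \<in> (adj_rel H)\<^sup>*")
    case False
    have "plane_graph V H p \<gamma>" by (rule subgraph) (use HE edge_subset in auto)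
    moreover have "card H < N" using cE F(4) less.prems(2) by linarith
    ultimately have "card H + 3 * card (\<Union>F) \<le> 3 * card V"
      using components_edge_bound[OF T F(2), of V H] WV False by blast
    \<comment> \<open>With \<open>m = card F\<close>, deleting the cycle gives
      \<open>card E \<le> 3 * card V - 2 * m\<close>, which is at most
      \<open>3 * card V - m - 3\<close> because \<open>m \<ge> 3\<close>.\<close>
    then show ?thesis using cE F(3,4) by simp
  next
    case True
    then obtain x y where "x \<in> \<Union>F" "y \<in> \<Union>F" "x \<noteq> y" "(x, y) \<in> (adj_rel H)\<^sup>*" by metis
    then obtain Q a b where Q: "Q \<subseteq> H" "gpath Q a b" "\<Union>Q \<inter> \<Union>F = {a, b}" by (rule shortest_ear)
    have "a \<noteq> b" using gpath_ends[OF Q(2)] by auto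
    moreover have "a \<in> \<Union>F" "b \<in> \<Union>F" using Q(3) by (metis IntE insertI1, metis IntE insertCI)
    ultimately have "gcycle_at F a b" using gcycle_at_any[OF less.prems(3)] by blast
    then obtain F1 F2 where FF: "gpath F1 a b" "gpath F2 a b" "F = F1 \<union> F2" "F1 \<inter> F2 = {}"
      "\<Union>F1 \<inter> \<Union>F2 = {a, b}"
      unfolding gcycle_at_def by blast
    have QE: "Q \<subseteq> E" "Q \<inter> (F1 \<union> F2) = {}" using Q(1) FF(3) by (auto simp: H_def)
    obtain V1 E1 V2 E2 where G: "plane_graph V1 E1 p \<gamma>" "plane_graph V2 E2 p \<gamma>"
      "V1 \<union> V2 = V" "V1 \<inter> V2 = \<Union>Q" "E1 \<union> E2 = E" "E1 \<inter> E2 = Q" "E1 \<inter> F2 = {}" "E2 \<inter> F1 = {}"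
      "F1 \<union> Q \<subseteq> E1" "F2 \<union> Q \<subseteq> E2"
      "\<And>v. v \<in> V1 \<Longrightarrow> p v \<in> img (F1 \<union> Q) \<union> inside (img (F1 \<union> Q))"
      "\<And>v. v \<in> V2 \<Longrightarrow> p v \<in> img (F2 \<union> Q) \<union> inside (img (F2 \<union> Q))"
      "\<And>e. e \<in> E1 \<Longrightarrow> path_image (\<gamma> e) \<subseteq> img (F1 \<union> Q) \<union> inside (img (F1 \<union> Q))"
      "\<And>e. e \<in> E2 \<Longrightarrow> path_image (\<gamma> e) \<subseteq> img (F2 \<union> Q) \<union> inside (img (F2 \<union> Q))"
      using inside_ear_split[OF less.prems(1) FF(1,2) less.prems(4)[unfolded FF(3)] FF(4,5) Q(2) QE
          Q(3)[unfolded FF(3)] less.prems(5,6)[unfolded FF(3)]] by blast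
    have fin: "finite E1" "finite E2" "finite V1" "finite V2" using finite_edges finite_verts G(3,5)
      by auto
    have ne: "F1 \<noteq> {}" "F2 \<noteq> {}" using gpath_ends[OF FF(1)] gpath_ends[OF FF(2)] by auto
    have FE: "F1 \<subseteq> E" "F2 \<subseteq> E" using less.prems(4) FF(3) by auto
    have "E1 \<subset> E" "E2 \<subset> E" using G(5,7,8) ne FE by blast+
    then have lt: "card E1 < card E" "card E2 < card E" using finite_edges psubset_card_mono by blast+
    have uni: "\<Union>F1 \<inter> \<Union>Q = {a, b}" "\<Union>F2 \<inter> \<Union>Q = {a, b}"
    proof -
      have *: "A \<inter> C = {a, b} \<and> B \<inter> C = {a, b}"
        if "C \<inter> (A \<union> B) = {a, b}" "A \<inter> B = {a, b}" for A B C :: "'a set"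
        using that by blast
      show "\<Union>F1 \<inter> \<Union>Q = {a, b}" "\<Union>F2 \<inter> \<Union>Q = {a, b}"
        using *[OF Q(3)[unfolded FF(3) Union_Un_distrib] FF(5)] by simp_all
    qed
    have dj: "F1 \<inter> Q = {}" "F2 \<inter> Q = {}" using QE(2) by auto
    have gc: "gcycle (F1 \<union> Q)" "gcycle (F2 \<union> Q)"
      unfolding gcycle_def gcycle_at_def using FF(1,2) Q(2) dj uni by metis+
    have fins: "finite F1" "finite F2" "finite Q"
      using gpath_ends[OF FF(1)] gpath_ends[OF FF(2)] gpath_ends[OF Q(2)] by auto
    have cards: "card (F1 \<union> Q) = card F1 + card Q" "card (F2 \<union> Q) = card F2 + card Q"
      "card F = card F1 + card F2"
      using fins dj FF(3,4) by (simp_all add: card_Un_disjoint)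
    have "card E1 + card (F1 \<union> Q) + 3 \<le> 3 * card V1"
      by (rule less.hyps[OF lt(1) G(1) _ gc(1) G(9) G(11,13)]) (use lt less.prems(2) in auto)
    moreover have "card E2 + card (F2 \<union> Q) + 3 \<le> 3 * card V2"
      by (rule less.hyps[OF lt(2) G(2) _ gc(2) G(10) G(12,14)]) (use lt less.prems(2) in auto)
    moreover have "card E1 + card E2 = card E + card Q"
      using card_Un_Int[OF fin(1,2)] G(5,6) by simp
    \<comment> \<open>\<open>Q\<close> has one vertex more than edges. With
      \<open>l = card Q\<close> the sum of the two bounds carries \<open>3 * l + 6\<close> on the
      left and \<open>3 * l + 3\<close> on the right, which leaves exactly the required 3.\<close>
    moreover have "card V1 + card V2 = card V + (card Q + 1)"
      using card_Un_Int[OF fin(3,4)] G(3,4) card_gpath[OF Q(2)] by simp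
    ultimately show ?thesis using cards by linarith
  qed
qed

text \<open>Inversion at a point inside the cycle exchanges the two sides.\<close>

lemma outside_edge_bound:
  fixes V :: "'a set"
  assumes T: "edge_bound_below N TYPE('a)"
    and G: "plane_graph V E p \<gamma>" "card E \<le> N" "gcycle F" "F \<subseteq> E"
    and in_V: "\<And>v. v \<in> V \<Longrightarrow> p v \<in> plane_graph.img \<gamma> F \<union> outside (plane_graph.img \<gamma> F)"
    and in_E: "\<And>e. e \<in> E \<Longrightarrow> path_image (\<gamma> e) \<subseteq> plane_graph.img \<gamma> F \<union> outside (plane_graph.img \<gamma> F)"
  shows "card E + card F + 3 \<le> 3 * card V"
proof -
  interpret plane_graph V E p \<gamma> by fact
  define S where "S = img F"
  note J = Jordan_gcycle[OF G(3,4), folded S_def]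
  obtain z0 where z0: "z0 \<in> inside S" using J(1) by blast
  \<comment> \<open>As \<open>inverse 0 = 0\<close>, this map is injective on the whole plane; it is
    continuous away from \<open>z0\<close>, which no edge meets because all edges lie on or outside
    the cycle.\<close>
  define f where "f z = inverse (z - z0)" for z :: complex
  have inj: "inj f" by (auto simp: inj_def f_def)
  have cont: "continuous_on X f" if "z0 \<notin> X" for X
    unfolding f_def using that by (intro continuous_intros) auto
  have z0out: "z0 \<notin> S \<union> outside S" using z0 by (simp add: union_with_outside)
  define p' where "p' = f \<circ> p"
  define \<gamma>' where "\<gamma>' e = f \<circ> \<gamma> e" for e
  have pim: "path_image (\<gamma>' e) = f ` path_image (\<gamma> e)" for e
    by (simp add: \<gamma>'_def path_image_compose)
  have pl: "plane_graph V E p' \<gamma>'"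
  proof
    show "simple_graph (V, E)" by (rule simple)
    have "inj_on p' V" unfolding p'_def
      using inj_p inj by (intro comp_inj_on) (auto intro: inj_on_subset)
    moreover have "arc (\<gamma>' e)" "{pathstart (\<gamma>' e), pathfinish (\<gamma>' e)} = p' ` e"
      "path_image (\<gamma>' e) \<inter> p' ` V = p' ` e" if e: "e \<in> E" for e
    proof -
      have "z0 \<notin> path_image (\<gamma> e)" using in_E[OF e] z0out unfolding S_def by blast
      then have "path (\<gamma>' e)" unfolding \<gamma>'_def
        using edge_arc(1)[OF e] cont by (intro path_continuous_image) (auto simp: arc_def)
      then show "arc (\<gamma>' e)"
        using edge_arc(1)[OF e] inj unfolding arc_def \<gamma>'_def
        by (auto intro!: comp_inj_on intro: inj_on_subset)
      have "{pathstart (\<gamma>' e), pathfinish (\<gamma>' e)} = f ` {pathstart (\<gamma> e), pathfinish (\<gamma> e)}"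
        by (simp add: \<gamma>'_def pathstart_def pathfinish_def)
      then show "{pathstart (\<gamma>' e), pathfinish (\<gamma>' e)} = p' ` e"
        using edge_arc(2)[OF e] by (simp add: p'_def image_comp)
      show "path_image (\<gamma>' e) \<inter> p' ` V = p' ` e"
        using edge_arc(3)[OF e] inj unfolding pim p'_def image_comp[symmetric]
        by (metis image_Int)
    qed
    moreover have "path_image (\<gamma>' e) \<inter> path_image (\<gamma>' e') \<subseteq> p' ` (e \<inter> e')"
      if "e \<in> E" "e' \<in> E" "e \<noteq> e'" for e e'
      using edge_Int[OF that] inj unfolding pim p'_def image_comp[symmetric]
      by (metis image_Int image_mono)
    ultimately show "plane_drawing (V, E) p' \<gamma>'" unfolding plane_drawing_def by simp
  qed
  interpret P': plane_graph V E p' \<gamma>' by (rule pl)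
  define S' where "S' = P'.img F"
  have S': "S' = f ` S" unfolding S'_def S_def img_def P'.img_def pim by auto
  note J' = P'.Jordan_gcycle[OF G(3,4), folded S'_def]
  \<comment> \<open>The punctured inside is sent to a connected unbounded set disjoint from the new
    curve, hence into the outside of the new curve.\<close>
  define A where "A = f ` (inside S - {z0})"
  have "connected A" unfolding A_def
    using J(2,3) by (intro connected_continuous_image cont connected_open_delete) auto
  have disj: "A \<inter> S' = {}" unfolding A_def S' image_Int[OF inj, symmetric]
    using inside_no_overlap by blast
  have unb: "\<not> bounded A"
  proof
    assume "bounded A"
    then obtain B where B: "\<And>x. x \<in> A \<Longrightarrow> norm x \<le> B" by (auto simp: bounded_iff)
    obtain e where e: "e > 0" "ball z0 e \<subseteq> inside S" using J(2) z0 by (auto simp: open_contains_ball)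
    define t where "t = min (e / 2) (1 / (\<bar>B\<bar> + 1))"
    have t: "t > 0" "t < e" "t \<le> 1 / (\<bar>B\<bar> + 1)" using e(1) by (auto simp: t_def min_def)
    have "z0 + of_real t \<in> inside S - {z0}" using t e(2) by (auto simp: dist_norm subset_iff)
    then have "norm (f (z0 + of_real t)) \<le> B" using B by (auto simp: A_def)
    then have "1 / t \<le> B" using t(1) by (simp add: f_def norm_inverse divide_inverse)
    moreover have "\<bar>B\<bar> + 1 \<le> 1 / t" using t by (simp add: field_simps)
    ultimately show False by linarith
  qed
  have cover: "inside S' \<union> outside S' = - S'" "inside S' \<inter> outside S' = {}" by auto
  have "A \<subseteq> inside S' \<union> outside S'" using disj cover(1) by blast
  then have "inside S' \<inter> A = {} \<or> outside S' \<inter> A = {}"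
    using connectedD[OF \<open>connected A\<close> J'(2,4)] cover(2) by blast
  moreover have "\<not> A \<subseteq> inside S'" using unb J'(7) bounded_subset by blast
  ultimately have A_out: "inside S' \<inter> A = {}" using \<open>A \<subseteq> inside S' \<union> outside S'\<close> by blast
  have "f ` outside S \<subseteq> inside S'"
  proof -
    \<comment> \<open>\<open>inside S'\<close> is open and nonempty, so it has a point other than
      \<open>0\<close>, the only value not taken away from \<open>z0\<close>. The preimage of such a
      point lies in \<open>outside S\<close>, and this one point decides the side for the image of
      all of the connected \<open>outside S\<close>.\<close>
    have "\<not> inside S' \<subseteq> {0}"
      using J'(1,2) by (metis finite.emptyI finite.insertI finite_imp_not_open finite_subset)
    then obtain y where y: "y \<in> inside S'" "y \<noteq> 0" by blast
    define x where "x = z0 + inverse y"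
    have x: "f x = y" "x \<noteq> z0" using y(2) by (auto simp: x_def f_def)
    have "x \<notin> inside S" using A_out x y(1) by (auto simp: A_def)
    moreover have "x \<notin> S" using x(1) y(1) S' inside_no_overlap[of S'] by blast
    ultimately have "x \<in> outside S" using inside_Un_outside[of S] by blast
    then have meet: "inside S' \<inter> f ` outside S \<noteq> {}" using x(1) y(1) by blast
    have "connected (f ` outside S)"
      using J(5) z0out by (intro connected_continuous_image cont) auto
    moreover have "f ` outside S \<inter> S' = {}" unfolding S' image_Int[OF inj, symmetric]
      using outside_no_overlap by blast
    then have "f ` outside S \<subseteq> inside S' \<union> outside S'" using cover(1) by blast
    ultimately show ?thesis using connectedD[OF _ J'(2,4)] cover(2) meet by blast
  qed
  then have side: "f ` (S \<union> outside S) \<subseteq> S' \<union> inside S'" using S' by blast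
  show ?thesis
  proof (rule inside_edge_bound[OF T pl G(2-4)])
    show "p' v \<in> P'.img F \<union> inside (P'.img F)" if "v \<in> V" for v
      using in_V[OF that] side unfolding p'_def S'_def S_def by auto
    show "path_image (\<gamma>' e) \<subseteq> P'.img F \<union> inside (P'.img F)" if "e \<in> E" for e
      using in_E[OF that] side unfolding pim S'_def S_def by blast
  qed
qed

text \<open>Adding the bounds for the two sides of an \<open>m\<close>-cycle counts its
  \<open>m\<close> edges and \<open>m\<close> vertices twice:
  \<open>card E + m \<le> 3 * (card V + m) - 2 * m - 6\<close>, and all \<open>m\<close>
  cancel.\<close>

lemma edge_bound_below_all: "edge_bound_below N TYPE('a)"
proof (induction N)
  case 0
  then show ?case by (simp add: edge_bound_below_def)
next
  case (Suc N)
  have "card E + 6 \<le> 3 * card V"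
    if G: "plane_graph V E p \<gamma>" "card E \<le> N" "3 \<le> card V" for V :: "'a set" and E p \<gamma>
  proof (cases "\<exists>F\<subseteq>E. gcycle F")
    case False
    interpret plane_graph V E p \<gamma> by fact
    obtain v where v: "v \<in> V" using G(3) by fastforce
    \<comment> \<open>A single vertex serves as the set of pairwise disconnected vertices, so there
      are at most \<open>card V - 1\<close> edges; from three vertices on this is at most
      \<open>3 * card V - 6\<close>.\<close>
    have "card E + card {v} \<le> card V"
      by (rule forest_edge_bound) (use finite_verts v edge_subset edge_card False in auto)
    then show ?thesis using G(3) by simp
  next
    case True
    interpret plane_graph V E p \<gamma> by fact
    obtain F where F: "F \<subseteq> E" "gcycle F" using True by blast
    define S where "S = img F"
    note J = Jordan_gcycle[OF F(2,1), folded S_def]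
    define Vi where "Vi = {v \<in> V. p v \<in> S \<union> inside S}"
    define Vo where "Vo = {v \<in> V. p v \<in> S \<union> outside S}"
    define Ei where "Ei = {e \<in> E. path_image (\<gamma> e) \<subseteq> S \<union> inside S}"
    define Eo where "Eo = {e \<in> E. path_image (\<gamma> e) \<subseteq> S \<union> outside S}"
    have "e \<subseteq> Vi" if "e \<in> Ei" for e
      using that ends_in_path_image[of e] edge_subset[of e] by (auto simp: Ei_def Vi_def)
    then have Gi: "plane_graph Vi Ei p \<gamma>" by (intro subgraph) (auto simp: Ei_def Vi_def)
    have "e \<subseteq> Vo" if "e \<in> Eo" for e
      using that ends_in_path_image[of e] edge_subset[of e] by (auto simp: Eo_def Vo_def)
    then have Go: "plane_graph Vo Eo p \<gamma>" by (intro subgraph) (auto simp: Eo_def Vo_def)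
    have cover: "inside S \<union> outside S = - S" "inside S \<inter> outside S = {}" by auto
    have V: "Vi \<union> Vo = V" using cover(1) unfolding Vi_def Vo_def by blast
    have "Vi \<inter> Vo = {v \<in> V. p v \<in> S}"
      using cover(2) unfolding Vi_def Vo_def by blast
    moreover have WV: "\<Union>F \<subseteq> V" using F(1) edge_subset by auto
    ultimately have VF: "Vi \<inter> Vo = \<Union>F" using vert_img[OF F(1)] unfolding S_def by auto
    have FE: "F \<subseteq> Ei \<inter> Eo" using F(1) img_edge[of _ F] by (auto simp: Ei_def Eo_def S_def)
    have oe: "open_edge e \<subseteq> path_image (\<gamma> e)" for e by (auto simp: open_edge_def)
    have noF: "e \<in> Ei \<and> e \<notin> Eo \<or> e \<notin> Ei \<and> e \<in> Eo" if e: "e \<in> E" "e \<notin> F" for e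
    proof -
      have d: "open_edge e \<inter> S = {}" unfolding S_def using e F(1) by (intro open_edge_disjoint) auto
      then have "open_edge e \<subseteq> inside S \<union> outside S" using cover(1) by blast
      moreover from this have "inside S \<inter> open_edge e = {} \<or> outside S \<inter> open_edge e = {}"
        using connectedD[OF open_edge(1)[OF e(1)] J(2,4)] cover(2) by blast
      ultimately have "open_edge e \<subseteq> inside S \<or> open_edge e \<subseteq> outside S" by blast
      then have "e \<in> Ei \<or> e \<in> Eo"
        using edge_in_closure[OF e(1)] J(9,10) e(1) unfolding Ei_def Eo_def by auto
      moreover have "\<not> (e \<in> Ei \<and> e \<in> Eo)"
        using d open_edge(2)[OF e(1)] oe[of e] cover(2) unfolding Ei_def Eo_def by blast
      ultimately show ?thesis by blast
    qed
    have E: "Ei \<union> Eo = E" "Ei \<inter> Eo = F"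
      using noF FE F(1) unfolding Ei_def Eo_def by blast+
    have fin: "finite Vi" "finite Vo" "finite Ei" "finite Eo"
      using finite_verts finite_edges V E(1) by auto
    have "card Ei \<le> N" "card Eo \<le> N"
      using E(1) card_mono[OF finite_edges, of Ei] card_mono[OF finite_edges, of Eo] G(2) by auto
    have "card Ei + card F + 3 \<le> 3 * card Vi"
      by (rule inside_edge_bound[OF Suc.IH Gi \<open>card Ei \<le> N\<close> F(2)])
        (use E in \<open>auto simp: Vi_def Ei_def S_def\<close>)
    moreover have "card Eo + card F + 3 \<le> 3 * card Vo"
      by (rule outside_edge_bound[OF Suc.IH Go \<open>card Eo \<le> N\<close> F(2)])
        (use E in \<open>auto simp: Vo_def Eo_def S_def\<close>)
    moreover have "card Ei + card Eo = card E + card F" using card_Un_Int[OF fin(3,4)] E by simp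
    moreover have "card Vi + card Vo = card V + card F"
      using card_Un_Int[OF fin(1,2)] V VF gcycle_card(3)[OF F(2)] by simp
    ultimately show ?thesis by linarith
  qed
  then show ?case unfolding edge_bound_below_def by (simp add: less_Suc_eq_le)
qed

theorem planar_edge_bound:
  assumes "simple_graph G" "planar G" "3 \<le> card (verts G)"
  shows "card (edges G) \<le> 3 * card (verts G) - 6"
proof -
  obtain p \<gamma> where "plane_drawing G p \<gamma>" using assms(2) by (auto simp: planar_def)
  then have "plane_graph (verts G) (edges G) p \<gamma>" using assms(1) by unfold_locales auto
  then have "card (edges G) + 6 \<le> 3 * card (verts G)"
    using edge_bound_below_all[of "Suc (card (edges G))"] assms(3)
    unfolding edge_bound_below_def by blast
  then show ?thesis by linarith
qed

section \<open>Cycles of fixed length\<close>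

text \<open>A \<open>k\<close>-cycle is encoded as a \<open>k\<close>-periodic sequence on all of
  \<open>nat\<close>, so that the starting point can be shifted without reducing indices modulo
  \<open>k\<close>.\<close>

definition closed_cycle :: "nat \<Rightarrow> 'a set set \<Rightarrow> (nat \<Rightarrow> 'a) \<Rightarrow> bool" where
  "closed_cycle k E f \<longleftrightarrow> inj_on f {..<k} \<and> (\<forall>i. f (i + k) = f i) \<and> (\<forall>i. {f i, f (Suc i)} \<in> E)"

definition ck_free :: "nat \<Rightarrow> 'a set set \<Rightarrow> bool" where
  "ck_free k E \<longleftrightarrow> (\<nexists>f. closed_cycle k E f)"

lemma periodic_mod:
  fixes f :: "nat \<Rightarrow> 'a"
  assumes "\<And>i. f (i + k) = f i"
  shows "f (i mod k) = f i"
proof -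
  have "f (j + m * k) = f j" for j m
  proof (induction m)
    case (Suc m)
    have "j + Suc m * k = (j + m * k) + k" by simp
    then show ?case using assms[of "j + m * k"] Suc by metis
  qed simp
  from this[of "i mod k" "i div k"] show ?thesis by simp
qed

lemma closed_cycle_eq_iff:
  assumes "closed_cycle k E f" "k > 0"
  shows "f i = f j \<longleftrightarrow> i mod k = j mod k"
proof -
  have "f (i mod k) = f i" "f (j mod k) = f j"
    using assms(1) by (auto intro: periodic_mod simp: closed_cycle_def)
  moreover have "f (i mod k) = f (j mod k) \<longleftrightarrow> i mod k = j mod k"
    using assms by (intro inj_on_eq_iff[of f "{..<k}"]) (auto simp: closed_cycle_def)
  ultimately show ?thesis by metis
qed

lemma contains_cycle_graph:
  assumes "contains_subgraph G (cycle_graph k)" "k > 0"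
  shows "\<not> ck_free k (edges G)"
proof -
  obtain f where f: "inj_on f {..<k}" "\<And>e. e \<in> edges (cycle_graph k) \<Longrightarrow> f ` e \<in> edges G"
    using assms(1) by (auto simp: contains_subgraph_def cycle_graph_def)
  define g where "g i = f (i mod k)" for i
  have "{g i, g (Suc i)} \<in> edges G" for i
  proof -
    have "{i mod k, (i mod k + 1) mod k} \<in> edges (cycle_graph k)"
      using assms(2) by (auto simp: cycle_graph_def)
    from f(2)[OF this] show ?thesis by (simp add: g_def mod_Suc_eq)
  qed
  moreover have "inj_on g {..<k}" using f(1) by (auto simp: g_def inj_on_def)
  ultimately have "closed_cycle k (edges G) g" by (simp add: closed_cycle_def g_def)
  then show ?thesis by (auto simp: ck_free_def)
qed

lemma closed_cycle_shift:
  assumes "closed_cycle k E f" "k > 0"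
  shows "closed_cycle k E (\<lambda>i. f (i + m))"
proof -
  have "inj_on (\<lambda>i. f (i + m)) {..<k}"
  proof (rule inj_onI)
    fix i j assume ij: "i \<in> {..<k}" "j \<in> {..<k}" "f (i + m) = f (j + m)"
    then have "[i + m = j + m] (mod k)" using closed_cycle_eq_iff[OF assms] by (simp add: cong_def)
    then have "[i = j] (mod k)" by (simp add: cong_add_rcancel_nat)
    then show "i = j" using ij by (simp add: cong_def)
  qed
  moreover have "f (i + k + m) = f (i + m)" for i
    using assms(1) unfolding closed_cycle_def by (metis add.assoc add.commute)
  ultimately show ?thesis using assms(1) by (simp add: closed_cycle_def)
qed

text \<open>Start the cycle at an edge outside \<open>E1\<close> and take the first maximal run of
  \<open>E1\<close>-edges. The edges just before and just after it belong to \<open>E2\<close>, so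
  its ends are vertices of both edge sets; they differ because the run is shorter than the
  cycle.\<close>

lemma closed_cycle_Un:
  assumes "closed_cycle k (E1 \<union> E2) f" "k > 0" "ck_free k E1" "ck_free k E2"
  obtains g n where "n < k" "g 0 \<in> \<Union>E1 \<inter> \<Union>E2" "g n \<in> \<Union>E1 \<inter> \<Union>E2" "g 0 \<noteq> g n"
    "\<And>l. l < n \<Longrightarrow> {g l, g (Suc l)} \<in> E1"
proof -
  have "\<exists>i. {f i, f (Suc i)} \<notin> E1"
  proof (rule ccontr)
    assume "\<not> ?thesis"
    then have "closed_cycle k E1 f" using assms(1) by (simp add: closed_cycle_def)
    then show False using assms(3) by (simp add: ck_free_def)
  qed
  then obtain i0 where i0: "{f i0, f (Suc i0)} \<notin> E1" ..
  define h where "h i = f (i + i0)" for i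
  have h: "closed_cycle k (E1 \<union> E2) h" unfolding h_def by (rule closed_cycle_shift[OF assms(1,2)])
  have hk: "h (i + k) = h i" for i using h by (simp add: closed_cycle_def)
  have h12: "{h i, h (Suc i)} \<in> E1 \<union> E2" for i using h by (simp add: closed_cycle_def)
  have h0: "{h 0, h (Suc 0)} \<notin> E1" using i0 by (simp add: h_def)
  have hkk: "{h k, h (Suc k)} \<notin> E1" using h0 hk[of 0] hk[of "Suc 0"] by simp
  have "\<exists>l. {h l, h (Suc l)} \<in> E1"
  proof (rule ccontr)
    assume "\<not> ?thesis"
    then have "closed_cycle k E2 h" using h by (simp add: closed_cycle_def)
    then show False using assms(4) by (simp add: ck_free_def)
  qed
  then obtain l where l: "{h l, h (Suc l)} \<in> E1" ..
  have per: "h (m mod k) = h m" for m using periodic_mod[of h k] hk by blast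
  have "h (l mod k) = h l" "h (Suc (l mod k)) = h (Suc l)"
    using per[of l] per[of "Suc (l mod k)"] per[of "Suc l"] by (simp_all add: mod_Suc_eq)
  then have lk: "{h (l mod k), h (Suc (l mod k))} \<in> E1" using l by simp
  define i where "i = (LEAST i. {h i, h (Suc i)} \<in> E1)"
  have i: "{h i, h (Suc i)} \<in> E1" unfolding i_def using lk by (rule LeastI)
  have "i \<le> l mod k" unfolding i_def using lk by (rule Least_le)
  then have ik: "i < k" using assms(2) by (meson le_less_trans mod_less_divisor)
  have ipos: "i > 0" using i h0 by (cases i) auto
  have "{h (i - 1), h (Suc (i - 1))} \<notin> E1"
  proof
    assume "{h (i - 1), h (Suc (i - 1))} \<in> E1"
    from Least_le[of "\<lambda>i. {h i, h (Suc i)} \<in> E1", OF this] have "i \<le> i - 1"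
      unfolding i_def[symmetric] .
    then show False using ipos by simp
  qed
  then have im: "{h (i - 1), h i} \<in> E2" using h12[of "i - 1"] ipos by simp
  \<comment> \<open>Position \<open>k\<close> carries the starting edge again, so the run ends there
    at the latest; since \<open>i > 0\<close> it has fewer than \<open>k\<close> edges.\<close>
  define j where "j = (LEAST j. i \<le> j \<and> {h j, h (Suc j)} \<notin> E1)"
  have kk: "i \<le> k \<and> {h k, h (Suc k)} \<notin> E1" using ik hkk by simp
  have jj: "i \<le> j \<and> {h j, h (Suc j)} \<notin> E1" unfolding j_def using kk by (rule LeastI)
  have jk: "j \<le> k" unfolding j_def using kk by (rule Least_le)
  have "i \<noteq> j" using jj i by metis
  then have ij: "i < j" using jj by simp
  have run: "{h m, h (Suc m)} \<in> E1" if "i \<le> m" "m < j" for m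
  proof (rule ccontr)
    assume "{h m, h (Suc m)} \<notin> E1"
    then have "j \<le> m" unfolding j_def using that(1) by (intro Least_le) simp
    then show False using that(2) by simp
  qed
  have j1: "{h (j - 1), h j} \<in> E1" using run[of "j - 1"] ij by simp
  have j2: "{h j, h (Suc j)} \<in> E2" using jj h12[of j] by simp
  have hj: "h j \<in> \<Union>E1 \<inter> \<Union>E2" by (intro IntI UnionI[OF j1] UnionI[OF j2]) simp_all
  have hi: "h i \<in> \<Union>E1 \<inter> \<Union>E2" by (intro IntI UnionI[OF i] UnionI[OF im]) simp_all
  have "i mod k \<noteq> j mod k" using ij ik jk ipos by (cases "j = k") auto
  then have "h i \<noteq> h j" using closed_cycle_eq_iff[OF h assms(2)] by simp
  show thesis
  proof (rule that[of "j - i" "\<lambda>m. h (i + m)"])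
    show "j - i < k" using ij jk ipos by linarith
    show "h (i + 0) \<in> \<Union>E1 \<inter> \<Union>E2" using hi by simp
    show "h (i + (j - i)) \<in> \<Union>E1 \<inter> \<Union>E2" using hj ij by simp
    show "h (i + 0) \<noteq> h (i + (j - i))" using \<open>h i \<noteq> h j\<close> ij by simp
    show "{h (i + l), h (i + Suc l)} \<in> E1" if "l < j - i" for l
      using run[of "i + l"] that by simp
  qed
qed

text \<open>The run given by \<open>closed_cycle_Un\<close> would need two different ends in a set
  with one element.\<close>

lemma ck_free_glue:
  fixes E1 E2 :: "'a set set"
  assumes "k > 0" "ck_free k E1" "ck_free k E2" "\<Union>E1 \<inter> \<Union>E2 \<subseteq> {v}"
  shows "ck_free k (E1 \<union> E2)"
  unfolding ck_free_def
proof
  assume "\<exists>f. closed_cycle k (E1 \<union> E2) f"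
  then obtain f where f: "closed_cycle k (E1 \<union> E2) f" ..
  obtain g :: "nat \<Rightarrow> 'a" and n
    where "g 0 \<in> \<Union>E1 \<inter> \<Union>E2" "g n \<in> \<Union>E1 \<inter> \<Union>E2" "g 0 \<noteq> g n"
    by (rule closed_cycle_Un[OF f assms(1-3)]) (rule that)
  then show False using assms(4) by (metis singletonD subsetD)
qed

text \<open>The run of \<open>E1\<close>-edges would lead from one of \<open>a\<close>,
  \<open>b\<close> to the other in fewer than \<open>k\<close> steps, while the potential
  \<open>h\<close> has to change by at least \<open>k\<close> and changes by at most 1 per
  step.\<close>

lemma ck_free_ring:
  fixes h :: "'a \<Rightarrow> real"
  assumes "k > 0" "ck_free k E1" "ck_free k E2" "\<Union>E1 \<inter> \<Union>E2 \<subseteq> {a, b}"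
    and "\<And>u v. {u, v} \<in> E1 \<Longrightarrow> \<bar>h u - h v\<bar> \<le> 1" "\<bar>h a - h b\<bar> \<ge> real k"
  shows "ck_free k (E1 \<union> E2)"
  unfolding ck_free_def
proof
  assume "\<exists>f. closed_cycle k (E1 \<union> E2) f"
  then obtain f where f: "closed_cycle k (E1 \<union> E2) f" ..
  obtain g n where g: "n < k" "g 0 \<in> \<Union>E1 \<inter> \<Union>E2" "g n \<in> \<Union>E1 \<inter> \<Union>E2" "g 0 \<noteq> g n"
    "\<And>l. l < n \<Longrightarrow> {g l, g (Suc l)} \<in> E1"
    by (rule closed_cycle_Un[OF f assms(1-3)]) (rule that)
  have "m \<le> n \<Longrightarrow> \<bar>h (g 0) - h (g m)\<bar> \<le> real m" for m
  proof (induction m)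
    case (Suc m)
    then have "\<bar>h (g m) - h (g (Suc m))\<bar> \<le> 1" using assms(5) g(5) by auto
    then show ?case using Suc by auto
  qed simp
  then have "\<bar>h (g 0) - h (g n)\<bar> \<le> real n" by blast
  moreover have "g 0 \<in> {a, b}" "g n \<in> {a, b}" using g(2,3) assms(4) by (metis subsetD)+
  then have "\<bar>h (g 0) - h (g n)\<bar> \<ge> real k" using g(4) assms(6) by auto
  ultimately show False using g(1) by linarith
qed

text \<open>On a cycle every vertex outside the cover is followed by a vertex of the cover,
  unless the next edge is uncovered.\<close>

lemma ck_free_cover:
  assumes "finite S" "finite M" "\<And>e. e \<in> E \<Longrightarrow> e \<inter> S = {} \<Longrightarrow> e \<in> M" "k \<ge> 3"
    "2 * card S + card M < k"
  shows "ck_free k E"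
  unfolding ck_free_def
proof
  assume "\<exists>f. closed_cycle k E f"
  then obtain f where f: "closed_cycle k E f" ..
  have k0: "k > 0" using assms(4) by simp
  note eq = closed_cycle_eq_iff[OF f k0]
  define I where "I = {i. i < k \<and> f i \<in> S}"
  define J where "J = {i. i < k \<and> f i \<notin> S \<and> f (Suc i) \<in> S}"
  define K where "K = {i. i < k \<and> f i \<notin> S \<and> f (Suc i) \<notin> S}"
  have inj: "inj_on f {..<k}" using f by (simp add: closed_cycle_def)
  have "card I \<le> card S"
    by (rule card_inj_on_le[of f]) (use inj assms(1) in \<open>auto simp: I_def inj_on_def\<close>)
  moreover have "card J \<le> card S"
  proof (rule card_inj_on_le[of "\<lambda>i. f (Suc i)"])
    show "inj_on (\<lambda>i. f (Suc i)) J"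
    proof (rule inj_onI)
      fix i j assume ij: "i \<in> J" "j \<in> J" "f (Suc i) = f (Suc j)"
      then have "[i + 1 = j + 1] (mod k)" using eq by (simp add: cong_def)
      then have "[i = j] (mod k)" by (simp only: cong_add_rcancel_nat)
      then show "i = j" using ij by (simp add: cong_def J_def)
    qed
  qed (use assms(1) in \<open>auto simp: J_def\<close>)
  moreover have "card K \<le> card M"
  proof (rule card_inj_on_le[of "\<lambda>i. {f i, f (Suc i)}"])
    show "(\<lambda>i. {f i, f (Suc i)}) ` K \<subseteq> M"
      using f assms(3) by (auto simp: K_def closed_cycle_def)
    show "inj_on (\<lambda>i. {f i, f (Suc i)}) K"
    proof (rule inj_onI)
      fix i j assume ij: "i \<in> K" "j \<in> K" "{f i, f (Suc i)} = {f j, f (Suc j)}"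
      show "i = j"
      proof (rule ccontr)
        assume "i \<noteq> j"
        then have "f i \<noteq> f j" using ij inj by (auto simp: K_def inj_on_def)
        then have "f i = f (Suc j)" "f (Suc i) = f j" using ij(3) by (auto simp: doubleton_eq_iff)
        \<comment> \<open>Two positions carrying the same edge would be each other's successors,
          forcing \<open>2 = 0\<close> modulo \<open>k\<close>.\<close>
        then have c: "[i = j + 1] (mod k)" "[i + 1 = j] (mod k)" using eq by (simp_all add: cong_def)
        have "[i + 1 = j + 1 + 1] (mod k)" by (rule cong_add[OF c(1) cong_refl])
        from cong_trans[OF cong_sym[OF this] c(2)] have "[j + 2 = j + 0] (mod k)" by simp
        then have "[2 = 0] (mod k)" by (simp only: cong_add_lcancel_nat)
        then show False using assms(4) by (simp add: cong_def)
      qed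
    qed
  qed (use assms(2) in auto)
  moreover have "{..<k} = I \<union> (J \<union> K)" by (auto simp: I_def J_def K_def)
  then have "k \<le> card I + (card J + card K)"
    using card_Un_le[of I "J \<union> K"] card_Un_le[of J K]
      by (metis add_le_cancel_left card_lessThan le_trans)
  ultimately show False using assms(5) by linarith
qed

lemma ck_free_small:
  assumes "finite V" "card V < k" "\<And>e. e \<in> E \<Longrightarrow> e \<subseteq> V"
  shows "ck_free k E"
  unfolding ck_free_def
proof
  assume "\<exists>f. closed_cycle k E f"
  then obtain f where f: "closed_cycle k E f" ..
  then have "f ` {..<k} \<subseteq> V" using assms(3) by (auto simp: closed_cycle_def)
  then have "card (f ` {..<k}) \<le> card V" using assms(1) by (rule card_mono[rotated])
  then show False using f assms(2) by (simp add: closed_cycle_def card_image)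
qed

lemma ck_free_image:
  assumes "inj f" "ck_free k E"
  shows "ck_free k ((`) f ` E)"
  unfolding ck_free_def
proof
  assume "\<exists>g. closed_cycle k ((`) f ` E) g"
  then obtain g where g: "closed_cycle k ((`) f ` E) g" ..
  have r: "g i \<in> range f" for i
  proof -
    obtain e where "{g i, g (Suc i)} = f ` e" using g unfolding closed_cycle_def by blast
    then show ?thesis by blast
  qed
  have "{inv f (g i), inv f (g (Suc i))} \<in> E" for i
  proof -
    obtain e where e: "{g i, g (Suc i)} = f ` e" "e \<in> E" using g unfolding closed_cycle_def by blast
    then have "inv f ` {g i, g (Suc i)} = e" using assms(1) by (simp add: image_inv_f_f)
    then show ?thesis using e(2) by simp
  qed
  moreover have "inj_on (\<lambda>i. inv f (g i)) {..<k}"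
    using g r unfolding closed_cycle_def inj_on_def by (metis f_inv_into_f)
  ultimately have "closed_cycle k E (\<lambda>i. inv f (g i))" using g by (simp add: closed_cycle_def)
  then show False using assms(2) by (auto simp: ck_free_def)
qed

section \<open>Straight-line drawings\<close>

text \<open>The vertices are themselves the points of the drawing and every edge is drawn as the
  segment \<open>convex hull e\<close>; gluing, affine maps and separation by lines then act
  directly on the graph.\<close>

definition geo :: "complex sgraph \<Rightarrow> bool" where
  "geo G \<longleftrightarrow> simple_graph G \<and> (\<forall>e\<in>edges G. convex hull e \<inter> verts G \<subseteq> e) \<and>
     (\<forall>e\<in>edges G. \<forall>e'\<in>edges G. e \<noteq> e' \<longrightarrow> convex hull e \<inter> convex hull e' \<subseteq> e \<inter> e')"

definition supp :: "complex sgraph \<Rightarrow> complex set" where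
  "supp G = verts G \<union> (\<Union>e\<in>edges G. convex hull e)"

definition gun :: "'a sgraph \<Rightarrow> 'a sgraph \<Rightarrow> 'a sgraph" where
  "gun G H = (verts G \<union> verts H, edges G \<union> edges H)"

definition gimg :: "('a \<Rightarrow> 'b) \<Rightarrow> 'a sgraph \<Rightarrow> 'b sgraph" where
  "gimg f G = (f ` verts G, (`) f ` edges G)"

lemma gun_simps [simp]: "verts (gun G H) = verts G \<union> verts H" "edges (gun G H) = edges G \<union> edges H"
  by (simp_all add: gun_def)

lemma gimg_simps [simp]: "verts (gimg f G) = f ` verts G" "edges (gimg f G) = (`) f ` edges G"
  by (simp_all add: gimg_def)

lemma supp_gun: "supp (gun G H) = supp G \<union> supp H"
  by (auto simp: supp_def)

lemma geo_edge:
  "geo G \<Longrightarrow> e \<in> edges G \<Longrightarrow> e \<subseteq> verts G" "geo G \<Longrightarrow> e \<in> edges G \<Longrightarrow> card e = 2"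
  by (auto simp: geo_def simple_graph_def)

lemma geo_vert_hull:
  "geo G \<Longrightarrow> e \<in> edges G \<Longrightarrow> z \<in> convex hull e \<Longrightarrow> z \<in> verts G \<Longrightarrow> z \<in> e"
  by (auto simp: geo_def)

lemma geo_edge_hulls:
  assumes "geo G" "e \<in> edges G" "e' \<in> edges G" "e \<noteq> e'" "z \<in> convex hull e" "z \<in> convex hull e'"
  shows "z \<in> e" "z \<in> e'"
proof -
  have "convex hull e \<inter> convex hull e' \<subseteq> e \<inter> e'" using assms(1-4) by (simp add: geo_def)
  then show "z \<in> e" "z \<in> e'" using assms(5,6) by auto
qed

lemma geo_finite: "geo G \<Longrightarrow> finite (verts G)" "geo G \<Longrightarrow> finite (edges G)"
proof -
  assume G: "geo G"
  then show f: "finite (verts G)" by (simp add: geo_def simple_graph_def)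
  have "edges G \<subseteq> Pow (verts G)" using geo_edge(1)[OF G] by auto
  then show "finite (edges G)" using f finite_subset by blast
qed

lemma geo_planar:
  assumes "geo G"
  shows "planar G"
proof -
  have "\<exists>g. arc g \<and> {pathstart g, pathfinish g} = e \<and> path_image g = convex hull e" if "e \<in> edges G" for e
  proof -
    have "card e = 2" using geo_edge(2)[OF assms that] .
    then obtain u v where "e = {u, v}" "u \<noteq> v" by (auto simp: card_2_iff)
    then show ?thesis by (intro exI[of _ "linepath u v"]) (simp add: segment_convex_hull)
  qed
  then obtain \<gamma> where \<gamma>: "\<And>e. e \<in> edges G \<Longrightarrow>
      arc (\<gamma> e) \<and> {pathstart (\<gamma> e), pathfinish (\<gamma> e)} = e \<and> path_image (\<gamma> e) = convex hull e"
    by metis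
  have "convex hull e \<inter> verts G = e" if "e \<in> edges G" for e
  proof
    show "e \<subseteq> convex hull e \<inter> verts G" using geo_edge(1)[OF assms that] hull_subset[of e convex] by blast
  qed (use assms that in \<open>auto simp: geo_def\<close>)
  then have "plane_drawing G id \<gamma>"
    using \<gamma> assms unfolding plane_drawing_def geo_def by simp
  then show ?thesis by (auto simp: planar_def)
qed

text \<open>The supports may also meet along shared edges, as they do when triangles are glued along
  a side. A possible conflict then sits at a shared vertex or on a shared edge, and there the
  drawing of one of the two parts already excludes it.\<close>

lemma geo_gun:
  assumes G: "geo G" and H: "geo H"
    and GH: "\<And>z. z \<in> supp G \<Longrightarrow> z \<in> supp H \<Longrightarrow>
      z \<in> verts G \<inter> verts H \<or> (\<exists>e\<in>edges G \<inter> edges H. z \<in> convex hull e)"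
  shows "geo (gun G H)"
proof -
  have vert: "z \<in> e" if A: "geo A" "geo B" "e \<in> edges A" "z \<in> convex hull e" "z \<in> verts B"
    and AB: "\<And>z. z \<in> supp A \<Longrightarrow> z \<in> supp B \<Longrightarrow>
      z \<in> verts A \<inter> verts B \<or> (\<exists>e\<in>edges A \<inter> edges B. z \<in> convex hull e)" for A B e z
  proof -
    have "z \<in> supp A" "z \<in> supp B" using A by (auto simp: supp_def)
    from AB[OF this] have "z \<in> verts A"
    proof
      assume "\<exists>e\<in>edges A \<inter> edges B. z \<in> convex hull e"
      then obtain f where f: "f \<in> edges A" "f \<in> edges B" "z \<in> convex hull f" by auto
      have "z \<in> f" by (rule geo_vert_hull[OF A(2) f(2,3) A(5)])
      then show ?thesis using geo_edge(1)[OF A(1) f(1)] by auto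
    qed simp
    then show ?thesis by (rule geo_vert_hull[OF A(1,3,4)])
  qed
  have edge: "z \<in> e \<and> z \<in> e'" if e: "e \<in> edges G" "e' \<in> edges H" "e \<noteq> e'"
    "z \<in> convex hull e" "z \<in> convex hull e'" for e e' z
  proof -
    have "z \<in> supp G" "z \<in> supp H" using e by (auto simp: supp_def)
    from GH[OF this] show ?thesis
    proof
      assume "z \<in> verts G \<inter> verts H"
      then show ?thesis using geo_vert_hull[OF G e(1,4)] geo_vert_hull[OF H e(2,5)] by simp
    next
      assume "\<exists>e\<in>edges G \<inter> edges H. z \<in> convex hull e"
      then obtain f where f: "f \<in> edges G" "f \<in> edges H" "z \<in> convex hull f" by auto
      consider "f = e" | "f = e'" | "f \<noteq> e" "f \<noteq> e'" by metis
      then show ?thesis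
      proof cases
        case 1
        then show ?thesis using geo_edge_hulls[OF H _ e(2,3,4,5)] f(2) by simp
      next
        case 2
        then show ?thesis using geo_edge_hulls[OF G e(1) _ e(3,4,5)] f(1) by simp
      next
        case 3
        then show ?thesis
          using geo_edge_hulls[OF G f(1) e(1) _ f(3) e(4)] geo_edge_hulls[OF H f(2) e(2) _ f(3) e(5)]
            by simp
      qed
    qed
  qed
  have HG: "z \<in> verts H \<inter> verts G \<or> (\<exists>e\<in>edges H \<inter> edges G. z \<in> convex hull e)"
    if "z \<in> supp H" "z \<in> supp G" for z
    using GH[OF that(2,1)] by (simp only: Int_commute)
  show ?thesis
    unfolding geo_def
  proof (intro conjI ballI impI)
    show "simple_graph (gun G H)" using G H by (auto simp: geo_def simple_graph_def)
  next
    fix e assume "e \<in> edges (gun G H)"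
    then consider "e \<in> edges G" | "e \<in> edges H" by auto
    then show "convex hull e \<inter> verts (gun G H) \<subseteq> e"
    proof cases
      case 1
      show ?thesis
      proof
        fix z assume "z \<in> convex hull e \<inter> verts (gun G H)"
        then show "z \<in> e" using geo_vert_hull[OF G 1, of z] vert[OF G H 1 _ _ GH, of z] by auto
      qed
    next
      case 2
      show ?thesis
      proof
        fix z assume "z \<in> convex hull e \<inter> verts (gun G H)"
        then show "z \<in> e" using geo_vert_hull[OF H 2, of z] vert[OF H G 2 _ _ HG, of z] by auto
      qed
    qed
  next
    fix e e' assume e: "e \<in> edges (gun G H)" "e' \<in> edges (gun G H)" "e \<noteq> e'"
    show "convex hull e \<inter> convex hull e' \<subseteq> e \<inter> e'"
    proof
      fix z assume "z \<in> convex hull e \<inter> convex hull e'"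
      then have z: "z \<in> convex hull e" "z \<in> convex hull e'" by auto
      consider "e \<in> edges G" "e' \<in> edges G" | "e \<in> edges H" "e' \<in> edges H"
        | "e \<in> edges G" "e' \<in> edges H" | "e \<in> edges H" "e' \<in> edges G" using e(1,2) by auto
      then show "z \<in> e \<inter> e'"
      proof cases
        case 1 then show ?thesis using geo_edge_hulls[OF G 1 e(3) z] by simp
      next
        case 2 then show ?thesis using geo_edge_hulls[OF H 2 e(3) z] by simp
      next
        case 3 then show ?thesis using edge[OF 3 e(3) z] by simp
      next
        case 4 then show ?thesis using edge[OF 4(2,1) e(3)[symmetric] z(2,1)] by simp
      qed
    qed
  qed
qed

lemma supp_subset:
  assumes "geo G" "convex C" "verts G \<subseteq> C"
  shows "supp G \<subseteq> C"
proof -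
  have "convex hull e \<subseteq> C" if "e \<in> edges G" for e
    using geo_edge(1)[OF assms(1) that] assms(2,3) by (intro hull_minimal) auto
  then show ?thesis using assms(3) by (auto simp: supp_def)
qed

text \<open>The maps that keep vertical lines vertical: the new \<open>Re\<close> depends on
  \<open>Re z\<close> alone. For \<open>\<alpha> > 0\<close> the left-to-right order survives, for
  \<open>\<alpha> = 1\<close> all horizontal distances do.\<close>

definition aff :: "real \<Rightarrow> real \<Rightarrow> real \<Rightarrow> complex \<Rightarrow> complex \<Rightarrow> complex" where
  "aff \<alpha> \<beta> \<delta> c z = c + Complex (\<alpha> * Re z) (\<beta> * Re z + \<delta> * Im z)"

lemma aff_simps [simp]: "Re (aff \<alpha> \<beta> \<delta> c z) = Re c + \<alpha> * Re z"
  "Im (aff \<alpha> \<beta> \<delta> c z) = Im c + (\<beta> * Re z + \<delta> * Im z)"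
  by (simp_all add: aff_def)

lemma inj_aff:
  assumes "\<alpha> \<noteq> 0" "\<delta> \<noteq> 0"
  shows "inj (aff \<alpha> \<beta> \<delta> c)"
proof (rule injI)
  fix z w assume *: "aff \<alpha> \<beta> \<delta> c z = aff \<alpha> \<beta> \<delta> c w"
  have "Re c + \<alpha> * Re z = Re c + \<alpha> * Re w" using arg_cong[OF *, of Re] by simp
  then have re: "Re z = Re w" using assms(1) by simp
  have "\<beta> * Re z + \<delta> * Im z = \<beta> * Re w + \<delta> * Im w" using arg_cong[OF *, of Im] by simp
  then have "Im z = Im w" using assms(2) re by simp
  with re show "z = w" by (simp add: complex_eq_iff)
qed

lemma hull_aff: "convex hull (aff \<alpha> \<beta> \<delta> c ` S) = aff \<alpha> \<beta> \<delta> c ` (convex hull S)"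
proof -
  define L where "L z = Complex (\<alpha> * Re z) (\<beta> * Re z + \<delta> * Im z)" for z
  have "linear L"
    by (rule linearI) (simp_all add: L_def complex_eq_iff algebra_simps)
  then have L: "L ` (convex hull S) = convex hull (L ` S)" by (rule convex_hull_linear_image)
  have "aff \<alpha> \<beta> \<delta> c ` X = (\<lambda>z. c + z) ` (L ` X)" for X
    by (simp add: aff_def L_def image_image)
  then show ?thesis using convex_hull_translation[of c "L ` S"] L by simp
qed

lemma geo_gimg:
  assumes "geo G" "\<alpha> \<noteq> 0" "\<delta> \<noteq> 0"
  shows "geo (gimg (aff \<alpha> \<beta> \<delta> c) G)"
proof -
  let ?f = "aff \<alpha> \<beta> \<delta> c"
  have inj: "inj ?f" by (rule inj_aff[OF assms(2,3)])
  have c2: "card (?f ` e) = card e" for e by (rule card_image) (rule inj_on_subset[OF inj subset_UNIV])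
  show ?thesis
    unfolding geo_def
  proof (intro conjI ballI impI)
    show "simple_graph (gimg ?f G)"
      using geo_edge[OF assms(1)] geo_finite(1)[OF assms(1)] c2
      unfolding simple_graph_def gimg_simps by (simp add: image_mono)
  next
    fix e assume "e \<in> edges (gimg ?f G)"
    then obtain d where d: "e = ?f ` d" "d \<in> edges G"
      unfolding gimg_simps by (elim imageE)
    show "convex hull e \<inter> verts (gimg ?f G) \<subseteq> e"
    proof
      fix z assume "z \<in> convex hull e \<inter> verts (gimg ?f G)"
      then have "z \<in> ?f ` (convex hull d) \<inter> ?f ` verts G" by (simp add: d(1) hull_aff)
      then have "z \<in> ?f ` (convex hull d \<inter> verts G)" unfolding image_Int[OF inj] .
      then obtain w where w: "z = ?f w" "w \<in> convex hull d" "w \<in> verts G" by (elim imageE IntE)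
      then show "z \<in> e" using geo_vert_hull[OF assms(1) d(2)] d(1) by simp
    qed
  next
    fix e e' assume e: "e \<in> edges (gimg ?f G)" "e' \<in> edges (gimg ?f G)" "e \<noteq> e'"
    obtain d where d: "e = ?f ` d" "d \<in> edges G" using e(1) unfolding gimg_simps by (elim imageE)
    obtain d' where d': "e' = ?f ` d'" "d' \<in> edges G" using e(2) unfolding gimg_simps by (elim imageE)
    have ne: "d \<noteq> d'" using e(3) d d' by metis
    show "convex hull e \<inter> convex hull e' \<subseteq> e \<inter> e'"
    proof
      fix z assume "z \<in> convex hull e \<inter> convex hull e'"
      then have "z \<in> ?f ` (convex hull d) \<inter> ?f ` (convex hull d')" by (simp add: d(1) d'(1) hull_aff)
      then have "z \<in> ?f ` (convex hull d \<inter> convex hull d')" unfolding image_Int[OF inj] .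
      then obtain w where w: "z = ?f w" "w \<in> convex hull d" "w \<in> convex hull d'" by (elim imageE IntE)
      then show "z \<in> e \<inter> e'" using geo_edge_hulls[OF assms(1) d(2) d'(2) ne] d(1) d'(1) by simp
    qed
  qed
qed

lemma supp_gimg: "supp (gimg (aff \<alpha> \<beta> \<delta> c) G) = aff \<alpha> \<beta> \<delta> c ` supp G"
  by (simp add: supp_def hull_aff image_Un image_UN)

section \<open>Separation of drawings by lines\<close>

definition lf :: "real \<Rightarrow> real \<Rightarrow> complex \<Rightarrow> real" where
  "lf p q z = p * Re z + q * Im z"

lemma lf_combine: "lf p q (u *\<^sub>R x + v *\<^sub>R y) = u * lf p q x + v * lf p q y"
  by (simp add: lf_def algebra_simps)

lemma convex_lf_le: "convex {z. lf p q z \<le> \<alpha>}"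
proof (rule convexI)
  fix x y and u v :: real
  assume *: "x \<in> {z. lf p q z \<le> \<alpha>}" "y \<in> {z. lf p q z \<le> \<alpha>}" "0 \<le> u" "0 \<le> v" "u + v = 1"
  then have "u * lf p q x + v * lf p q y \<le> \<alpha>" by (intro convex_bound_le) auto
  then show "u *\<^sub>R x + v *\<^sub>R y \<in> {z. lf p q z \<le> \<alpha>}" by (simp add: lf_combine)
qed

text \<open>Ensures that a drawing on one side of a line with \<open>a\<close> as its only vertex on
  that line touches the line nowhere else: a proper convex combination with a point strictly below
  stays strictly below.\<close>

lemma convex_lf_extreme: "convex ({z. lf p q z < lf p q a} \<union> {a})"
proof (rule convexI)
  fix x y and u v :: real
  assume xy: "x \<in> {z. lf p q z < lf p q a} \<union> {a}" "y \<in> {z. lf p q z < lf p q a} \<union> {a}"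
    and uv: "0 \<le> u" "0 \<le> v" "u + v = 1"
  let ?w = "u *\<^sub>R x + v *\<^sub>R y"
  consider "u = 0" | "v = 0" | "u > 0" "v > 0" "x = a" "y = a"
    | "u > 0" "v > 0" "lf p q x < lf p q a \<or> lf p q y < lf p q a" using xy uv by fastforce
  then show "?w \<in> {z. lf p q z < lf p q a} \<union> {a}"
  proof cases
    case 1 then show ?thesis using xy uv by simp
  next
    case 2 then show ?thesis using xy uv by simp
  next
    case 3
    then have "?w = (u + v) *\<^sub>R a" by (simp only: scaleR_add_left)
    then show ?thesis using uv by simp
  next
    case 4
    have le: "lf p q x \<le> lf p q a" "lf p q y \<le> lf p q a" using xy by auto
    have "u * lf p q x + v * lf p q y < u * lf p q a + v * lf p q a"
      using 4 le by (smt (verit) mult_left_mono mult_strict_left_mono)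
    also have "\<dots> = lf p q a" using uv by (simp add: distrib_right[symmetric])
    finally show ?thesis by (simp add: lf_combine)
  qed
qed

text \<open>The value of the functional at \<open>z\<close> exceeds \<open>\<alpha>\<close> by the
  barycentric weight of \<open>w\<close> times a positive number, so that weight must
  vanish.\<close>

lemma hull_triangle_Int:
  assumes "z \<in> convex hull {x, y, w}" "lf p q z \<le> \<alpha>" "lf p q x = \<alpha>" "lf p q y = \<alpha>" "lf p q w > \<alpha>"
  shows "z \<in> convex hull {x, y}"
proof -
  obtain a b c where abc: "a \<ge> 0" "b \<ge> 0" "c \<ge> 0" "a + b + c = 1" "z = a *\<^sub>R x + b *\<^sub>R y + c *\<^sub>R w"
    using assms(1) unfolding convex_hull_3 by blast
  have "lf p q z = a * \<alpha> + b * \<alpha> + c * lf p q w"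
    using assms(3,4) lf_combine[of p q 1 "a *\<^sub>R x + b *\<^sub>R y" c w] by (simp add: abc(5) lf_combine)
  also have "\<dots> = \<alpha> + c * (lf p q w - \<alpha>)"
  proof -
    have "a * \<alpha> + b * \<alpha> + c * \<alpha> = \<alpha>" using abc(4) by (simp add: distrib_right[symmetric])
    then show ?thesis by (simp add: algebra_simps)
  qed
  finally have "c * (lf p q w - \<alpha>) \<le> 0" using assms(2) by simp
  then have "c = 0" using abc(3) assms(5) by (smt (verit) mult_pos_pos)
  then show ?thesis using abc unfolding convex_hull_2 by auto
qed

definition tri :: "complex \<Rightarrow> complex \<Rightarrow> complex \<Rightarrow> complex sgraph" where
  "tri x y z = ({x, y, z}, {{x, y}, {y, z}, {x, z}})"

lemma tri_simps [simp]: "verts (tri x y z) = {x, y, z}" "edges (tri x y z) = {{x, y}, {y, z}, {x, z}}"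
  by (simp_all add: tri_def)

text \<open>The functional certifies that the corners are not collinear, two being on one level and
  the third above it; then two sides meet only in their common corner.\<close>

lemma geo_tri:
  assumes "x \<noteq> y" "lf p q x = lf p q y" "lf p q z > lf p q x"
  shows "geo (tri x y z)"
proof -
  have nc: "\<not> collinear {x, y, z}"
  proof
    assume "collinear {x, y, z}"
    then obtain u where u: "\<And>a b. a \<in> {x, y, z} \<Longrightarrow> b \<in> {x, y, z} \<Longrightarrow> \<exists>c. a - b = c *\<^sub>R u"
      unfolding collinear_def by blast
    obtain c where c: "x - y = c *\<^sub>R u" using u[of x y] by blast
    obtain d where d: "z - x = d *\<^sub>R u" using u[of z x] by blast
    have diff: "lf p q (a - b) = lf p q a - lf p q b" for a b by (simp add: lf_def algebra_simps)
    have scale: "lf p q (c *\<^sub>R u) = c * lf p q u" for c by (simp add: lf_def algebra_simps)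
    have "c \<noteq> 0" using c assms(1) by auto
    moreover have "c * lf p q u = 0" using diff[of x y] scale[of c] c assms(2) by simp
    ultimately have "lf p q u = 0" by simp
    then show False using diff[of z x] scale[of d] d assms(3) by simp
  qed
  have ne: "y \<noteq> z" "x \<noteq> z" using assms by auto
  have i: "convex hull {a, b} \<inter> convex hull {b, c} = {b}" if "{a, b, c} = {x, y, z}" for a b c
    using Int_closed_segment[of b a c] nc that by (simp add: segment_convex_hull)
  have p: "{z, x, y} = {x, y, z}" "{y, z, x} = {x, y, z}" "{x, z, y} = {x, y, z}" "{y, x, z} = {x, y, z}"
    "{z, y, x} = {x, y, z}" by auto
  have sw: "{y, x} = {x, y}" "{z, x} = {x, z}" "{z, y} = {y, z}" by auto
  note I = i[of x y z, OF refl] i[of y z x, OF p(2), unfolded sw] i[of z x y, OF p(1), unfolded sw]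
    i[of y x z, OF p(4), unfolded sw] i[of z y x, OF p(5), unfolded sw] i[of x z y, OF p(3), unfolded sw]
  have h: "a \<in> convex hull {a, b}" "b \<in> convex hull {a, b}" for a b :: complex
    using hull_subset[of "{a, b}" convex] by auto
  have V: "z \<notin> convex hull {x, y}" "x \<notin> convex hull {y, z}" "y \<notin> convex hull {x, z}"
  proof -
    have n: "a \<notin> A" if "A \<inter> B = {b}" "a \<in> B" "a \<noteq> b" for a b :: complex and A B
      using that by auto
    show "z \<notin> convex hull {x, y}" by (rule n[OF I(1) h(2)]) (use ne in simp)
    show "x \<notin> convex hull {y, z}" by (rule n[OF I(2) h(1)]) (use ne in simp)
    show "y \<notin> convex hull {x, z}" by (rule n[OF I(3) h(2)]) (use assms(1) in simp)
  qed
  have ed: "{x, y} \<noteq> {y, z}" "{x, y} \<noteq> {x, z}" "{y, z} \<noteq> {x, z}"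
    using assms(1) ne by (auto simp: doubleton_eq_iff)
  show ?thesis
    unfolding geo_def tri_simps
  proof (intro conjI)
    show "simple_graph (tri x y z)" using assms(1) ne by (simp add: simple_graph_def)
    show "\<forall>e\<in>{{x, y}, {y, z}, {x, z}}. convex hull e \<inter> {x, y, z} \<subseteq> e"
    proof -
      have "A \<inter> {x, y, z} \<subseteq> {x, y}" if "z \<notin> A" for A using that by auto
      moreover have "A \<inter> {x, y, z} \<subseteq> {y, z}" if "x \<notin> A" for A using that by auto
      moreover have "A \<inter> {x, y, z} \<subseteq> {x, z}" if "y \<notin> A" for A using that by auto
      ultimately show ?thesis using V by (simp only: ball_simps simp_thms)
    qed
    have sub: "{y} \<subseteq> {x, y} \<inter> {y, z}" "{x} \<subseteq> {x, y} \<inter> {x, z}" "{z} \<subseteq> {y, z} \<inter> {x, z}"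
      "{y} \<subseteq> {y, z} \<inter> {x, y}" "{x} \<subseteq> {x, z} \<inter> {x, y}" "{z} \<subseteq> {x, z} \<inter> {y, z}" by simp_all
    show "\<forall>e\<in>{{x, y}, {y, z}, {x, z}}. \<forall>e'\<in>{{x, y}, {y, z}, {x, z}}. e \<noteq> e' \<longrightarrow>
        convex hull e \<inter> convex hull e' \<subseteq> e \<inter> e'"
      unfolding ball_simps using I sub ed by (simp only: simp_thms)
  qed
qed

lemma supp_tri: "supp (tri x y z) \<subseteq> convex hull {x, y, z}"
proof -
  have "convex hull e \<subseteq> convex hull {x, y, z}" if "e \<in> edges (tri x y z)" for e
    by (rule hull_mono) (use that in auto)
  then show ?thesis using hull_subset[of "{x, y, z}" convex] unfolding supp_def by auto
qed

text \<open>The line through \<open>x\<close> and \<open>y\<close> separates \<open>G\<close> from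
  the triangle that contains \<open>H\<close>, so the two drawings meet only along the shared
  edge.\<close>

lemma geo_attach:
  assumes G: "geo G" and H: "geo H" and e: "{x, y} \<in> edges G" "{x, y} \<in> edges H"
    and S: "supp H \<subseteq> convex hull {x, y, w}"
    and V: "\<And>v. v \<in> verts G \<Longrightarrow> lf p q v \<le> \<alpha>" and a: "lf p q x = \<alpha>" "lf p q y = \<alpha>" "lf p q w > \<alpha>"
  shows "geo (gun G H)"
proof (rule geo_gun[OF G H])
  fix z assume z: "z \<in> supp G" "z \<in> supp H"
  have "lf p q z \<le> \<alpha>" using supp_subset[OF G convex_lf_le[of p q \<alpha>]] V z(1) by auto
  then have "z \<in> convex hull {x, y}" using hull_triangle_Int[of z x y w p q \<alpha>] z(2) S a by auto
  then show "z \<in> verts G \<inter> verts H \<or> (\<exists>e\<in>edges G \<inter> edges H. z \<in> convex hull e)" using e by blast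
qed

section \<open>Blocks\<close>

text \<open>The separation argument of \<open>geo_attach\<close> for a single point. It is used
  where a new part touches the old drawing along two sides, each of which needs its own separating
  line.\<close>

lemma supp_Int_attach:
  assumes "geo G" "supp H \<subseteq> convex hull {x, y, w}" "\<And>v. v \<in> verts G \<Longrightarrow> lf p q v \<le> \<alpha>"
    "lf p q x = \<alpha>" "lf p q y = \<alpha>" "lf p q w > \<alpha>" "z \<in> supp G" "z \<in> supp H"
  shows "z \<in> convex hull {x, y}"
proof -
  have "verts G \<subseteq> {z. lf p q z \<le> \<alpha>}" using assms(3) by auto
  then have "lf p q z \<le> \<alpha>" using supp_subset[OF assms(1) convex_lf_le[of p q \<alpha>]] assms(7) by auto
  then show ?thesis using hull_triangle_Int[OF _ _ assms(4-6)] assms(2,8) by auto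
qed

text \<open>A model face with corners \<open>0\<close>, \<open>1\<close> and
  \<open>1 + \<i>\<close>, where \<open>b\<close> decides whether its centroid is joined to the
  three corners. The faces added in \<open>block\<close> are affine images of it.\<close>

definition piece :: "bool \<Rightarrow> complex sgraph" where
  "piece b = (if b
     then gun (gun (tri 0 1 (Complex (2/3) (1/3))) (tri 1 (Complex 1 1) (Complex (2/3) (1/3))))
            (tri (Complex 1 1) 0 (Complex (2/3) (1/3)))
     else tri 0 1 (Complex 1 1))"

lemma verts_piece: "verts (piece b) = {0, 1, Complex 1 1} \<union> (if b then {Complex (2/3) (1/3)} else {})"
  by (auto simp: piece_def)

lemma edges_piece: "edges (piece b) = {{0, 1}, {1, Complex 1 1}, {0, Complex 1 1}} \<union>
    (if b then {{0, Complex (2/3) (1/3)}, {1, Complex (2/3) (1/3)}, {Complex 1 1, Complex (2/3) (1/3)}} else {})"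
  by (auto simp: piece_def insert_commute)

lemma geo_piece: "geo (piece b)"
proof (cases b)
  case False
  have "geo (tri 0 1 (Complex 1 1))" by (rule geo_tri[of _ _ 0 1]) (simp_all add: lf_def)
  then show ?thesis using False by (simp add: piece_def)
next
  case True
  let ?w = "Complex (2/3) (1/3)" and ?q = "Complex 1 1"
  let ?A = "tri 0 1 ?w" and ?B = "tri 1 ?q ?w" and ?C = "tri ?q 0 ?w"
  have A: "geo ?A" by (rule geo_tri[of _ _ 0 1]) (simp_all add: lf_def)
  have B: "geo ?B" by (rule geo_tri[of _ _ "-1" 0]) (simp_all add: lf_def complex_eq_iff)
  have C: "geo ?C" by (rule geo_tri[of _ _ 1 "-1"]) (simp_all add: lf_def complex_eq_iff)
  have sB: "supp ?B \<subseteq> convex hull {1, ?w, ?q}" using supp_tri[of 1 ?q ?w] by (simp add: insert_commute)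
  have sC: "supp ?C \<subseteq> convex hull {0, ?w, ?q}" "supp ?C \<subseteq> convex hull {?q, ?w, 0}"
    using supp_tri[of ?q 0 ?w] by (simp_all add: insert_commute)
  have AB: "geo (gun ?A ?B)"
    by (rule geo_attach[OF A B _ _ sB, of 1 1 1]) (auto simp: lf_def)
  have "geo (gun (gun ?A ?B) ?C)"
  proof (rule geo_gun[OF AB C])
    fix z assume z: "z \<in> supp (gun ?A ?B)" "z \<in> supp ?C"
    then consider "z \<in> supp ?A" | "z \<in> supp ?B" by (auto simp: supp_gun)
    then have "z \<in> convex hull {0, ?w} \<or> z \<in> convex hull {?q, ?w}"
    proof cases
      case 1
      \<comment> \<open>The line through \<open>0\<close> and the centroid is
        \<open>- x + 2 y = 0\<close>; in the other case, \<open>- 2 x + y = - 1\<close> is the line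
        through \<open>1 + \<i>\<close> and the centroid.\<close>
      have "z \<in> convex hull {0, ?w}"
        by (rule supp_Int_attach[OF A sC(1), of "-1" 2 0, OF _ _ _ _ 1 z(2)]) (auto simp: lf_def)
      then show ?thesis ..
    next
      case 2
      have "z \<in> convex hull {?q, ?w}"
        by (rule supp_Int_attach[OF B sC(2), of "-2" 1 "-1", OF _ _ _ _ 2 z(2)]) (auto simp: lf_def)
      then show ?thesis ..
    qed
    moreover have "{0, ?w} \<in> edges (gun ?A ?B) \<inter> edges ?C" "{?q, ?w} \<in> edges (gun ?A ?B) \<inter> edges ?C"
      by simp_all
    ultimately show "z \<in> verts (gun ?A ?B) \<inter> verts ?C \<or>
      (\<exists>e\<in>edges (gun ?A ?B) \<inter> edges ?C. z \<in> convex hull e)" by blast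
  qed
  then show ?thesis using True by (simp add: piece_def)
qed

lemma supp_piece: "supp (piece b) \<subseteq> convex hull {0, 1, Complex 1 1}"
proof (rule supp_subset[OF geo_piece convex_convex_hull])
  have "Complex (2/3) (1/3) = (1/3) *\<^sub>R 0 + (1/3) *\<^sub>R 1 + (1/3) *\<^sub>R Complex 1 1"
    by (simp add: complex_eq_iff)
  moreover have "(0::real) \<le> 1/3" "1/3 + 1/3 + 1/3 = (1::real)" by simp_all
  ultimately have "Complex (2/3) (1/3) \<in> convex hull {0, 1, Complex 1 1}"
    unfolding convex_hull_3 by blast
  then show "verts (piece b) \<subseteq> convex hull {0, 1, Complex 1 1}"
    using hull_subset[of "{0, 1, Complex 1 1}" convex] by (simp add: verts_piece)
qed

text \<open>The path of a block runs upwards on the line \<open>Re z = 1/2\<close>;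
  \<open>lc i\<close> and \<open>rc i\<close> are the centroids of the faces that
  \<open>ax i\<close> and \<open>ax (Suc i)\<close> span with \<open>0\<close> and with
  \<open>1\<close>.\<close>

definition ax :: "nat \<Rightarrow> complex" where "ax i = Complex (1/2) (real i + 1)"
definition lc :: "nat \<Rightarrow> complex" where "lc i = Complex (1/3) ((2 * real i + 3) / 3)"
definition rc :: "nat \<Rightarrow> complex" where "rc i = Complex (2/3) ((2 * real i + 3) / 3)"

definition lpiece :: "bool \<Rightarrow> nat \<Rightarrow> complex sgraph" where
  "lpiece b i = gimg (aff (1/2) (real i + 1) 1 0) (piece b)"
definition rpiece :: "bool \<Rightarrow> nat \<Rightarrow> complex sgraph" where
  "rpiece b i = gimg (aff (-1/2) (real i + 1) 1 1) (piece b)"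

lemma aff_corners:
  "aff (1/2) (real i + 1) 1 0 0 = 0" "aff (1/2) (real i + 1) 1 0 1 = ax i"
  "aff (1/2) (real i + 1) 1 0 (Complex 1 1) = ax (Suc i)"
  "aff (1/2) (real i + 1) 1 0 (Complex (2/3) (1/3)) = lc i"
  "aff (-1/2) (real i + 1) 1 1 0 = 1" "aff (-1/2) (real i + 1) 1 1 1 = ax i"
  "aff (-1/2) (real i + 1) 1 1 (Complex 1 1) = ax (Suc i)"
  "aff (-1/2) (real i + 1) 1 1 (Complex (2/3) (1/3)) = rc i"
  by (simp_all add: complex_eq_iff ax_def lc_def rc_def field_simps)

lemma verts_lpiece: "verts (lpiece b i) = {0, ax i, ax (Suc i)} \<union> (if b then {lc i} else {})"
  and verts_rpiece: "verts (rpiece b i) = {1, ax i, ax (Suc i)} \<union> (if b then {rc i} else {})"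
  unfolding lpiece_def rpiece_def gimg_simps verts_piece
    by (simp_all only: image_Un image_insert image_empty aff_corners if_distrib[of "image _"])

lemma edges_lpiece: "edges (lpiece b i) = {{0, ax i}, {ax i, ax (Suc i)}, {0, ax (Suc i)}} \<union>
    (if b then {{0, lc i}, {ax i, lc i}, {ax (Suc i), lc i}} else {})"
  and edges_rpiece: "edges (rpiece b i) = {{1, ax i}, {ax i, ax (Suc i)}, {1, ax (Suc i)}} \<union>
    (if b then {{1, rc i}, {ax i, rc i}, {ax (Suc i), rc i}} else {})"
  unfolding lpiece_def rpiece_def gimg_simps edges_piece
    by (simp_all only: image_Un image_insert image_empty aff_corners if_distrib[of "image _"])

lemma geo_lpiece: "geo (lpiece b i)" and geo_rpiece: "geo (rpiece b i)"
  unfolding lpiece_def rpiece_def by (intro geo_gimg geo_piece; simp)+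

lemma supp_lpiece: "supp (lpiece b i) \<subseteq> convex hull {0, ax i, ax (Suc i)}"
proof -
  have "supp (lpiece b i) \<subseteq> convex hull (aff (1/2) (real i + 1) 1 0 ` {0, 1, Complex 1 1})"
    unfolding lpiece_def supp_gimg hull_aff by (rule image_mono[OF supp_piece])
  then show ?thesis by (simp only: image_insert image_empty aff_corners)
qed

lemma supp_rpiece: "supp (rpiece b i) \<subseteq> convex hull {1, ax i, ax (Suc i)}"
proof -
  have "supp (rpiece b i) \<subseteq> convex hull (aff (-1/2) (real i + 1) 1 1 ` {0, 1, Complex 1 1})"
    unfolding rpiece_def supp_gimg hull_aff by (rule image_mono[OF supp_piece])
  then show ?thesis by (simp only: image_insert image_empty aff_corners)
qed

text \<open>The triangulation \<open>K\<^sub>2 + P\<^sub>m\<^sub>+\<^sub>1\<close> on the vertices \<open>0\<close>, \<open>1\<close>, \<open>ax 0, \<dots>, ax m\<close>, with an extra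
  vertex inside the faces selected by \<open>pl\<close> (left) and \<open>pr\<close> (right).\<close>

fun block :: "(nat \<Rightarrow> bool) \<Rightarrow> (nat \<Rightarrow> bool) \<Rightarrow> nat \<Rightarrow> complex sgraph" where
  "block pl pr 0 = tri 0 1 (ax 0)"
| "block pl pr (Suc m) = gun (gun (block pl pr m) (lpiece (pl m) m)) (rpiece (pr m) m)"

lemma verts_block: "verts (block pl pr m) =
    {0, 1} \<union> ax ` {..m} \<union> lc ` {i. i < m \<and> pl i} \<union> rc ` {i. i < m \<and> pr i}"
proof (induction m)
  case (Suc m)
  have "{i. i < Suc m \<and> p i} = {i. i < m \<and> p i} \<union> (if p m then {m} else {})" for p
    by (auto simp: less_Suc_eq)
  then show ?case using Suc by (auto simp: verts_lpiece verts_rpiece atMost_Suc)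
qed auto

lemma block_edges:
  "{0, ax m} \<in> edges (block pl pr m)" "{1, ax m} \<in> edges (block pl pr m)"
  by (cases m; simp add: edges_lpiece edges_rpiece)+

text \<open>The old drawing lies on or below the lines from \<open>0\<close> and from
  \<open>1\<close> through its apex \<open>ax m\<close>. The left piece lies above the first line,
  the right piece above the second, and the line \<open>Re z = 1/2\<close> separates the two pieces
  from each other.\<close>

lemma geo_block: "geo (block pl pr m)"
proof (induction m)
  case 0
  have "geo (tri 0 1 (ax 0))" by (rule geo_tri[of _ _ 0 1]) (simp_all add: lf_def ax_def)
  then show ?case by simp
next
  case (Suc m)
  let ?A = "block pl pr m" and ?B = "lpiece (pl m) m" and ?C = "rpiece (pr m) m"
  have v: "v = 0 \<or> v = 1 \<or> (\<exists>i\<le>m. v = ax i) \<or> (\<exists>i. i + 1 \<le> m \<and> v = lc i) \<or> (\<exists>i. i + 1 \<le> m \<and> v = rc i)"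
    if "v \<in> verts ?A" for v using that unfolding verts_block by (auto simp: Suc_le_eq)
  have lA: "lf (- 2 * (real m + 1)) 1 v \<le> 0" if "v \<in> verts ?A" for v
    using v[OF that] by (auto simp: lf_def ax_def lc_def rc_def field_simps)
  have rA: "lf (2 * (real m + 1)) 1 v \<le> 2 * (real m + 1)" if "v \<in> verts ?A" for v
    using v[OF that] by (auto simp: lf_def ax_def lc_def rc_def field_simps)
  have rB: "lf 1 0 v \<le> 1/2" if "v \<in> verts ?B" for v
    using that by (auto simp: verts_lpiece lf_def ax_def lc_def split: if_splits)
  have AB: "geo (gun ?A ?B)"
  proof (rule geo_attach[OF Suc.IH geo_lpiece block_edges(1) _ supp_lpiece lA])
    show "{0, ax m} \<in> edges ?B" by (simp add: edges_lpiece)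
  qed (simp_all add: lf_def ax_def field_simps)
  have sC: "supp ?C \<subseteq> convex hull {ax m, ax (Suc m), 1}"
    using supp_rpiece[of "pr m" m] by (simp add: insert_commute)
  have "geo (gun (gun ?A ?B) ?C)"
  proof (rule geo_gun[OF AB geo_rpiece])
    fix z assume z: "z \<in> supp (gun ?A ?B)" "z \<in> supp ?C"
    then consider "z \<in> supp ?A" | "z \<in> supp ?B" by (auto simp: supp_gun)
    then have "z \<in> convex hull {1, ax m} \<or> z \<in> convex hull {ax m, ax (Suc m)}"
    proof cases
      case 1
      have "z \<in> convex hull {1, ax m}"
        by (rule supp_Int_attach[OF Suc.IH supp_rpiece rA _ _ _ 1 z(2)])
          (simp_all add: lf_def ax_def field_simps)
      then show ?thesis ..
    next
      case 2
      have "z \<in> convex hull {ax m, ax (Suc m)}"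
        by (rule supp_Int_attach[OF geo_lpiece sC rB _ _ _ 2 z(2)]) (simp_all add: lf_def ax_def)
      then show ?thesis ..
    qed
    moreover have "{1, ax m} \<in> edges (gun ?A ?B) \<inter> edges ?C"
      "{ax m, ax (Suc m)} \<in> edges (gun ?A ?B) \<inter> edges ?C"
      using block_edges(2)[of m pl pr] by (simp_all add: edges_lpiece edges_rpiece)
    ultimately show "z \<in> verts (gun ?A ?B) \<inter> verts ?C \<or>
      (\<exists>e\<in>edges (gun ?A ?B) \<inter> edges ?C. z \<in> convex hull e)" by blast
  qed
  then show ?case by simp
qed

lemma points_eq_iff [simp]:
  "ax i = ax j \<longleftrightarrow> i = j" "lc i = lc j \<longleftrightarrow> i = j" "rc i = rc j \<longleftrightarrow> i = j"
  "ax i \<noteq> lc j" "ax i \<noteq> rc j" "lc i \<noteq> rc j" "lc i \<noteq> ax j" "rc i \<noteq> ax j" "rc i \<noteq> lc j"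
  "ax i \<noteq> 0" "ax i \<noteq> 1" "lc i \<noteq> 0" "lc i \<noteq> 1" "rc i \<noteq> 0" "rc i \<noteq> 1"
  "0 \<noteq> ax i" "1 \<noteq> ax i" "0 \<noteq> lc i" "1 \<noteq> lc i" "0 \<noteq> rc i" "1 \<noteq> rc i"
  by (auto simp: ax_def lc_def rc_def complex_eq_iff)

lemma card_verts_block:
  "card (verts (block pl pr m)) = m + 3 + card {i. i < m \<and> pl i} + card {i. i < m \<and> pr i}"
proof -
  have inj: "inj_on ax A" "inj_on lc A" "inj_on rc A" for A by (auto simp: inj_on_def)
  have c: "card ({0, 1} \<union> ax ` {..m}) = m + 3"
    by (subst card_Un_disjoint) (auto simp: card_image inj)
  have d: "card ({0, 1} \<union> ax ` {..m} \<union> lc ` {i. i < m \<and> pl i}) = m + 3 + card {i. i < m \<and> pl i}"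
    using c by (subst card_Un_disjoint) (auto simp: card_image inj)
  show ?thesis
    unfolding verts_block using d by (subst card_Un_disjoint) (auto simp: card_image inj)
qed

text \<open>Every vertex beyond the first triangle arrives with three edges, which are new because
  one of their ends is not yet a vertex of the block.\<close>

lemma card_edges_block:
  "3 * (m + card {i. i < m \<and> pl i} + card {i. i < m \<and> pr i}) + 3 \<le> card (edges (block pl pr m))"
proof (induction m)
  case 0
  have "card {{0, 1}, {1, ax 0}, {0, ax 0}} = 3" by (simp add: doubleton_eq_iff)
  then show ?case by simp
next
  case (Suc m)
  define N1 where "N1 = {{0, ax (Suc m)}, {ax m, ax (Suc m)}, {1, ax (Suc m)}}"
  define N2 where "N2 = (if pl m then {{0, lc m}, {ax m, lc m}, {ax (Suc m), lc m}} else {})"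
  define N3 where "N3 = (if pr m then {{1, rc m}, {ax m, rc m}, {ax (Suc m), rc m}} else {})"
  let ?E = "edges (block pl pr m)" and ?E' = "edges (block pl pr (Suc m))"
  have fin: "finite ?E" "finite ?E'" using geo_finite(2)[OF geo_block] by blast+
  have "card N1 = 3" unfolding N1_def by (simp add: doubleton_eq_iff)
  moreover have "card N2 = (if pl m then 3 else 0)" unfolding N2_def by (simp add: doubleton_eq_iff)
  moreover have "card N3 = (if pr m then 3 else 0)" unfolding N3_def by (simp add: doubleton_eq_iff)
  moreover have "card (N1 \<union> N2 \<union> N3) = card N1 + card N2 + card N3"
  proof -
    have "N1 \<inter> N2 = {}" "(N1 \<union> N2) \<inter> N3 = {}"
      unfolding N1_def N2_def N3_def by (auto simp: doubleton_eq_iff)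
    moreover have "finite N1" "finite N2" "finite N3" by (simp_all add: N1_def N2_def N3_def)
    ultimately show ?thesis by (simp add: card_Un_disjoint)
  qed
  moreover have "card (?E \<union> (N1 \<union> N2 \<union> N3)) = card ?E + card (N1 \<union> N2 \<union> N3)"
  proof (rule card_Un_disjoint[OF fin(1)])
    have "ax (Suc m) \<notin> verts (block pl pr m)" "lc m \<notin> verts (block pl pr m)" "rc m \<notin> verts (block pl pr m)"
      unfolding verts_block by auto
    then have "ax (Suc m) \<notin> e" "lc m \<notin> e" "rc m \<notin> e" if "e \<in> ?E" for e
      using geo_edge(1)[OF geo_block that] by auto
    moreover have "ax (Suc m) \<in> e \<or> lc m \<in> e \<or> rc m \<in> e" if "e \<in> N1 \<union> N2 \<union> N3" for e
      using that unfolding N1_def N2_def N3_def by (auto split: if_splits)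
    ultimately show "?E \<inter> (N1 \<union> N2 \<union> N3) = {}" by blast
  qed (auto simp: N1_def N2_def N3_def)
  moreover have "card (?E \<union> (N1 \<union> N2 \<union> N3)) \<le> card ?E'"
  proof (rule card_mono[OF fin(2)])
    show "?E \<union> (N1 \<union> N2 \<union> N3) \<subseteq> ?E'"
      unfolding N1_def N2_def N3_def by (auto simp: edges_lpiece edges_rpiece)
  qed
  moreover have "{i. i < Suc m \<and> p i} = (if p m then insert m {i. i < m \<and> p i} else {i. i < m \<and> p i})" for p
    by (auto simp: less_Suc_eq)
  then have "card {i. i < Suc m \<and> p i} = card {i. i < m \<and> p i} + (if p m then 1 else 0)" for p by simp
  ultimately show ?case using Suc by (simp split: if_splits)
qed

text \<open>Prepares the covering argument: an edge at an inserted vertex leads to \<open>0\<close>,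
  to \<open>1\<close> or to a path vertex of the face that received it. Once these are covered, only
  path edges can remain.\<close>

lemma block_edge_cases:
  "e \<in> edges (block pl pr m) \<Longrightarrow> 0 \<in> e \<or> 1 \<in> e \<or> (\<exists>i<m. e = {ax i, ax (Suc i)}) \<or>
    (\<exists>i. (pl i \<or> pr i) \<and> (ax i \<in> e \<or> ax (Suc i) \<in> e))"
proof (induction m)
  case (Suc m)
  then consider "e \<in> edges (block pl pr m)" | "e \<in> edges (lpiece (pl m) m)" | "e \<in> edges (rpiece (pr m) m)"
    by auto
  then show ?case
  proof cases
    case 1 then show ?thesis using Suc.IH less_Suc_eq by metis
  next
    case 2 then show ?thesis unfolding edges_lpiece by (auto split: if_splits)
  next
    case 3 then show ?thesis unfolding edges_rpiece by (auto split: if_splits)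
  qed
qed auto

section \<open>Chains and rings of blocks\<close>

text \<open>\<open>x\<close> and \<open>y\<close> are the unique leftmost and rightmost vertices, so
  that two strips glued end to start lie on opposite sides of a vertical line.\<close>

definition strip :: "nat \<Rightarrow> complex sgraph \<Rightarrow> complex \<Rightarrow> complex \<Rightarrow> bool" where
  "strip k G x y \<longleftrightarrow> geo G \<and> ck_free k (edges G) \<and> x \<in> verts G \<and> y \<in> verts G \<and> Re x < Re y \<and>
     (\<forall>v\<in>verts G. v = x \<or> v = y \<or> Re x < Re v \<and> Re v < Re y)"

text \<open>Makes \<open>Re\<close> a potential suitable for \<open>ck_free_ring\<close>.\<close>

definition lip :: "complex sgraph \<Rightarrow> bool" where
  "lip G \<longleftrightarrow> (\<forall>u v. {u, v} \<in> edges G \<longrightarrow> \<bar>Re u - Re v\<bar> \<le> 1)"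

lemma card_gimg:
  assumes "\<alpha> \<noteq> 0" "\<delta> \<noteq> 0"
  shows "card (verts (gimg (aff \<alpha> \<beta> \<delta> c) G)) = card (verts G)"
    "card (edges (gimg (aff \<alpha> \<beta> \<delta> c) G)) = card (edges G)"
proof -
  have inj: "inj (aff \<alpha> \<beta> \<delta> c)" by (rule inj_aff[OF assms])
  show "card (verts (gimg (aff \<alpha> \<beta> \<delta> c) G)) = card (verts G)"
    unfolding gimg_simps by (rule card_image) (rule inj_on_subset[OF inj subset_UNIV])
  show "card (edges (gimg (aff \<alpha> \<beta> \<delta> c) G)) = card (edges G)"
    unfolding gimg_simps by (rule card_image) (simp add: inj_on_def inj_image_eq_iff[OF inj])
qed

lemma strip_gimg:
  assumes "strip k G x y" "\<alpha> > 0" "\<delta> \<noteq> 0"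
  shows "strip k (gimg (aff \<alpha> \<beta> \<delta> c) G) (aff \<alpha> \<beta> \<delta> c x) (aff \<alpha> \<beta> \<delta> c y)"
proof -
  have G: "geo G" "ck_free k (edges G)" "x \<in> verts G" "y \<in> verts G" "Re x < Re y"
    "\<And>v. v \<in> verts G \<Longrightarrow> v = x \<or> v = y \<or> Re x < Re v \<and> Re v < Re y"
    using assms(1) unfolding strip_def by metis+
  have "ck_free k ((`) (aff \<alpha> \<beta> \<delta> c) ` edges G)"
    by (rule ck_free_image[OF inj_aff G(2)]) (use assms in auto)
  moreover have "geo (gimg (aff \<alpha> \<beta> \<delta> c) G)" by (rule geo_gimg[OF G(1)]) (use assms in auto)
  moreover have "w = aff \<alpha> \<beta> \<delta> c x \<or> w = aff \<alpha> \<beta> \<delta> c y \<or>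
      Re (aff \<alpha> \<beta> \<delta> c x) < Re w \<and> Re w < Re (aff \<alpha> \<beta> \<delta> c y)" if "w \<in> aff \<alpha> \<beta> \<delta> c ` verts G" for w
  proof -
    from that obtain v where "w = aff \<alpha> \<beta> \<delta> c v" "v \<in> verts G" by (elim imageE)
    then show ?thesis using G(6)[of v] assms(2) by auto
  qed
  ultimately show ?thesis using G(3-5) assms(2) unfolding strip_def by simp
qed

lemma lip_gimg:
  assumes "geo G" "lip G"
  shows "lip (gimg (aff 1 \<beta> \<delta> c) G)"
  unfolding lip_def
proof (intro allI impI)
  fix u v assume "{u, v} \<in> edges (gimg (aff 1 \<beta> \<delta> c) G)"
  then obtain e where e: "{u, v} = aff 1 \<beta> \<delta> c ` e" "e \<in> edges G" by auto
  obtain a b where ab: "e = {a, b}" using geo_edge(2)[OF assms(1) e(2)] by (auto simp: card_2_iff)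
  then have "\<bar>Re a - Re b\<bar> \<le> 1" using assms(2) e(2) by (simp add: lip_def)
  moreover have "u = aff 1 \<beta> \<delta> c a \<and> v = aff 1 \<beta> \<delta> c b \<or> u = aff 1 \<beta> \<delta> c b \<and> v = aff 1 \<beta> \<delta> c a"
    using e(1) unfolding ab by (simp add: doubleton_eq_iff)
  ultimately show "\<bar>Re u - Re v\<bar> \<le> 1" by auto
qed

lemma lip_gun: "lip G \<Longrightarrow> lip H \<Longrightarrow> lip (gun G H)"
  by (auto simp: lip_def)

lemma geo_Union_edges: "geo G \<Longrightarrow> \<Union>(edges G) \<subseteq> verts G"
  using geo_edge(1) by (simp add: Sup_le_iff)

text \<open>The vertical line through \<open>y\<close> separates the two drawings, which therefore
  meet in \<open>y\<close> alone. This excludes crossings and shared edges, and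
  \<open>ck_free_glue\<close> excludes new \<open>k\<close>-cycles.\<close>

lemma
  assumes "k > 0" "strip k G x y" "strip k H y z"
  shows strip_glue: "strip k (gun G H) x z"
    and card_verts_glue: "card (verts (gun G H)) + 1 = card (verts G) + card (verts H)"
    and card_edges_glue: "card (edges (gun G H)) = card (edges G) + card (edges H)"
proof -
  have G: "geo G" "ck_free k (edges G)" "x \<in> verts G" "y \<in> verts G" "Re x < Re y"
    "\<And>v. v \<in> verts G \<Longrightarrow> v = x \<or> v = y \<or> Re x < Re v \<and> Re v < Re y"
    using assms(2) unfolding strip_def by metis+
  have H: "geo H" "ck_free k (edges H)" "y \<in> verts H" "z \<in> verts H" "Re y < Re z"
    "\<And>v. v \<in> verts H \<Longrightarrow> v = y \<or> v = z \<or> Re y < Re v \<and> Re v < Re z"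
    using assms(3) unfolding strip_def by metis+
  have "verts G \<subseteq> {w. lf 1 0 w < lf 1 0 y} \<union> {y}" using G(5,6) by (auto simp: lf_def)
  then have "supp G \<subseteq> {w. lf 1 0 w < lf 1 0 y} \<union> {y}" by (rule supp_subset[OF G(1) convex_lf_extreme])
  then have sG: "Re w < Re y \<or> w = y" if "w \<in> supp G" for w using that by (auto simp: lf_def)
  have "verts H \<subseteq> {w. lf (-1) 0 w < lf (-1) 0 y} \<union> {y}" using H(5,6) by (auto simp: lf_def)
  then have "supp H \<subseteq> {w. lf (-1) 0 w < lf (-1) 0 y} \<union> {y}"
    by (rule supp_subset[OF H(1) convex_lf_extreme])
  then have sH: "Re y < Re w \<or> w = y" if "w \<in> supp H" for w using that by (auto simp: lf_def)
  have meet: "w = y" if "w \<in> supp G" "w \<in> supp H" for w using sG[OF that(1)] sH[OF that(2)] by auto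
  have VV: "verts G \<inter> verts H = {y}" using meet G(4) H(3) by (auto simp: supp_def)
  have geo: "geo (gun G H)" by (rule geo_gun[OF G(1) H(1)]) (use meet VV in auto)
  have "\<Union>(edges G) \<inter> \<Union>(edges H) \<subseteq> {y}"
    using Int_mono[OF geo_Union_edges[OF G(1)] geo_Union_edges[OF H(1)]] unfolding VV .
  then have ck: "ck_free k (edges G \<union> edges H)" by (rule ck_free_glue[OF assms(1) G(2) H(2)])
  have "v = x \<or> v = z \<or> Re x < Re v \<and> Re v < Re z" if "v \<in> verts G \<union> verts H" for v
    using that G(5) G(6)[of v] H(5) H(6)[of v] by auto
  then show "strip k (gun G H) x z"
    unfolding strip_def using geo ck G(3,5) H(4,5) by auto
  show "card (verts (gun G H)) + 1 = card (verts G) + card (verts H)"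
    using card_Un_Int[OF geo_finite(1)[OF G(1)] geo_finite(1)[OF H(1)]] VV by simp
  have "edges G \<inter> edges H = {}"
  proof (rule ccontr)
    assume "edges G \<inter> edges H \<noteq> {}"
    then obtain e where e: "e \<in> edges G" "e \<in> edges H" by auto
    have "e \<subseteq> {y}" using geo_edge(1)[OF G(1) e(1)] geo_edge(1)[OF H(1) e(2)] VV by auto
    then have "card e \<le> 1" using card_mono[of "{y}" e] by simp
    then show False using geo_edge(2)[OF G(1) e(1)] by simp
  qed
  then show "card (edges (gun G H)) = card (edges G) + card (edges H)"
    using geo_finite(2)[OF G(1)] geo_finite(2)[OF H(1)] by (simp add: card_Un_disjoint)
qed

text \<open>\<open>H\<close> lies above the real axis and \<open>B\<close> below it. An edge
  \<open>{x, y}\<close> would run along the axis, but it is too long to occur in \<open>H\<close>;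
  so each edge of \<open>H\<close> touches the axis in at most one end, and the drawings share only
  \<open>x\<close> and \<open>y\<close>.\<close>

lemma
  assumes k: "k \<ge> 2" and "strip k H x y" "strip k B x y" and lip: "lip H"
    and im: "Im x = 0" "Im y = 0" and far: "Re y - Re x \<ge> real k"
    and up: "\<And>v. v \<in> verts H \<Longrightarrow> v = x \<or> v = y \<or> Im v > 0"
    and down: "\<And>v. v \<in> verts B \<Longrightarrow> Im v \<le> 0"
  shows strip_ring: "strip k (gun H B) x y"
    and card_verts_ring: "card (verts (gun H B)) + 2 = card (verts H) + card (verts B)"
    and card_edges_ring: "card (edges (gun H B)) = card (edges H) + card (edges B)"
proof -
  have H: "geo H" "ck_free k (edges H)" "x \<in> verts H" "y \<in> verts H" "Re x < Re y"
    "\<And>v. v \<in> verts H \<Longrightarrow> v = x \<or> v = y \<or> Re x < Re v \<and> Re v < Re y"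
    using assms(2) unfolding strip_def by metis+
  have B: "geo B" "ck_free k (edges B)" "x \<in> verts B" "y \<in> verts B"
    "\<And>v. v \<in> verts B \<Longrightarrow> v = x \<or> v = y \<or> Re x < Re v \<and> Re v < Re y"
    using assms(3) unfolding strip_def by metis+
  have xy: "x \<noteq> y" using H(5) by auto
  have noxy: "{x, y} \<notin> edges H"
  proof
    assume "{x, y} \<in> edges H"
    then have "\<bar>Re x - Re y\<bar> \<le> 1" using lip by (simp add: lip_def)
    then show False using far k by linarith
  qed
  have sB: "Im w \<le> 0" if "w \<in> supp B" for w
  proof -
    have "verts B \<subseteq> {z. lf 0 1 z \<le> 0}" using down by (auto simp: lf_def)
    then have "supp B \<subseteq> {z. lf 0 1 z \<le> 0}" by (rule supp_subset[OF B(1) convex_lf_le])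
    then show ?thesis using that by (auto simp: lf_def)
  qed
  have hH: "Im w > 0 \<or> w = x \<or> w = y" if e: "e \<in> edges H" "w \<in> convex hull e" for e w
  proof -
    have eV: "e \<subseteq> verts H" "card e = 2" using geo_edge[OF H(1) e(1)] by auto
    have one: ?thesis if a: "a = x \<or> a = y" "e \<subseteq> {z. lf 0 (-1) z < lf 0 (-1) a} \<union> {a}" for a
    proof -
      have "w \<in> {z. lf 0 (-1) z < lf 0 (-1) a} \<union> {a}"
        using hull_minimal[of e _ convex, OF a(2) convex_lf_extreme] e(2) by blast
      then show ?thesis using a(1) im by (auto simp: lf_def)
    qed
    have "x \<notin> e \<or> y \<notin> e"
    proof (rule ccontr)
      assume "\<not> ?thesis"
      then have "{x, y} \<subseteq> e" by auto
      moreover have "finite e" using eV(2) card.infinite by fastforce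
      ultimately have "{x, y} = e" using eV(2) xy by (intro card_subset_eq) auto
      then show False using noxy e(1) by simp
    qed
    then show ?thesis
    proof
      assume "x \<notin> e"
      then have "e \<subseteq> {z. lf 0 (-1) z < lf 0 (-1) y} \<union> {y}" using eV(1) up im by (auto simp: lf_def)
      then show ?thesis using one by blast
    next
      assume "y \<notin> e"
      then have "e \<subseteq> {z. lf 0 (-1) z < lf 0 (-1) x} \<union> {x}" using eV(1) up im by (auto simp: lf_def)
      then show ?thesis using one by blast
    qed
  qed
  have meet: "w = x \<or> w = y" if w: "w \<in> supp H" "w \<in> supp B" for w
  proof -
    have "w \<in> verts H \<or> (\<exists>e\<in>edges H. w \<in> convex hull e)" using w(1) by (auto simp: supp_def)
    then have "Im w > 0 \<or> w = x \<or> w = y" using up hH by metis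
    then show ?thesis using sB[OF w(2)] by linarith
  qed
  have VV: "verts H \<inter> verts B = {x, y}" using meet H(3,4) B(3,4) by (auto simp: supp_def)
  have geo: "geo (gun H B)" by (rule geo_gun[OF H(1) B(1)]) (use meet VV in auto)
  have UU: "\<Union>(edges H) \<inter> \<Union>(edges B) \<subseteq> {x, y}"
    using Int_mono[OF geo_Union_edges[OF H(1)] geo_Union_edges[OF B(1)]] unfolding VV .
  have ck: "ck_free k (edges H \<union> edges B)"
  proof (rule ck_free_ring[where h = Re, OF _ H(2) B(2) UU])
    show "\<bar>Re u - Re v\<bar> \<le> 1" if "{u, v} \<in> edges H" for u v using lip that by (simp add: lip_def)
    show "real k \<le> \<bar>Re x - Re y\<bar>" using far by linarith
  qed (use k in simp)
  have "v = x \<or> v = y \<or> Re x < Re v \<and> Re v < Re y" if "v \<in> verts H \<union> verts B" for v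
    using that H(6)[of v] B(5)[of v] by auto
  then show "strip k (gun H B) x y" unfolding strip_def using geo ck H(3-5) by auto
  show "card (verts (gun H B)) + 2 = card (verts H) + card (verts B)"
    using card_Un_Int[OF geo_finite(1)[OF H(1)] geo_finite(1)[OF B(1)]] VV xy by simp
  have "edges H \<inter> edges B = {}"
  proof (rule ccontr)
    assume "edges H \<inter> edges B \<noteq> {}"
    then obtain e where e: "e \<in> edges H" "e \<in> edges B" by auto
    have "e \<subseteq> {x, y}" using geo_edge(1)[OF H(1) e(1)] geo_edge(1)[OF B(1) e(2)] VV by auto
    then have "e = {x, y}" using geo_edge(2)[OF H(1) e(1)] xy by (intro card_subset_eq) auto
    then show False using noxy e(1) by simp
  qed
  then show "card (edges (gun H B)) = card (edges H) + card (edges B)"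
    using geo_finite(2)[OF H(1)] geo_finite(2)[OF B(1)] by (simp add: card_Un_disjoint)
qed

text \<open>Normalised to run from \<open>0\<close> to \<open>w\<close> on the real axis within the
  closed upper half-plane, so that chains can be translated, sheared and concatenated knowing only
  the numbers \<open>n\<close>, \<open>e\<close> and \<open>w\<close>.\<close>

definition chain_graph :: "nat \<Rightarrow> nat \<Rightarrow> nat \<Rightarrow> real \<Rightarrow> bool" where
  "chain_graph k n e w \<longleftrightarrow> (\<exists>G. strip k G 0 (of_real w) \<and> lip G \<and> (\<forall>v\<in>verts G. Im v \<ge> 0) \<and>
     card (verts G) = n \<and> e \<le> card (edges G))"

definition strip_graph :: "nat \<Rightarrow> nat \<Rightarrow> nat \<Rightarrow> bool" where
  "strip_graph k n e \<longleftrightarrow> (\<exists>G x y. strip k G x y \<and> card (verts G) = n \<and> e \<le> card (edges G))"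

lemma strip_of_chain: "chain_graph k n e w \<Longrightarrow> strip_graph k n e"
  by (auto simp: chain_graph_def strip_graph_def)

lemma strip_graph_glue:
  assumes "k > 0" "strip_graph k n1 e1" "strip_graph k n2 e2"
  shows "strip_graph k (n1 + n2 - 1) (e1 + e2)"
proof -
  obtain G x y where G: "strip k G x y" "card (verts G) = n1" "e1 \<le> card (edges G)"
    using assms(2) by (auto simp: strip_graph_def)
  obtain H x' y' where H: "strip k H x' y'" "card (verts H) = n2" "e2 \<le> card (edges H)"
    using assms(3) by (auto simp: strip_graph_def)
  let ?f = "aff 1 0 1 (y - x')"
  have fx: "?f x' = y" by (simp add: complex_eq_iff)
  have H': "strip k (gimg ?f H) y (?f y')" using strip_gimg[OF H(1), of 1 1 0 "y - x'"] fx by simp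
  show ?thesis
    unfolding strip_graph_def
    using strip_glue[OF assms(1) G(1) H'] card_verts_glue[OF assms(1) G(1) H']
      card_edges_glue[OF assms(1) G(1) H'] G(2,3) H(2,3) card_gimg[of 1 1 0 "y - x'" H]
    by (intro exI[of _ "gun G (gimg ?f H)"] exI[of _ x] exI[of _ "?f y'"] conjI) simp_all
qed

lemma chain_graph_glue:
  assumes "k > 0" "chain_graph k n1 e1 w1" "chain_graph k n2 e2 w2"
  shows "chain_graph k (n1 + n2 - 1) (e1 + e2) (w1 + w2)"
proof -
  obtain G where G: "strip k G 0 (of_real w1)" "lip G" "\<And>v. v \<in> verts G \<Longrightarrow> Im v \<ge> 0"
    "card (verts G) = n1" "e1 \<le> card (edges G)"
    using assms(2) by (auto simp: chain_graph_def)
  obtain H where H: "strip k H 0 (of_real w2)" "lip H" "\<And>v. v \<in> verts H \<Longrightarrow> Im v \<ge> 0"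
    "card (verts H) = n2" "e2 \<le> card (edges H)"
    using assms(3) by (auto simp: chain_graph_def)
  let ?f = "aff 1 0 1 (of_real w1)"
  have f: "?f 0 = of_real w1" "?f (of_real w2) = of_real (w1 + w2)" by (simp_all add: complex_eq_iff)
  have H': "strip k (gimg ?f H) (of_real w1) (of_real (w1 + w2))"
    using strip_gimg[OF H(1), of 1 1 0 "of_real w1"] f by simp
  have gH: "geo H" using H(1) by (simp add: strip_def)
  have "\<forall>v\<in>verts (gun G (gimg ?f H)). Im v \<ge> 0" using G(3) H(3) by auto
  then show ?thesis
    unfolding chain_graph_def
    using strip_glue[OF assms(1) G(1) H'] card_verts_glue[OF assms(1) G(1) H']
      card_edges_glue[OF assms(1) G(1) H'] G(4,5) H(4,5) card_gimg[of 1 1 0 "of_real w1" H]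
      lip_gun[OF G(2) lip_gimg[OF gH H(2)], of 0 1 "of_real w1"]
    by (intro exI[of _ "gun G (gimg ?f H)"] conjI) simp_all
qed

text \<open>The first and the last part of the chain are sheared, so that the chain touches the real axis
  only in its two ends; the ring is closed by a block below the axis.\<close>

lemma strip_graph_ring:
  assumes k: "k \<ge> 2" and "chain_graph k n1 e1 w1" "chain_graph k n2 e2 w2" "chain_graph k n3 e3 w3"
    "chain_graph k n4 e4 w4" and far: "w1 + w2 + w3 \<ge> real k"
  shows "strip_graph k (n1 + n2 + n3 + n4 - 4) (e1 + e2 + e3 + e4)"
proof -
  have k0: "k > 0" using k by simp
  obtain G1 where G1: "strip k G1 0 (of_real w1)" "lip G1" "\<And>v. v \<in> verts G1 \<Longrightarrow> Im v \<ge> 0"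
    "card (verts G1) = n1" "e1 \<le> card (edges G1)"
    using assms(2) by (auto simp: chain_graph_def)
  obtain G2 where G2: "strip k G2 0 (of_real w2)" "lip G2" "\<And>v. v \<in> verts G2 \<Longrightarrow> Im v \<ge> 0"
    "card (verts G2) = n2" "e2 \<le> card (edges G2)"
    using assms(3) by (auto simp: chain_graph_def)
  obtain G3 where G3: "strip k G3 0 (of_real w3)" "lip G3" "\<And>v. v \<in> verts G3 \<Longrightarrow> Im v \<ge> 0"
    "card (verts G3) = n3" "e3 \<le> card (edges G3)"
    using assms(4) by (auto simp: chain_graph_def)
  obtain G4 where G4: "strip k G4 0 (of_real w4)" "\<And>v. v \<in> verts G4 \<Longrightarrow> Im v \<ge> 0"
    "card (verts G4) = n4" "e4 \<le> card (edges G4)"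
    using assms(5) by (auto simp: chain_graph_def)
  have w: "w1 > 0" "w2 > 0" "w3 > 0" "w4 > 0" using G1(1) G2(1) G3(1) G4(1) by (simp_all add: strip_def)
  have g: "geo G1" "geo G2" "geo G3" using G1(1) G2(1) G3(1) by (simp_all add: strip_def)
  define W where "W = w1 + w2 + w3"
  define H1 where "H1 = gimg (aff 1 (1 / w1) 1 0) G1"
  define H2 where "H2 = gimg (aff 1 0 1 (Complex w1 1)) G2"
  define H3 where "H3 = gimg (aff 1 (- 1 / w3) 1 (Complex (w1 + w2) 1)) G3"
  \<comment> \<open>The closing part is reflected below the axis and stretched to the width of the
    other three. This may lengthen its edges horizontally, but the ring argument measures only the
    path through \<open>H\<close>.\<close>
  define B where "B = gimg (aff (W / w4) 0 (-1) 0) G4"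
  have f: "aff 1 (1 / w1) 1 0 0 = 0" "aff 1 (1 / w1) 1 0 (of_real w1) = Complex w1 1"
    "aff 1 0 1 (Complex w1 1) 0 = Complex w1 1"
    "aff 1 0 1 (Complex w1 1) (of_real w2) = Complex (w1 + w2) 1"
    "aff 1 (- 1 / w3) 1 (Complex (w1 + w2) 1) 0 = Complex (w1 + w2) 1"
    "aff 1 (- 1 / w3) 1 (Complex (w1 + w2) 1) (of_real w3) = of_real W"
    "aff (W / w4) 0 (-1) 0 0 = 0" "aff (W / w4) 0 (-1) 0 (of_real w4) = of_real W"
    using w by (simp_all add: complex_eq_iff W_def)
  have s1: "strip k H1 0 (Complex w1 1)"
    using strip_gimg[OF G1(1), of 1 1 "1 / w1" 0] f unfolding H1_def by simp
  have s2: "strip k H2 (Complex w1 1) (Complex (w1 + w2) 1)"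
    using strip_gimg[OF G2(1), of 1 1 0 "Complex w1 1"] f unfolding H2_def by simp
  have s3: "strip k H3 (Complex (w1 + w2) 1) (of_real W)"
    using strip_gimg[OF G3(1), of 1 1 "- 1 / w3" "Complex (w1 + w2) 1"] f unfolding H3_def by simp
  have s4: "strip k B 0 (of_real W)"
    using strip_gimg[OF G4(1), of "W / w4" "-1" 0 0] f w unfolding B_def by (simp add: W_def)
  note s12 = strip_glue[OF k0 s1 s2]
  define H where "H = gun (gun H1 H2) H3"
  have sH: "strip k H 0 (of_real W)" unfolding H_def by (rule strip_glue[OF k0 s12 s3])
  have lip: "lip H" unfolding H_def H1_def H2_def H3_def
    by (intro lip_gun lip_gimg g G1(2) G2(2) G3(2))
  have up: "v = 0 \<or> v = of_real W \<or> Im v > 0" if "v \<in> verts H" for v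
  proof -
    have r1: "u = 0 \<or> Re u > 0" if "u \<in> verts G1" for u using G1(1) that w(1) by (auto simp: strip_def)
    have r3: "u = of_real w3 \<or> Re u < w3" if "u \<in> verts G3" for u
      using G3(1) that w(3) by (auto simp: strip_def)
    from that consider u where "u \<in> verts G1" "v = aff 1 (1 / w1) 1 0 u" | u where "u \<in> verts G2" "v = aff 1 0 1 (Complex w1 1) u"
      | u where "u \<in> verts G3" "v = aff 1 (- 1 / w3) 1 (Complex (w1 + w2) 1) u"
      unfolding H_def H1_def H2_def H3_def by auto
    then show ?thesis
    proof cases
      case 1
      show ?thesis
      proof (cases "u = 0")
        case False
        then have "Re u / w1 > 0" using r1[OF 1(1)] w(1) by simp
        then show ?thesis using 1 G1(3)[OF 1(1)] by simp
      qed (use 1 f in simp)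
    next
      case 2
      then show ?thesis using G2(3)[OF 2(1)] by simp
    next
      case 3
      show ?thesis
      proof (cases "u = of_real w3")
        case False
        then have "Re u / w3 < 1" using r3[OF 3(1)] w(3) by simp
        then show ?thesis using 3 G3(3)[OF 3(1)] by simp
      qed (use 3 f in simp)
    qed
  qed
  have down: "Im v \<le> 0" if "v \<in> verts B" for v using that G4(2) by (auto simp: B_def)
  have W: "Re (of_real W) - Re 0 \<ge> real k" using far by (simp add: W_def)
  note ring = strip_ring[OF k sH s4 lip _ _ W up down] card_verts_ring[OF k sH s4 lip _ _ W up down]
    card_edges_ring[OF k sH s4 lip _ _ W up down]
  have c: "card (verts H1) = n1" "card (verts H2) = n2" "card (verts H3) = n3" "card (verts B) = n4"
    "e1 \<le> card (edges H1)" "e2 \<le> card (edges H2)" "e3 \<le> card (edges H3)" "e4 \<le> card (edges B)"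
    using card_gimg[of 1 1] card_gimg[of "W / w4" "-1"] w G1(4,5) G2(4,5) G3(4,5) G4(3,4)
    by (simp_all add: H1_def H2_def H3_def B_def W_def)
  have "card (verts H) + 2 = n1 + n2 + n3"
    using card_verts_glue[OF k0 s1 s2] card_verts_glue[OF k0 s12 s3] c unfolding H_def by linarith
  moreover have "e1 + e2 + e3 \<le> card (edges H)"
    using card_edges_glue[OF k0 s1 s2] card_edges_glue[OF k0 s12 s3] c unfolding H_def by linarith
  ultimately show ?thesis
    unfolding strip_graph_def using ring c(4,8)
    by (intro exI[of _ "gun H B"] exI[of _ 0] exI[of _ "of_real W"] conjI) simp_all
qed

lemma chain_graph_edge:
  assumes "k \<ge> 3"
  shows "chain_graph k 2 1 1"
proof -
  let ?G = "({0, 1}, {{0, 1}}) :: complex sgraph"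
  have "geo ?G" by (auto simp: geo_def simple_graph_def)
  moreover have "ck_free k (edges ?G)" by (rule ck_free_small[of "{0, 1}"]) (use assms in auto)
  ultimately have "strip k ?G 0 (of_real 1)" by (simp add: strip_def)
  moreover have "lip ?G" by (auto simp: lip_def doubleton_eq_iff)
  ultimately show ?thesis unfolding chain_graph_def by (intro exI[of _ ?G] conjI) auto
qed

text \<open>The covered vertices are \<open>0\<close>, \<open>1\<close> and
  \<open>ax 1, ..., ax (s - 2)\<close>. In a full block the path vertex \<open>ax 0\<close> plays
  the role of a vertex inserted into the face at the edge \<open>{0, 1}\<close>, and
  \<open>ax (s - 1)\<close> that of one inserted into the outer face. For even \<open>k\<close> the
  outer face also receives \<open>ax s\<close>, and \<open>{ax (s - 1), ax s}\<close> is the only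
  uncovered edge.\<close>

lemma chain_graph_block:
  assumes k: "k \<ge> 11" and n: "3 \<le> n" "n \<le> k - 5 + (k - 1) div 2"
  shows "chain_graph k n (3 * n - 6) 1"
proof -
  define s where "s = (k - 1) div 2"
  have s: "s \<ge> 5" "k = 2 * s + 1 \<or> k = 2 * s + 2" using k unfolding s_def by linarith+
  \<comment> \<open>The path is grown first, up to index \<open>k - s - 2\<close>, which is
    \<open>s - 1\<close> for odd \<open>k\<close> and \<open>s\<close> for even \<open>k\<close>;
    faces are filled only when it is complete.\<close>
  define m where "m = min (n - 3) (k - s - 2)"
  define j where "j = n - 3 - m"
  \<comment> \<open>Left faces are filled before right ones; on each side there are
    \<open>s - 3\<close> faces between \<open>ax 1\<close> and \<open>ax (s - 2)\<close>.\<close>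
  define a where "a = min j (s - 3)"
  define b where "b = j - a"
  define pl where "pl i \<longleftrightarrow> 1 \<le> i \<and> i \<le> a" for i :: nat
  define pr where "pr i \<longleftrightarrow> 1 \<le> i \<and> i \<le> b" for i :: nat
  have j: "j \<le> 2 * (s - 3)" using n(2) s unfolding j_def m_def s_def[symmetric] by linarith
  have ab: "a \<le> s - 3" "b \<le> s - 3" "a + b = j" using j unfolding a_def b_def by linarith+
  have jm: "j = 0 \<or> m = k - s - 2"
    by (cases "n - 3 \<le> k - s - 2") (simp_all add: j_def m_def)
  have am: "a = 0 \<or> a < m" "b = 0 \<or> b < m" using jm ab s by linarith+
  have "{i. i < m \<and> pl i} = {1..a}" "{i. i < m \<and> pr i} = {1..b}"
    using am unfolding pl_def pr_def by auto
  then have c: "card {i. i < m \<and> pl i} = a" "card {i. i < m \<and> pr i} = b" by simp_all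
  let ?G = "block pl pr m"
  have mj: "m + j + 3 = n" using n(1) by (simp add: j_def m_def)
  have cV: "card (verts ?G) = n" using card_verts_block[of pl pr m] c ab(3) mj by linarith
  have "3 * (m + a + b) + 3 \<le> card (edges ?G)" using card_edges_block[of m pl pr] c by simp
  moreover have "3 * n - 6 = 3 * (m + a + b) + 3" using ab(3) mj by auto
  ultimately have cE: "3 * n - 6 \<le> card (edges ?G)" by simp
  define S where "S = {0, 1} \<union> ax ` {1..s - 2}"
  define M where "M = (if k = 2 * s + 1 then {} else {{ax (s - 1), ax s}})"
  have "card (ax ` {1..s - 2}) \<le> s - 2" using card_image_le[of "{1..s - 2}" ax] by simp
  then have cS: "card S \<le> s" using card_Un_le[of "{0, 1}" "ax ` {1..s - 2}"] s unfolding S_def by simp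
  have "ck_free k (edges ?G)"
  proof (rule ck_free_cover[of S M])
    show "finite S" "finite M" by (simp_all add: S_def M_def)
    show "3 \<le> k" using k by simp
    show "2 * card S + card M < k" using cS s(2) unfolding M_def by auto
    fix e assume e: "e \<in> edges ?G" "e \<inter> S = {}"
    have nS: "ax i \<notin> e" if "1 \<le> i" "i \<le> s - 2" for i using e(2) that unfolding S_def by auto
    have 01: "0 \<notin> e" "1 \<notin> e" using e(2) unfolding S_def by auto
    have ins: "ax i \<notin> e \<and> ax (Suc i) \<notin> e" if "pl i \<or> pr i" for i
    proof -
      have "1 \<le> i" "Suc i \<le> s - 2" using that ab(1,2) s(1) unfolding pl_def pr_def by linarith+
      then show ?thesis using nS[of i] nS[of "Suc i"] by simp
    qed
    have "\<exists>i<m. e = {ax i, ax (Suc i)}" using block_edge_cases[OF e(1)] 01 ins by blast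
    then obtain i where i: "i < m" "e = {ax i, ax (Suc i)}" by (elim exE conjE)
    have "\<not> (1 \<le> i \<and> i \<le> s - 2)" "\<not> (Suc i \<le> s - 2)"
      using nS[of i] nS[of "Suc i"] i(2) by auto
    then have "i \<ge> s - 1" using s(1) by linarith
    moreover have "i < k - s - 2" using i(1) unfolding m_def by simp
    ultimately have "k = 2 * s + 2" "i = s - 1" using s by linarith+
    then show "e \<in> M" using i(2) s(1) unfolding M_def by simp
  qed
  moreover have v: "v = 0 \<or> v = 1 \<or> 0 < Re v \<and> Re v < 1" "Im v \<ge> 0" if "v \<in> verts ?G" for v
    using that unfolding verts_block by (auto simp: ax_def lc_def rc_def)
  moreover have "0 \<in> verts ?G" "1 \<in> verts ?G" unfolding verts_block by auto
  ultimately have "strip k ?G 0 (of_real 1)" using geo_block by (simp add: strip_def)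
  moreover have "lip ?G"
    unfolding lip_def
  proof (intro allI impI)
    fix u w assume "{u, w} \<in> edges ?G"
    then have "{u, w} \<subseteq> verts ?G" by (rule geo_edge(1)[OF geo_block])
    then have "u \<in> verts ?G" "w \<in> verts ?G" by simp_all
    then show "\<bar>Re u - Re w\<bar> \<le> 1" using v(1)[of u] v(1)[of w] by auto
  qed
  ultimately show ?thesis unfolding chain_graph_def using cV cE v(2)
    by (intro exI[of _ ?G] conjI) simp_all
qed

section \<open>Passage to the extremal number\<close>

text \<open>\<open>ex_planar\<close> ranges over graphs on natural numbers, whereas the
  constructions have points of the plane as vertices. Renaming the vertices keeps all points and
  arcs.\<close>

lemma planar_image:
  assumes "plane_drawing G p \<gamma>" "simple_graph G" "inj_on f (verts G)"
  shows "plane_drawing (gimg f G) (p \<circ> inv_into (verts G) f) (\<lambda>e. \<gamma> (inv_into (verts G) f ` e))"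
proof -
  let ?h = "inv_into (verts G) f"
  have h: "?h (f v) = v" if "v \<in> verts G" for v using assms(3) that by simp
  have hs: "?h ` f ` A = A" if "A \<subseteq> verts G" for A using h that by (force simp: image_image)
  have sub: "e \<subseteq> verts G" if "e \<in> edges G" for e using assms(2) that by (simp add: simple_graph_def)
  have D: "inj_on p (verts G)" "\<And>e. e \<in> edges G \<Longrightarrow> arc (\<gamma> e) \<and> {pathstart (\<gamma> e), pathfinish (\<gamma> e)} = p ` e \<and>
        path_image (\<gamma> e) \<inter> p ` verts G = p ` e"
    "\<And>e e'. e \<in> edges G \<Longrightarrow> e' \<in> edges G \<Longrightarrow> e \<noteq> e' \<Longrightarrow>
        path_image (\<gamma> e) \<inter> path_image (\<gamma> e') \<subseteq> p ` (e \<inter> e')"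
    using assms(1) unfolding plane_drawing_def by auto
  have im: "(p \<circ> ?h) ` f ` A = p ` A" if "A \<subseteq> verts G" for A
    unfolding image_comp[symmetric] hs[OF that] ..
  show ?thesis
    unfolding plane_drawing_def gimg_simps
  proof (intro conjI ballI impI)
    show "inj_on (p \<circ> ?h) (f ` verts G)"
      using D(1) by (intro comp_inj_on inj_on_inv_into) (simp_all add: hs)
  next
    fix e assume "e \<in> (`) f ` edges G"
    then obtain d where d: "e = f ` d" "d \<in> edges G" by (elim imageE)
    show "arc (\<gamma> (?h ` e))" "{pathstart (\<gamma> (?h ` e)), pathfinish (\<gamma> (?h ` e))} = (p \<circ> ?h) ` e"
      "path_image (\<gamma> (?h ` e)) \<inter> (p \<circ> ?h) ` f ` verts G = (p \<circ> ?h) ` e"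
      unfolding d(1) hs[OF sub[OF d(2)]] im[OF sub[OF d(2)]] im[OF subset_refl] using D(2)[OF d(2)]
        by blast+
  next
    fix e e' assume "e \<in> (`) f ` edges G" "e' \<in> (`) f ` edges G" and ne: "e \<noteq> e'"
    then obtain d d' where d: "e = f ` d" "d \<in> edges G" "e' = f ` d'" "d' \<in> edges G" by (elim imageE)
    have "f ` d \<inter> f ` d' = f ` (d \<inter> d')"
      by (rule inj_on_image_Int[OF assms(3) sub[OF d(2)] sub[OF d(4)], symmetric])
    moreover have "d \<inter> d' \<subseteq> verts G" using sub[OF d(2)] by auto
    moreover have "d \<noteq> d'" using ne d by metis
    ultimately show "path_image (\<gamma> (?h ` e)) \<inter> path_image (\<gamma> (?h ` e')) \<subseteq> (p \<circ> ?h) ` (e \<inter> e')"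
      unfolding d(1,3) hs[OF sub[OF d(2)]] hs[OF sub[OF d(4)]] using D(3)[OF d(2,4)] im by simp
  qed
qed

lemma contains_subgraph_image:
  assumes "contains_subgraph (gimg f G) H" "inj_on f (verts G)" "simple_graph G"
  shows "contains_subgraph G H"
proof -
  let ?h = "inv_into (verts G) f"
  obtain g where g: "inj_on g (verts H)" "g ` verts H \<subseteq> f ` verts G" "\<And>e. e \<in> edges H \<Longrightarrow> g ` e \<in> (`) f ` edges G"
    using assms(1) unfolding contains_subgraph_def gimg_simps by auto
  have "inj_on (?h \<circ> g) (verts H)"
    using g(1,2) by (intro comp_inj_on inj_on_inv_into) auto
  moreover have "(?h \<circ> g) ` verts H \<subseteq> verts G"
    using g(2) unfolding image_comp[symmetric] by (auto intro!: inv_into_into)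
  moreover have "(?h \<circ> g) ` e \<in> edges G" if "e \<in> edges H" for e
  proof -
    from g(3)[OF that] obtain d where d: "g ` e = f ` d" "d \<in> edges G" by auto
    have "d \<subseteq> verts G" using d(2) assms(3) by (simp add: simple_graph_def)
    then have "?h ` f ` d = d" using assms(2) by (force simp: image_image)
    then show ?thesis unfolding image_comp[symmetric] d(1) using d(2) by simp
  qed
  ultimately show ?thesis unfolding contains_subgraph_def by blast
qed

abbreviation planar_free_sizes :: "nat \<Rightarrow> 'b sgraph \<Rightarrow> nat set" where
  "planar_free_sizes n H \<equiv> {card (edges G) | G :: nat sgraph.
     simple_graph G \<and> card (verts G) = n \<and> planar G \<and> \<not> contains_subgraph G H}"

lemma finite_planar_free_sizes: "finite (planar_free_sizes n H)"
proof (rule finite_subset)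
  show "planar_free_sizes n H \<subseteq> {..2 ^ n}"
  proof
    fix m assume "m \<in> planar_free_sizes n H"
    then obtain G :: "nat sgraph" where G: "m = card (edges G)" "simple_graph G" "card (verts G) = n"
      by auto
    have "edges G \<subseteq> Pow (verts G)" "finite (verts G)" using G(2) by (auto simp: simple_graph_def)
    then have "card (edges G) \<le> 2 ^ n" using card_mono[of "Pow (verts G)"] G(3) by (simp add: card_Pow)
    then show "m \<in> {..2 ^ n}" using G(1) by simp
  qed
qed simp

lemma strip_graph_planar_free:
  assumes "strip_graph k n e" "k > 0"
  shows "\<exists>m\<in>planar_free_sizes n (cycle_graph k). e \<le> m"
proof -
  obtain G x y where G: "strip k G x y" "card (verts G) = n" "e \<le> card (edges G)"
    using assms(1) unfolding strip_graph_def by blast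
  have g: "geo G" "ck_free k (edges G)" using G(1) unfolding strip_def by blast+
  have simple: "simple_graph G" using g(1) by (simp add: geo_def)
  obtain f :: "complex \<Rightarrow> nat" where f: "inj_on f (verts G)"
    using finite_imp_inj_to_nat_seg[OF geo_finite(1)[OF g(1)]] by blast
  obtain p \<gamma> where "plane_drawing G p \<gamma>" using geo_planar[OF g(1)] unfolding planar_def by blast
  from planar_image[OF this simple f] have pl: "planar (gimg f G)" unfolding planar_def by blast
  have inj: "inj_on ((`) f) (edges G)"
  proof (rule inj_onI)
    fix d d' assume "d \<in> edges G" "d' \<in> edges G" "f ` d = f ` d'"
    then show "d = d'" using inj_on_image_eq_iff[OF f] geo_edge(1)[OF g(1)] by blast
  qed
  have c: "card (verts (gimg f G)) = n" "card (edges (gimg f G)) = card (edges G)"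
    using card_image[OF f] card_image[OF inj] G(2) by simp_all
  have "f ` d \<subseteq> f ` verts G \<and> card (f ` d) = 2" if "d \<in> edges G" for d
    using card_image[OF inj_on_subset[OF f geo_edge(1)[OF g(1) that]]] geo_edge[OF g(1) that] by auto
  then have s: "simple_graph (gimg f G)"
    using geo_finite(1)[OF g(1)] unfolding simple_graph_def gimg_simps by blast
  have "\<not> contains_subgraph (gimg f G) (cycle_graph k)"
    using contains_subgraph_image[OF _ f simple] contains_cycle_graph[OF _ assms(2)] g(2) by blast
  then have "card (edges G) \<in> planar_free_sizes n (cycle_graph k)"
    using pl c s by (intro CollectI exI[of _ "gimg f G"] conjI) simp_all
  then show ?thesis using G(3) by blast
qed

lemma strip_graph_ex_planar:
  assumes "strip_graph k n e" "k > 0"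
  shows "e \<le> ex_planar n (cycle_graph k)"
proof -
  obtain m where m: "m \<in> planar_free_sizes n (cycle_graph k)" "e \<le> m"
    using strip_graph_planar_free[OF assms] by blast
  have "m \<le> ex_planar n (cycle_graph k)"
    unfolding ex_planar_def by (rule Max_ge[OF finite_planar_free_sizes m(1)])
  then show ?thesis using m(2) by simp
qed

text \<open>A strip glued on at a cut vertex contributes one vertex fewer than it has, so the pairs
  of gained vertices and edges simply add up. The pair \<open>(0, 0)\<close> stands for gluing on
  nothing.\<close>

definition vertex_gain :: "nat \<Rightarrow> nat \<Rightarrow> nat \<Rightarrow> bool" where
  "vertex_gain k v e \<longleftrightarrow> v = 0 \<and> e = 0 \<or> strip_graph k (v + 1) e"

lemma vertex_gain_add:
  assumes "k > 0" "vertex_gain k v1 e1" "vertex_gain k v2 e2"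
  shows "vertex_gain k (v1 + v2) (e1 + e2)"
  using assms strip_graph_glue[OF assms(1), of "v1 + 1" e1 "v2 + 1" e2]
  by (auto simp: vertex_gain_def)

lemma vertex_gain_mult:
  assumes "k > 0" "vertex_gain k v e"
  shows "vertex_gain k (c * v) (c * e)"
proof (induction c)
  case 0
  then show ?case by (simp add: vertex_gain_def)
next
  case (Suc c)
  then show ?case using vertex_gain_add[OF assms(1,2)] by simp
qed

lemma chain_graph_mult:
  assumes "k > 0" "chain_graph k (d + 1) e 1"
  shows "chain_graph k (Suc c * d + 1) (Suc c * e) (real (Suc c))"
proof (induction c)
  case 0
  then show ?case using assms(2) by simp
next
  case (Suc c)
  from chain_graph_glue[OF assms(1,2) Suc] show ?case by (simp add: algebra_simps)
qed

section \<open>Gains from blocks and rings\<close>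

context
  fixes k D :: nat
  assumes k: "k \<ge> 11" and D: "D = k - 6 + (k - 1) div 2"
begin

lemma D_ge: "D \<ge> 10"
proof -
  have "(k - 1) div 2 \<ge> 5" using k by linarith
  then show ?thesis using k unfolding D by linarith
qed

lemma chain_graph_le: "2 \<le> d \<Longrightarrow> d \<le> D \<Longrightarrow> chain_graph k (d + 1) (3 * d - 3) 1"
  using chain_graph_block[OF k, of "d + 1"] k by (simp add: D)

lemma vertex_gain_block: "2 \<le> d \<Longrightarrow> d \<le> D \<Longrightarrow> vertex_gain k d (3 * d - 3)"
  using strip_of_chain[OF chain_graph_le] by (simp add: vertex_gain_def)

lemma vertex_gain_one: "vertex_gain k 1 1"
  using strip_of_chain[OF chain_graph_edge] k by (simp add: vertex_gain_def numeral_2_eq_2)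

lemma vertex_gain_rest:
  assumes "b \<le> D"
  shows "\<exists>e. vertex_gain k b e \<and> 3 * b \<le> e + 3"
proof -
  consider "b = 0" | "b = 1" | "2 \<le> b" by linarith
  then show ?thesis
  proof cases
    case 1
    then show ?thesis by (intro exI[of _ 0]) (simp add: vertex_gain_def)
  next
    case 2
    then show ?thesis using vertex_gain_one by (intro exI[of _ 1]) simp
  next
    case 3
    then show ?thesis using vertex_gain_block[OF 3 assms] by (intro exI[of _ "3 * b - 3"]) simp
  qed
qed

text \<open>A chain of \<open>k + 1\<close> blocks has \<open>(k + 1) * D + 1\<close> vertices;
  closing it saves one, and the gain is one less again. One block, a chain of \<open>k - 2\<close>
  blocks and one block reach the width \<open>k\<close>, and the last block closes the ring.\<close>

lemma vertex_gain_ring: "vertex_gain k ((k + 1) * D - 1) ((k + 1) * (3 * D - 3))"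
proof -
  have k0: "k > 0" using k by simp
  define j where "j = k - 3"
  have j: "k = j + 3" using k by (simp add: j_def)
  define t where "t = 3 * D - 3"
  have B: "chain_graph k (D + 1) t 1" using chain_graph_le D_ge by (simp add: t_def)
  have "strip_graph k (D + 1 + (Suc j * D + 1) + (D + 1) + (D + 1) - 4)
      (t + Suc j * t + t + t)"
    by (rule strip_graph_ring[OF _ B chain_graph_mult[OF k0 B] B B]) (use j in auto)
  moreover have "D + 1 + (Suc j * D + 1) + (D + 1) + (D + 1) - 4 = (k + 1) * D - 1 + 1"
    using D_ge by (simp add: j algebra_simps)
  moreover have "t + Suc j * t + t + t = (k + 1) * t" by (simp add: j algebra_simps)
  ultimately have "strip_graph k ((k + 1) * D - 1 + 1) ((k + 1) * t)" by (simp only:)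
  then show ?thesis unfolding vertex_gain_def t_def by (rule disjI2)
qed

text \<open>A ring of \<open>q + 1\<close> blocks, one edge and one triangle. It has as many
  vertices as a chain of \<open>q + 1\<close> blocks and a triangle, since the extra edge uses up
  the saved vertex, but one edge more. The parts other than the closing triangle have width
  \<open>q + 2\<close>, whence the hypothesis.\<close>

lemma vertex_gain_special:
  assumes "q + 2 \<ge> k"
  shows "vertex_gain k ((q + 1) * D + 2) ((q + 1) * (3 * D - 3) + 4)"
proof -
  have k0: "k > 0" using k by simp
  define j where "j = q - 2"
  have j: "q = j + 2" using assms k by (simp add: j_def)
  define t where "t = 3 * D - 3"
  have B: "chain_graph k (D + 1) t 1" using chain_graph_le D_ge by (simp add: t_def)
  have T: "chain_graph k 3 3 1" using chain_graph_le[of 2] D_ge by simp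
  have E: "chain_graph k 2 1 1" using chain_graph_edge k by simp
  have M: "chain_graph k (Suc j * D + 1 + 2 - 1) (Suc j * t + 1) (real (Suc j) + 1)"
    by (rule chain_graph_glue[OF k0 chain_graph_mult[OF k0 B] E])
  have "strip_graph k (D + 1 + (Suc j * D + 1 + 2 - 1) + (D + 1) + 3 - 4) (t + (Suc j * t + 1) + t + 3)"
    by (rule strip_graph_ring[OF _ B M B T]) (use k assms j in auto)
  moreover have "D + 1 + (Suc j * D + 1 + 2 - 1) + (D + 1) + 3 - 4 = (q + 1) * D + 2 + 1"
    by (simp add: j algebra_simps)
  moreover have "t + (Suc j * t + 1) + t + 3 = (q + 1) * t + 4" by (simp add: j algebra_simps)
  ultimately have "strip_graph k ((q + 1) * D + 2 + 1) ((q + 1) * t + 4)" by (simp only:)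
  then show ?thesis unfolding vertex_gain_def t_def by (rule disjI2)
qed

end

section \<open>Counting\<close>

text \<open>Here \<open>K\<close> stands for \<open>k - 1\<close>.\<close>

lemma lower_bound_simplified:
  fixes n q r D K :: real
  assumes "D > 0" "K > 0" "n = q * D + r + 4"
  shows "(3 - (3 - 2 / K) / D) * n + (12 + 3 * r - (8 + 2 * r) / K) / D + 4 / K - m
    = 3 * n - 3 * q + 2 * (q + 2) / K - m"
proof -
  \<comment> \<open>Since \<open>n - (r + 4) = q * D\<close>, the two terms over \<open>D\<close>
    combine to \<open>- a * q\<close>: \<open>a\<close> is the permitted loss per block.\<close>
  define a where "a = 3 - 2 / K"
  have "12 + 3 * r - (8 + 2 * r) / K = (r + 4) * a"
    by (simp add: a_def algebra_simps add_divide_distrib)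
  then have "(12 + 3 * r - (8 + 2 * r) / K) / D = (r + 4) * a / D" by (simp only:)
  moreover have "a / D * n = a * q + (r + 4) * a / D"
    using assms(1) by (simp add: assms(3) field_simps)
  moreover have "a * q = 3 * q - 2 * q / K" by (simp add: a_def algebra_simps)
  moreover have "2 * (q + 2) / K = 2 * q / K + 4 / K" by (simp add: add_divide_distrib algebra_simps)
  moreover have "(3 - a / D) * n = 3 * n - a / D * n" by (simp add: algebra_simps)
  ultimately show ?thesis unfolding a_def[symmetric] by linarith
qed

text \<open>For \<open>q \<le> k\<close> the fraction is at most 3, so chains almost suffice.
  Besides \<open>q\<close> blocks, \<open>r + 3\<close> vertices have to be gained: by one smaller
  or full block if possible, otherwise by a full block with an edge or a triangle. The triangle
  yields \<open>3 n - 3 q - 9\<close>, enough while the fraction is at most 2; beyond that the ring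
  of \<open>vertex_gain_special\<close> supplies the missing edge.\<close>

lemma few_blocks:
  assumes k: "k \<ge> 11" and D: "D = k - 6 + (k - 1) div 2"
    and n: "n = q * D + r + 4" and r: "r < D" and q: "q \<le> k"
  shows "\<exists>e. strip_graph k n e \<and>
    3 * real n - 3 * real q + 2 * (real q + 2) / (real k - 1) - min (real r + 10) 11 \<le> real e"
proof -
  have k0: "k > 0" using k by simp
  have D10: "D \<ge> 10" by (rule D_ge[OF k D])
  have B: "vertex_gain k D (3 * D - 3)" by (rule vertex_gain_block[OF k D]) (use D10 in auto)
  have rD: "real (3 * D - 3) = 3 * real D - 3" using D10 by simp
  have rn: "real n = real q * real D + real r + 4" unfolding n by simp
  have frac: "2 * (real q + 2) / (real k - 1) \<le> x" if "2 * (real q + 2) \<le> x * (real k - 1)" for x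
    using that k by (simp add: pos_divide_le_eq)
  have qk: "real q \<le> real k" "real k \<ge> 11" using q k by simp_all
  have "2 * (x + 2) \<le> 3 * (y - 1)" if "x \<le> y" "11 \<le> y" for x y :: real using that by argo
  from this[OF qk] have fr3: "2 * (real q + 2) / (real k - 1) \<le> 3" by (rule frac)
  have res: ?thesis if e: "vertex_gain k (n - 1) e"
    and "3 * real n - 3 * real q + 2 * (real q + 2) / (real k - 1) - min (real r + 10) 11 \<le> real e" for e
  proof -
    have "n - 1 + 1 = n" "n - 1 \<noteq> 0" using n by simp_all
    with e have "strip_graph k n e" unfolding vertex_gain_def by metis
    then show ?thesis using that(2) by blast
  qed
  consider "r + 3 \<le> D" | "r + 2 = D" | "r + 1 = D" "q + 2 < k" | "r + 1 = D" "q + 2 \<ge> k"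
    using r by linarith
  then show ?thesis
  proof cases
    case 1
    have "vertex_gain k (r + 3) (3 * (r + 3) - 3)" by (rule vertex_gain_block[OF k D]) (use 1 in auto)
    moreover have eq: "q * D + (r + 3) = n - 1" using n by simp
    ultimately have g: "vertex_gain k (n - 1) (q * (3 * D - 3) + (3 * (r + 3) - 3))"
      using vertex_gain_add[OF k0 vertex_gain_mult[OF k0 B, of q], of "r + 3"] by (simp only: eq)
    have "real (q * (3 * D - 3) + (3 * (r + 3) - 3)) = 3 * real n - 3 * real q - 6"
      using rn by (simp only: of_nat_add of_nat_mult rD) (simp add: algebra_simps)
    moreover have "min (real r + 10) 11 \<ge> 10" by simp
    ultimately show ?thesis using fr3 by - (rule res[OF g], linarith)
  next
    case 2
    have eq: "(q + 1) * D + 1 = n - 1" using n 2 by (simp add: algebra_simps)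
    from vertex_gain_add[OF k0 vertex_gain_mult[OF k0 B, of "q + 1"] vertex_gain_one[OF k D]]
    have g: "vertex_gain k (n - 1) ((q + 1) * (3 * D - 3) + 1)" by (simp only: eq)
    have rr: "real r = real D - 2" using 2 by linarith
    have "real ((q + 1) * (3 * D - 3) + 1) = 3 * real n - 3 * real q - 8"
      using rn rr by (simp only: of_nat_add of_nat_mult rD) (simp add: algebra_simps)
    moreover have "min (real r + 10) 11 = 11" using 2 D10 by simp
    ultimately show ?thesis using fr3 by - (rule res[OF g], linarith)
  next
    case 3
    have eq: "(q + 1) * D + 2 = n - 1" using n 3 by (simp add: algebra_simps)
    have "vertex_gain k 2 (3 * 2 - 3)" by (rule vertex_gain_block[OF k D]) (use D10 in auto)
    from vertex_gain_add[OF k0 vertex_gain_mult[OF k0 B, of "q + 1"] this]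
    have g: "vertex_gain k (n - 1) ((q + 1) * (3 * D - 3) + (3 * 2 - 3))" by (simp only: eq)
    have rr: "real r = real D - 1" using 3 by linarith
    have "real ((q + 1) * (3 * D - 3) + (3 * 2 - 3)) = 3 * real n - 3 * real q - 9"
      using rn rr by (simp only: of_nat_add of_nat_mult rD) (simp add: algebra_simps)
    moreover have "min (real r + 10) 11 = 11" using 3 D10 by simp
    moreover have "real (q + 3) \<le> real k" using 3(2) by (simp only: of_nat_le_iff)
    then have "2 * (real q + 2) \<le> 2 * (real k - 1)" by simp
    then have "2 * (real q + 2) / (real k - 1) \<le> 2" by (rule frac)
    ultimately show ?thesis by - (rule res[OF g], linarith)
  next
    case 4
    have eq: "(q + 1) * D + 2 = n - 1" using n 4 by (simp add: algebra_simps)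
    have g: "vertex_gain k (n - 1) ((q + 1) * (3 * D - 3) + 4)"
      using vertex_gain_special[OF k D 4(2)] by (simp only: eq)
    have rr: "real r = real D - 1" using 4 by linarith
    have "real ((q + 1) * (3 * D - 3) + 4) = 3 * real n - 3 * real q - 8"
      using rn rr by (simp only: of_nat_add of_nat_mult rD) (simp add: algebra_simps)
    moreover have "min (real r + 10) 11 = 11" using 4 D10 by simp
    ultimately show ?thesis using fr3 by - (rule res[OF g], linarith)
  qed
qed

text \<open>Every ring of \<open>k + 1\<close> blocks saves three edges compared with a chain of \<open>k + 1\<close> blocks.\<close>

lemma many_blocks:
  assumes k: "k \<ge> 11" and D: "D = k - 6 + (k - 1) div 2"
    and n: "n = q * D + r + 4" and r: "r < D" and q: "q > k"
  shows "\<exists>e. strip_graph k n e \<and>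
    3 * real n - 3 * real q + 2 * (real q + 2) / (real k - 1) - min (real r + 10) 11 \<le> real e"
proof -
  have k0: "k > 0" using k by simp
  have D10: "D \<ge> 10" by (rule D_ge[OF k D])
  define c where "c = q div (k + 1)"
  define q' where "q' = q mod (k + 1)"
  \<comment> \<open>The \<open>r + 3\<close> vertices that \<open>q\<close> blocks leave to be
    gained are joined by the \<open>c\<close> vertices saved by the rings; they are spent on
    \<open>t\<close> further blocks and a partial one.\<close>
  define u where "u = r + 3 + c"
  define t where "t = u div D"
  define b where "b = u mod D"
  have qc: "q = c * (k + 1) + q'" unfolding c_def q'_def by (rule div_mult_mod_eq[symmetric])
  have q'k: "q' \<le> k" unfolding q'_def using mod_less_divisor[of "k + 1" q] by linarith
  have c1: "c \<ge> 1" unfolding c_def using q by (simp add: Suc_le_eq div_greater_zero_iff)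
  have ut: "u = t * D + b" unfolding t_def b_def by simp
  have bD: "b < D" unfolding b_def using D10 by simp
  have B: "vertex_gain k D (3 * D - 3)" by (rule vertex_gain_block[OF k D]) (use D10 in auto)
  \<comment> \<open>The number of these extra blocks, a partial one included; each of them costs at
    most three edges.\<close>
  define T where "T = (if b = 0 then t else t + 1)"
  have "\<exists>e. vertex_gain k b e \<and> 3 * b + 3 * t \<le> e + 3 * T"
  proof (cases "b = 0")
    case True
    then show ?thesis by (intro exI[of _ 0]) (simp add: vertex_gain_def T_def)
  next
    case False
    obtain e where "vertex_gain k b e" "3 * b \<le> e + 3"
      using vertex_gain_rest[OF k D, of b] bD by auto
    then show ?thesis using False by (intro exI[of _ e]) (simp add: T_def)
  qed
  then obtain e0 where e0: "vertex_gain k b e0" "3 * b + 3 * t \<le> e0 + 3 * T" by blast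
  define R where "R = (k + 1) * D - 1"
  have R: "R + 1 = (k + 1) * D" using D10 by (simp add: R_def)
  define e where "e = c * ((k + 1) * (3 * D - 3)) + ((q' + t) * (3 * D - 3) + e0)"
  have "vertex_gain k (c * R + ((q' + t) * D + b)) e"
    unfolding e_def R_def
    by (intro vertex_gain_add[OF k0] vertex_gain_mult[OF k0] vertex_gain_ring[OF k D] B e0(1))
  moreover have "c * R + ((q' + t) * D + b) = n - 1"
  proof -
    have "c * R + c = c * ((k + 1) * D)" using R
      by (metis mult.commute mult_Suc Suc_eq_plus1 add.commute)
    moreover have "(q' + t) * D + b = q' * D + r + 3 + c" using ut u_def by (simp add: algebra_simps)
    moreover have "q * D = c * ((k + 1) * D) + q' * D" unfolding qc by (simp add: algebra_simps)
    ultimately show ?thesis using n by linarith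
  qed
  moreover have "n - 1 + 1 = n" "n - 1 \<noteq> 0" using n by simp_all
  ultimately have g: "strip_graph k n e" unfolding vertex_gain_def by metis
  have rD: "real (3 * D - 3) = 3 * real D - 3" using D10 by simp
  have rn: "real n = real q * real D + real r + 4" unfolding n by simp
  have ru: "real r + 3 + real c = real t * real D + real b"
    using arg_cong[OF ut, of real] unfolding u_def by simp
  have rq: "real q = real c * (real k + 1) + real q'" unfolding qc by (simp add: algebra_simps)
  have "real e = (real c * (real k + 1) + real q' + real t) * (3 * real D - 3) + real e0"
    unfolding e_def by (simp only: of_nat_add of_nat_mult rD) (simp add: algebra_simps)
  also have "\<dots> = 3 * (real q * real D) - 3 * real q + 3 * (real t * real D) - 3 * real t + real e0"
    unfolding rq by (simp add: algebra_simps)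
  finally have "real e = 3 * (real q * real D) - 3 * real q + 3 * (real t * real D) - 3 * real t + real e0" .
  moreover have "3 * real b + 3 * real t \<le> real e0 + 3 * real T" using e0(2) by linarith
  \<comment> \<open>Relative to \<open>3 n - 3 q - 3\<close>, three edges are gained per ring and at
    most three lost per extra block.\<close>
  ultimately have e: "real e \<ge> 3 * real n - 3 - 3 * real q + 3 * real c - 3 * real T"
    using rn ru by linarith
  \<comment> \<open>\<open>T\<close> is \<open>u / D\<close> rounded up. Hence
    \<open>(T - 1) * D \<le> c + 2\<close> if \<open>r = 0\<close>, and
    \<open>(T - 2) * D \<le> c + 1\<close> in general because \<open>r < D\<close>; with
    \<open>D \<ge> 10\<close> this gives the two linear bounds on \<open>T\<close>.\<close>
  have TD: "T * D \<le> u + D - 1" unfolding T_def ut using bD by auto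
  have T1: "r = 0 \<Longrightarrow> 10 * T \<le> 12 + c"
  proof -
    assume r0: "r = 0"
    show "10 * T \<le> 12 + c"
    proof (cases "T \<le> 1")
      case False
      then obtain T' where T': "T = T' + 1" by (metis add.commute le_add_diff_inverse nat_le_linear)
      have "T' * D \<le> c + 2" using TD unfolding T' u_def r0 by simp
      moreover have "T' * 10 \<le> T' * D" using D10 by simp
      ultimately have "T' * 10 \<le> c + 2" by (rule order_trans[rotated])
      then show ?thesis unfolding T' by simp
    qed simp
  qed
  have T2: "10 * T \<le> 21 + c"
  proof (cases "T \<le> 2")
    case False
    then have "T = (T - 2) + 2" by simp
    then obtain T' where T': "T = T' + 2" by blast
    have "T' * D + 2 * D \<le> r + 3 + c + D - 1" using TD unfolding T' u_def by (simp add: algebra_simps)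
    then have "T' * D \<le> c + 1" using r by linarith
    moreover have "T' * 10 \<le> T' * D" using D10 by simp
    ultimately have "T' * 10 \<le> c + 1" by (rule order_trans[rotated])
    then show ?thesis unfolding T' by simp
  qed simp
  have frac: "2 * (real q + 2) / (real k - 1) \<le> x" if "2 * (real q + 2) \<le> x * (real k - 1)" for x
    using that k by (simp add: pos_divide_le_eq)
  have ck: "real c * 10 \<le> real c * (real k - 1)" using k by (intro mult_left_mono) auto
  have q2: "2 * (real q + 2) \<le> 2 * (real c * (real k - 1)) + 4 * real c + 2 * real k + 4"
    using q'k unfolding rq by (simp add: algebra_simps)
  have k11: "real k \<ge> 11" using k by simp
  \<comment> \<open>This uses \<open>q \<le> c * (k + 1) + k\<close>. The coefficients are the
    values at \<open>k = 11\<close>: \<open>12/5 = 2 * (k + 1) / (k - 1)\<close> and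
    \<open>13/5 = (2 * k + 4) / (k - 1)\<close>.\<close>
  have f: "2 * (real q + 2) / (real k - 1) \<le> 12/5 * real c + 13/5"
  proof (rule frac)
    have "(12/5 * real c + 13/5) * (real k - 1) =
        2 * (real c * (real k - 1)) + 2/5 * (real c * (real k - 1)) + 13/5 * (real k - 1)"
      by (simp add: field_simps)
    moreover have "x \<le> 2 * p + 2/5 * p + 13/5 * (y - 1)"
      if "x \<le> 2 * p + 4 * z + 2 * y + 4" "z * 10 \<le> p" "11 \<le> y" for p x y z :: real
      using that by argo
    note this[OF q2 ck k11]
    ultimately show "2 * (real q + 2) \<le> (12/5 * real c + 13/5) * (real k - 1)" by (simp only:)
  qed
  have "3 * real n - 3 * real q + 2 * (real q + 2) / (real k - 1) - min (real r + 10) 11 \<le> real e"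
  proof (cases "r = 0")
    case True
    have "10 * real T \<le> 12 + real c" using T1[OF True] by linarith
    moreover have "min (real r + 10) 11 = 10" using True by simp
    ultimately show ?thesis using e f by linarith
  next
    case False
    then have m: "min (real r + 10) 11 = 11" by simp
    have T2r: "10 * real T \<le> 21 + real c" using T2 by linarith
    \<comment> \<open>From three rings on the linear bound on \<open>T\<close> suffices; for one or
      two rings it must be sharpened by integrality to \<open>T \<le> 2\<close>.\<close>
    consider "c \<ge> 3" | "c = 1 \<or> c = 2" using c1 by linarith
    then show ?thesis
    proof cases
      case 1
      then show ?thesis using e f m T2r by linarith
    next
      case 2
      then have "T \<le> 2" using T2 by linarith
      then have "real T \<le> 2" by simp
      moreover have "real c \<ge> 1" using c1 by simp
      ultimately show ?thesis using e f m by linarith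
    qed
  qed
  then show ?thesis using g by blast
qed

theorem theorem2p1:
  fixes n k r :: nat
  assumes "k \<ge> 11" and "n \<ge> k"
    and "r = (n - 4) mod (k - 6 + (k - 1) div 2)"
  shows "(n \<le> k - 5 + (k - 1) div 2 \<longrightarrow> ex_planar n (cycle_graph k) = 3 * n - 6) \<and>
    (n \<ge> k - 4 + (k - 1) div 2 \<longrightarrow>
      real (ex_planar n (cycle_graph k)) \<ge>
        (3 - (3 - 2 / (real k - 1)) / (real k - 6 + real ((k - 1) div 2))) * real n
        + (12 + 3 * real r - (8 + 2 * real r) / (real k - 1))
            / (real k - 6 + real ((k - 1) div 2))
        + 4 / (real k - 1)
        - min (real r + 10) 11)"
proof (intro conjI impI)
  assume n: "n \<le> k - 5 + (k - 1) div 2"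
  have k0: "k > 0" using assms(1) by simp
  have S: "strip_graph k n (3 * n - 6)"
    using strip_of_chain[OF chain_graph_block[OF assms(1) _ n]] assms(1,2) by simp
  \<comment> \<open>\<open>Max\<close> is attained because the set of edge numbers is finite and,
    thanks to the block, nonempty; so the upper bound can be applied to an extremal graph.\<close>
  have "ex_planar n (cycle_graph k) \<in> planar_free_sizes n (cycle_graph k)"
    unfolding ex_planar_def
    by (rule Max_in[OF finite_planar_free_sizes]) (use strip_graph_planar_free[OF S k0] in blast)
  then obtain G :: "nat sgraph" where G: "ex_planar n (cycle_graph k) = card (edges G)"
    "simple_graph G" "card (verts G) = n" "planar G" by blast
  have "card (edges G) \<le> 3 * n - 6" using planar_edge_bound[OF G(2,4)] G(3) assms(1,2) by simp
  then show "ex_planar n (cycle_graph k) = 3 * n - 6"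
    using strip_graph_ex_planar[OF S k0] G(1) by simp
next
  define D where "D = k - 6 + (k - 1) div 2"
  define q where "q = (n - 4) div D"
  have k0: "k > 0" using assms(1) by simp
  have D10: "D \<ge> 10" by (rule D_ge[OF assms(1) D_def])
  have r: "r = (n - 4) mod D" using assms(3) unfolding D_def .
  have rD: "r < D" unfolding r using D10 by simp
  have n: "n = q * D + r + 4" unfolding q_def r using assms(1,2) by simp
  obtain e where e: "strip_graph k n e"
    "3 * real n - 3 * real q + 2 * (real q + 2) / (real k - 1) - min (real r + 10) 11 \<le> real e"
    using few_blocks[OF assms(1) D_def n rD] many_blocks[OF assms(1) D_def n rD] by (cases "q \<le> k") auto
  have Dr: "real k - 6 + real ((k - 1) div 2) = real D" using assms(1) unfolding D_def by simp
  have "real e \<le> real (ex_planar n (cycle_graph k))" using strip_graph_ex_planar[OF e(1) k0] by simp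
  moreover have "real n = real q * real D + real r + 4" unfolding n by simp
  ultimately show "real (ex_planar n (cycle_graph k)) \<ge>
        (3 - (3 - 2 / (real k - 1)) / (real k - 6 + real ((k - 1) div 2))) * real n
        + (12 + 3 * real r - (8 + 2 * real r) / (real k - 1))
            / (real k - 6 + real ((k - 1) div 2))
        + 4 / (real k - 1)
        - min (real r + 10) 11"
    using e(2) lower_bound_simplified[of "real D" "real k - 1" "real n" "real q" "real r" "min (real r + 10) 11"]
      D10 assms(1) unfolding Dr by simp
qed

end
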